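(* Let $\Omega\subset\mathbb{P}(\mathbb{R}^{d+1})$ be a properly convex domain and let $\mathcal{PS}^\Omega:=\{[x,y] : x,y\in\Omega\}$ be the geodesic path system of projective line segments on $(\Omega,d_\Omega)$. Then $\gamma\in\mathrm{Aut}(\Omega)$ is a contracting element for $(\Omega,\mathcal{PS}^\Omega)$ if and only if $\gamma$ is a rank one isometry.
   Context: A properly convex domain is a nonempty open set $\Omega\subset\mathbb{P}(\mathbb{R}^{d+1})$ such that some affine chart contains $\overline\Omega$ and in it $\Omega$ is a bounded convex set. For $x,y\in\overline\Omega$, $[x,y]\subset\overline\Omega$ is the closed projective line segment joining them, and $(x,y)=[x,y]\setminus\{x,y\}$. The Hilbert metric is $d_\Omega(x,y)=\frac12\log\frac{|b-x||y-a|}{|b-y||x-a|}$, where $a,b\in\partial\Omega$ are the endpoints of the intersection of $\overline\Omega$ with the projective line through $x\ne y$, ordered $a,x,y,b$ (computed in an affine chart containing $\overline{\Omega}$). $\mathrm{Aut}(\Omega)=\{g\in\mathrm{PGL}_{d+1}(\mathbb{R}): g\Omega=\Omega\}$ acts properly and isometrically on $(\Omega,d_\Omega)$. Rank one isometry: $\gamma\in\mathrm{Aut}(\Omega)$ is a rank one isometry if (a) $\tau_\Omega(\gamma):=\inf_{x\in\Omega}d_\Omega(x,\gamma x)>0$; (b) $\gamma$ has an axis, i.e. a non-trivial (open) projective line segment of the form $\mathbb{P}(V)\cap\Omega$ with $V\le\mathbb{R}^{d+1}$ a two-dimensional $\gamma$-invariant linear subspace; (c) no axis $(a,b)$ of $\gamma$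 ($a,b\in\partial\Omega$) is contained in a half triangle in $\Omega$, i.e. there is no $z\in\partial\Omega$ with $[a,z]\cup[z,b]\subset\partial\Omega$. Contracting subset (Sisto): $\mathcal{A}\subset\Omega$ is $\mathcal{PS}^\Omega$-contracting with constant $C$ if there is a map $\pi_{\mathcal A}:\Omega\to\mathcal{A}$ such that (1) $d_\Omega(x,\pi_{\mathcal A}(x))\le C$ for all $x\in\mathcal{A}$; (2) if $x,y\in\Omega$ and $d_\Omega(\pi_{\mathcal A}(x),\pi_{\mathcal A}(y))\ge C$, then $d_\Omega([x,y],\pi_{\mathcal A}(x))\le C$ and $d_\Omega([x,y],\pi_{\mathcal A}(y))\le C$. Contracting element (Sisto): $g\in\mathrm{Aut}(\Omega)$ is a contracting element for $(\Omega,\mathcal{PS}^\Omega)$ if for some (hence any) $x_0\in\Omega$: (1) $g$ has infinite order and $n\mapsto g^nx_0$ is a quasi-isometric embedding of $\mathbb{Z}$ into $\Omega$; (2) there is a $\langle g\rangle$-invariant subset $\mathcal{A}\subset\Omega$ containing $x_0$ that is $\mathcal{PS}^\Omega$-contracting (for some constant) and on which $\langle g\rangle$ acts co-boundedly. *)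

theory Defs
  imports "HOL-Analysis.Analysis" "HOL-Algebra.Coset" "HOL-Algebra.Generated_Groups"
begin

section \<open>The projective space P(R^(d+1)), where d + 1 = CARD('n)\<close>

typedef (overloaded) 'n proj = "{L :: (real ^ 'n::finite) set. subspace L \<and> dim L = 1}"
proof -
  have "span {axis undefined 1 :: real ^ 'n} \<in> {L. subspace L \<and> dim L = 1}"
    by (simp add: dim_insert axis_eq_0_iff)
  then show ?thesis by blast
qed

text \<open>\<open>proj_of v\<close> is the line spanned by \<open>v\<close>; it is meaningful only for \<open>v \<noteq> 0\<close>.\<close>

definition proj_of :: "real ^ 'n::finite \<Rightarrow> 'n proj" where
  "proj_of v = Abs_proj (span {v})"

lemma Rep_proj_of: "v \<noteq> 0 \<Longrightarrow> Rep_proj (proj_of v) = span {v}"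
  unfolding proj_of_def by (subst Abs_proj_inverse) (simp_all add: dim_insert)

text \<open>The quotient topology of the nonzero vectors.\<close>

instantiation proj :: (finite) topological_space
begin

definition open_proj :: "'a proj set \<Rightarrow> bool" where
  "open_proj U \<longleftrightarrow> open {v. v \<noteq> 0 \<and> proj_of v \<in> U}"

instance
proof
  have "{v :: real ^ 'a. v \<noteq> 0} = - {0}"
    by auto
  then show "open (UNIV :: 'a proj set)"
    by (simp add: open_proj_def open_Compl)
next
  fix S T :: "'a proj set"
  assume "open S" "open T"
  then have "open ({v. v \<noteq> 0 \<and> proj_of v \<in> S} \<inter> {v. v \<noteq> 0 \<and> proj_of v \<in> T})"
    unfolding open_proj_def by (rule open_Int)
  moreover have "{v. v \<noteq> 0 \<and> proj_of v \<in> S} \<inter> {v. v \<noteq> 0 \<and> proj_of v \<in> T}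
      = {v. v \<noteq> 0 \<and> proj_of v \<in> S \<inter> T}"
    by auto
  ultimately show "open (S \<inter> T)"
    by (simp add: open_proj_def)
next
  fix K :: "'a proj set set"
  assume "\<forall>S\<in>K. open S"
  then have "open (\<Union>S\<in>K. {v. v \<noteq> 0 \<and> proj_of v \<in> S})"
    unfolding open_proj_def by blast
  moreover have "(\<Union>S\<in>K. {v. v \<noteq> 0 \<and> proj_of v \<in> S}) = {v. v \<noteq> 0 \<and> proj_of v \<in> \<Union>K}"
    by auto
  ultimately show "open (\<Union>K)"
    by (simp add: open_proj_def)
qed

end

definition proj_subspace :: "(real ^ 'n::finite) set \<Rightarrow> 'n proj set" where
  "proj_subspace V = {x. Rep_proj x \<subseteq> V}"

definition proj_line :: "'n::finite proj \<Rightarrow> 'n proj \<Rightarrow> 'n proj set" where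
  "proj_line x y = proj_subspace (span (Rep_proj x \<union> Rep_proj y))"


section \<open>Affine charts and properly convex domains\<close>

text \<open>The functional \<open>w \<mapsto> u \<bullet> w\<close> with \<open>u \<noteq> 0\<close> determines an affine chart: the complement
  of the projective hyperplane of its kernel, identified with the affine hyperplane
  \<open>{w. u \<bullet> w = 1}\<close>.\<close>

definition affine_chart :: "real ^ 'n::finite \<Rightarrow> 'n proj set" where
  "affine_chart u = - proj_subspace {w. u \<bullet> w = 0}"

definition chart_coord :: "real ^ 'n::finite \<Rightarrow> 'n proj \<Rightarrow> real ^ 'n" where
  "chart_coord u x = (THE w. w \<in> Rep_proj x \<and> u \<bullet> w = 1)"

definition adapted_chart :: "'n::finite proj set \<Rightarrow> real ^ 'n \<Rightarrow> bool" where
  "adapted_chart \<Omega> u \<longleftrightarrow> u \<noteq> 0 \<and> closure \<Omega> \<subseteq> affine_chart u \<and>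
     convex (chart_coord u ` \<Omega>) \<and> bounded (chart_coord u ` \<Omega>)"

definition properly_convex_domain :: "'n::finite proj set \<Rightarrow> bool" where
  "properly_convex_domain \<Omega> \<longleftrightarrow> \<Omega> \<noteq> {} \<and> open \<Omega> \<and> (\<exists>u. adapted_chart \<Omega> u)"

text \<open>Segments and the Hilbert metric are computed in one fixed adapted chart; they do not
  depend on which one is chosen.\<close>

definition coord :: "'n::finite proj set \<Rightarrow> 'n proj \<Rightarrow> real ^ 'n" where
  "coord \<Omega> = chart_coord (SOME u. adapted_chart \<Omega> u)"

definition proj_segment :: "'n::finite proj set \<Rightarrow> 'n proj \<Rightarrow> 'n proj \<Rightarrow> 'n proj set" where
  "proj_segment \<Omega> x y = proj_of ` closed_segment (coord \<Omega> x) (coord \<Omega> y)"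

definition open_proj_segment :: "'n::finite proj set \<Rightarrow> 'n proj \<Rightarrow> 'n proj \<Rightarrow> 'n proj set" where
  "open_proj_segment \<Omega> x y = proj_segment \<Omega> x y - {x, y}"


section \<open>The Hilbert metric\<close>

text \<open>The last two conjuncts say that \<open>a, x, y, b\<close> lie in this order.\<close>

definition chord_ends :: "'n::finite proj set \<Rightarrow> 'n proj \<Rightarrow> 'n proj \<Rightarrow> 'n proj \<Rightarrow> 'n proj \<Rightarrow> bool" where
  "chord_ends \<Omega> x y a b \<longleftrightarrow> a \<in> frontier \<Omega> \<and> b \<in> frontier \<Omega> \<and>
     proj_line x y \<inter> closure \<Omega> = proj_segment \<Omega> a b \<and>
     x \<in> proj_segment \<Omega> a y \<and> y \<in> proj_segment \<Omega> x b"

definition hilbert_dist :: "'n::finite proj set \<Rightarrow> 'n proj \<Rightarrow> 'n proj \<Rightarrow> real" where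
  "hilbert_dist \<Omega> x y = (if x = y then 0 else
     (THE r. \<exists>a b. chord_ends \<Omega> x y a b \<and>
        r = 1 / 2 * ln ((norm (coord \<Omega> b - coord \<Omega> x) * norm (coord \<Omega> y - coord \<Omega> a)) /
                        (norm (coord \<Omega> b - coord \<Omega> y) * norm (coord \<Omega> x - coord \<Omega> a)))))"

definition hilbert_setdist :: "'n::finite proj set \<Rightarrow> 'n proj set \<Rightarrow> 'n proj \<Rightarrow> real" where
  "hilbert_setdist \<Omega> S p = (INF z\<in>S. hilbert_dist \<Omega> z p)"


section \<open>The projective linear group and its action\<close>

definition GL :: "(real ^ 'n::finite ^ 'n) monoid" where
  "GL = \<lparr>carrier = {A. invertible A}, mult = (**), one = mat 1\<rparr>"

definition scalars :: "(real ^ 'n::finite ^ 'n) set" where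
  "scalars = {c *\<^sub>R mat 1 | c. c \<noteq> 0}"

definition PGL :: "(real ^ 'n::finite ^ 'n) set monoid" where
  "PGL = GL Mod scalars"

text \<open>An element of \<open>PGL\<close> is a coset \<open>{c A | c \<noteq> 0}\<close>, so that the set on the right-hand side is
  the image of the line \<open>x\<close> under \<open>A\<close>.\<close>

definition pgl_act :: "(real ^ 'n::finite ^ 'n) set \<Rightarrow> 'n proj \<Rightarrow> 'n proj" where
  "pgl_act g x = Abs_proj {A *v v | A v. A \<in> g \<and> v \<in> Rep_proj x}"

lemma scaleR_mat_mult:
  fixes A :: "real ^ 'n::finite ^ 'n" and v :: "real ^ 'n"
  shows "(c *\<^sub>R mat 1) ** A = c *\<^sub>R A" "A ** (c *\<^sub>R mat 1) = c *\<^sub>R A"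
    and "(c *\<^sub>R A) *v v = c *\<^sub>R (A *v v)"
  by (simp_all add: scalar_matrix_assoc[symmetric] matrix_scalar_ac scaleR_matrix_vector_assoc)

lemma scalars_mem: "B \<in> scalars \<longleftrightarrow> (\<exists>c. c \<noteq> 0 \<and> B = c *\<^sub>R mat 1)"
  by (auto simp: scalars_def)

lemma scalars_r_coset: "scalars #>\<^bsub>GL\<^esub> A = {c *\<^sub>R A | c. c \<noteq> 0}"
  by (auto simp: r_coset_def scalars_def GL_def scaleR_mat_mult)

lemma scalars_l_coset: "A <#\<^bsub>GL\<^esub> scalars = {c *\<^sub>R A | c. c \<noteq> 0}"
  by (auto simp: l_coset_def scalars_def GL_def scaleR_mat_mult)

lemma invertible_mat_1: "invertible (mat 1 :: real ^ 'n::finite ^ 'n)"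
  unfolding invertible_def by (rule exI[of _ "mat 1"]) simp

lemma group_GL: "group (GL :: (real ^ 'n::finite ^ 'n) monoid)"
proof (rule groupI)
  fix A :: "real ^ 'n ^ 'n"
  assume "A \<in> carrier GL"
  then obtain B where "A ** B = mat 1" "B ** A = mat 1"
    by (auto simp: GL_def invertible_def)
  then show "\<exists>B\<in>carrier GL. B \<otimes>\<^bsub>GL\<^esub> A = \<one>\<^bsub>GL\<^esub>"
    by (auto simp: GL_def invertible_def)
qed (auto simp: GL_def invertible_mult matrix_mul_assoc invertible_mat_1)

lemma normal_scalars: "normal scalars (GL :: (real ^ 'n::finite ^ 'n) monoid)"
proof -
  interpret G: group "GL :: (real ^ 'n ^ 'n) monoid" by (rule group_GL)
  have "subgroup scalars (GL :: (real ^ 'n ^ 'n) monoid)"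
  proof (rule G.subgroupI)
    show "scalars \<subseteq> carrier (GL :: (real ^ 'n ^ 'n) monoid)"
      by (auto simp: scalars_def GL_def intro: scalar_invertible invertible_mat_1)
    show "(scalars :: (real ^ 'n ^ 'n) set) \<noteq> {}"
      by (auto simp: scalars_def)
  next
    fix A :: "real ^ 'n ^ 'n"
    assume "A \<in> scalars"
    then obtain c where c: "c \<noteq> 0" "A = c *\<^sub>R mat 1"
      by (auto simp: scalars_mem)
    have "inv\<^bsub>GL\<^esub> A = inverse c *\<^sub>R mat 1"
      by (rule G.inv_equality)
        (use c in \<open>auto simp: GL_def scaleR_mat_mult intro: scalar_invertible invertible_mat_1\<close>)
    then show "inv\<^bsub>GL\<^esub> A \<in> scalars"
      using c by (auto simp: scalars_mem intro!: exI[of _ "inverse c"])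
  next
    fix A B :: "real ^ 'n ^ 'n"
    assume "A \<in> scalars" "B \<in> scalars"
    then obtain c d where "c \<noteq> 0" "A = c *\<^sub>R mat 1" "d \<noteq> 0" "B = d *\<^sub>R mat 1"
      by (auto simp: scalars_mem)
    then show "A \<otimes>\<^bsub>GL\<^esub> B \<in> scalars"
      by (auto simp: scalars_mem GL_def scaleR_mat_mult intro!: exI[of _ "c * d"])
  qed
  then show ?thesis
    by (rule G.normalI) (simp add: scalars_r_coset scalars_l_coset)
qed

lemma group_PGL: "group (PGL :: (real ^ 'n::finite ^ 'n) set monoid)"
  unfolding PGL_def by (rule normal.factorgroup_is_group[OF normal_scalars])

lemma pgl_act_proj_of:
  fixes A :: "real ^ 'n::finite ^ 'n"
  assumes "v \<noteq> 0"
  shows "pgl_act (scalars #>\<^bsub>GL\<^esub> A) (proj_of v) = proj_of (A *v v)"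
proof -
  have "{B *v w | B w. B \<in> scalars #>\<^bsub>GL\<^esub> A \<and> w \<in> span {v}} = span {A *v v}"
  proof (intro subset_antisym subsetI)
    fix x assume "x \<in> {B *v w | B w. B \<in> scalars #>\<^bsub>GL\<^esub> A \<and> w \<in> span {v}}"
    then show "x \<in> span {A *v v}"
      by (auto simp: scalars_r_coset span_singleton scaleR_mat_mult matrix_vector_mult_scaleR
          intro!: image_eqI)
  next
    fix x assume "x \<in> span {A *v v}"
    then obtain k where k: "x = A *v (k *\<^sub>R v)"
      by (auto simp: span_singleton matrix_vector_mult_scaleR)
    have "A \<in> scalars #>\<^bsub>GL\<^esub> A"
      by (auto simp: scalars_r_coset intro!: exI[of _ 1])
    with k show "x \<in> {B *v w | B w. B \<in> scalars #>\<^bsub>GL\<^esub> A \<and> w \<in> span {v}}"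
      by (auto simp: span_singleton)
  qed
  then show ?thesis
    unfolding pgl_act_def Rep_proj_of[OF assms] by (simp add: proj_of_def)
qed

definition Aut :: "'n::finite proj set \<Rightarrow> (real ^ 'n ^ 'n) set set" where
  "Aut \<Omega> = {g \<in> carrier PGL. pgl_act g ` \<Omega> = \<Omega>}"


section \<open>Rank one isometries\<close>

definition translation_length :: "'n::finite proj set \<Rightarrow> (real ^ 'n ^ 'n) set \<Rightarrow> real" where
  "translation_length \<Omega> g = (INF x\<in>\<Omega>. hilbert_dist \<Omega> x (pgl_act g x))"

text \<open>The open segment from \<open>a\<close> to \<open>b\<close> is an axis of \<open>g\<close>.\<close>

definition is_axis :: "'n::finite proj set \<Rightarrow> (real ^ 'n ^ 'n) set \<Rightarrow> 'n proj \<Rightarrow> 'n proj \<Rightarrow> bool" where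
  "is_axis \<Omega> g a b \<longleftrightarrow> a \<in> frontier \<Omega> \<and> b \<in> frontier \<Omega> \<and> a \<noteq> b \<and>
     (\<exists>V. subspace V \<and> dim V = 2 \<and> (\<forall>A\<in>g. (\<lambda>v. A *v v) ` V \<subseteq> V) \<and>
          proj_subspace V \<inter> \<Omega> = open_proj_segment \<Omega> a b)"

definition in_half_triangle :: "'n::finite proj set \<Rightarrow> 'n proj \<Rightarrow> 'n proj \<Rightarrow> bool" where
  "in_half_triangle \<Omega> a b \<longleftrightarrow>
     (\<exists>z\<in>frontier \<Omega>. proj_segment \<Omega> a z \<union> proj_segment \<Omega> z b \<subseteq> frontier \<Omega>)"

definition rank_one_isometry :: "'n::finite proj set \<Rightarrow> (real ^ 'n ^ 'n) set \<Rightarrow> bool" where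
  "rank_one_isometry \<Omega> g \<longleftrightarrow> g \<in> Aut \<Omega> \<and>
     translation_length \<Omega> g > 0 \<and>
     (\<exists>a b. is_axis \<Omega> g a b) \<and>
     (\<forall>a b. is_axis \<Omega> g a b \<longrightarrow> \<not> in_half_triangle \<Omega> a b)"


section \<open>Contracting elements\<close>

definition PS_contracting :: "'n::finite proj set \<Rightarrow> real \<Rightarrow> 'n proj set \<Rightarrow> bool" where
  "PS_contracting \<Omega> C A \<longleftrightarrow> A \<subseteq> \<Omega> \<and> (\<exists>\<pi>. \<pi> ` \<Omega> \<subseteq> A \<and>
     (\<forall>x\<in>A. hilbert_dist \<Omega> x (\<pi> x) \<le> C) \<and>
     (\<forall>x\<in>\<Omega>. \<forall>y\<in>\<Omega>. hilbert_dist \<Omega> (\<pi> x) (\<pi> y) \<ge> C \<longrightarrow>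
        hilbert_setdist \<Omega> (proj_segment \<Omega> x y) (\<pi> x) \<le> C \<and>
        hilbert_setdist \<Omega> (proj_segment \<Omega> x y) (\<pi> y) \<le> C))"

definition qi_embedded_orbit :: "'n::finite proj set \<Rightarrow> (real ^ 'n ^ 'n) set \<Rightarrow> 'n proj \<Rightarrow> bool" where
  "qi_embedded_orbit \<Omega> g x0 \<longleftrightarrow> (\<exists>K L. K \<ge> 1 \<and> L \<ge> 0 \<and> (\<forall>m n :: int.
     let r = hilbert_dist \<Omega> (pgl_act (g [^]\<^bsub>PGL\<^esub> m) x0) (pgl_act (g [^]\<^bsub>PGL\<^esub> n) x0) in
     1 / K * \<bar>real_of_int m - real_of_int n\<bar> - L \<le> r \<and>
     r \<le> K * \<bar>real_of_int m - real_of_int n\<bar> + L))"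

text \<open>Some subset \<open>B\<close> of \<open>A\<close> of finite Hilbert diameter has translates covering \<open>A\<close>.\<close>

definition acts_coboundedly :: "'n::finite proj set \<Rightarrow> (real ^ 'n ^ 'n) set set \<Rightarrow> 'n proj set \<Rightarrow> bool" where
  "acts_coboundedly \<Omega> H A \<longleftrightarrow> (\<exists>B\<subseteq>A. (\<exists>R. \<forall>x\<in>B. \<forall>y\<in>B. hilbert_dist \<Omega> x y \<le> R) \<and>
     A = (\<Union>h\<in>H. pgl_act h ` B))"

definition contracting_element :: "'n::finite proj set \<Rightarrow> (real ^ 'n ^ 'n) set \<Rightarrow> bool" where
  "contracting_element \<Omega> g \<longleftrightarrow> g \<in> Aut \<Omega> \<and> (\<exists>x0\<in>\<Omega>.
     infinite (generate PGL {g}) \<and> qi_embedded_orbit \<Omega> g x0 \<and>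
     (\<exists>A. x0 \<in> A \<and> A \<subseteq> \<Omega> \<and> (\<forall>h\<in>generate PGL {g}. pgl_act h ` A = A) \<and>
          (\<exists>C. PS_contracting \<Omega> C A) \<and> acts_coboundedly \<Omega> (generate PGL {g}) A))"

end

(* Over Omega lies an open convex cone, and the Hilbert distance of x and y is half the logarithm of
   the supremum of the cross ratios (f x * g y) / (f y * g x) over the functionals f, g of the dual cone.

   If gamma is contracting, the segments between points of an orbit stay near the orbit. So the
   orbit accumulates at boundary points whose cross ratios with their images are bounded, and
   Brouwer's theorem replaces them by eigenvectors a, b that span an axis. Suppose that a, b, z is
   a half triangle, and let f1 vanish on [a,z] and f2 on [z,b]. The Lipschitz function
   ln (f2 / f1) is almost preserved by the projection to the orbit. It takes distant values at
   points arbitrarily close to z, so the segment between such points would have to pass near a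
   fixed orbit point, although it tends to z.

   If gamma is a rank one isometry, Brouwer's theorem gives eigenfunctionals fa, fb in the dual
   cone with fa b = 0 and fb a = 0. As there is no half triangle, fa and fb vanish on the closed
   cone only on the rays of b and a. Then x |-> fa(x) a + fb(x) b is a projection to the axis; it is
   contracting by compactness, since gamma acts cocompactly on the axis. *)

theory Submission
  imports Defs
begin

section \<open>Open convex cones and the Hilbert metric\<close>

text \<open>The end points of an axis lie on the boundary, where the Hilbert distance is infinite;
  cross ratio bounds bridge this gap. For fixed \<open>y\<close>, \<open>f\<close>, \<open>g\<close>
  the bound \<open>HB E v y\<close> is a linear inequality in \<open>v\<close>, so it cuts out
  compact convex subsets of the base, as Brouwer's theorem requires. Moreover, a bound between two
  nonzero boundary vectors makes the same dual functionals vanish on both: an eigenvector that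
  replaces a limit point stays on its face, and the segment between the new points still runs
  through the domain. A vector of the closed cone is interior iff no nonzero dual functional
  vanishes on it. So a segment between boundary points \<open>x\<close> and \<open>y\<close> enters
  the domain iff \<open>x + y\<close> is interior, and axes and half triangles become conditions on
  \<open>a + b\<close>, \<open>a + z\<close> and \<open>z + b\<close>. The projection of a
  contracting element is an arbitrary, possibly discontinuous map. It is encoded as an integer index
  that is only coarsely Lipschitz, and intermediate values come from the connectedness of
  [0, 1].\<close>

locale convex_open_cone =
  fixes Cn :: "'a::euclidean_space set" and u :: 'a
  assumes open_Cn: "open Cn" and Cn_ne: "Cn \<noteq> {}" and zero_notin: "0 \<notin> Cn"
    and Cn_add: "x \<in> Cn \<Longrightarrow> y \<in> Cn \<Longrightarrow> x + y \<in> Cn"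
    and Cn_scale: "x \<in> Cn \<Longrightarrow> 0 < s \<Longrightarrow> s *\<^sub>R x \<in> Cn"
    and Cn_bound: "\<exists>M>0. \<forall>x\<in>Cn. norm x \<le> M * (u \<bullet> x)"
begin

definition K :: "'a set" where "K = closure Cn"

definition dual :: "'a set" where "dual = {f. \<forall>v\<in>Cn. 0 \<le> f \<bullet> v}"

text \<open>\<open>HB E x y\<close> bounds by \<open>E\<close> the cross ratios whose supremum determines the Hilbert distance.
  Unlike the distance, it makes sense at the boundary of the cone and passes to limits.\<close>

definition HB :: "real \<Rightarrow> 'a \<Rightarrow> 'a \<Rightarrow> bool" where
  "HB E x y \<longleftrightarrow> (\<forall>f\<in>dual. \<forall>g\<in>dual. (f \<bullet> x) * (g \<bullet> y) \<le> E * ((f \<bullet> y) * (g \<bullet> x)))"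

text \<open>The least admissible \<open>E\<close> is the supremum of the cross ratios; the infimum
  avoids quotients whose denominators may vanish.\<close>

definition hd :: "'a \<Rightarrow> 'a \<Rightarrow> real" where
  "hd x y = 1 / 2 * ln (Inf {E. HB E x y})"

lemma Cn_subset_K: "x \<in> Cn \<Longrightarrow> x \<in> K"
  unfolding K_def using closure_subset by blast

lemma closed_K: "closed K" by (simp add: K_def)

section \<open>The closed cone\<close>

lemma K_seqI: assumes "\<And>n::nat. X n \<in> K" "X \<longlonglongrightarrow> x" shows "x \<in> K"
  using closed_K assms closed_sequentially by blast

lemma K_add:
  assumes "x \<in> K" "y \<in> K" shows "x + y \<in> K"
proof -
  obtain X Y where X: "\<And>n::nat. X n \<in> Cn" "X \<longlonglongrightarrow> x" and Y: "\<And>n::nat. Y n \<in> Cn" "Y \<longlonglongrightarrow> y"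
    using assms unfolding K_def closure_sequential by blast
  have "(\<lambda>n. X n + Y n) \<longlonglongrightarrow> x + y" using X Y by (intro tendsto_add)
  moreover have "\<And>n. X n + Y n \<in> Cn" using X Y Cn_add by blast
  ultimately show ?thesis using K_seqI[of "\<lambda>n. X n + Y n"] Cn_subset_K by blast
qed

lemma K_scale_pos:
  assumes "x \<in> K" "0 < s" shows "s *\<^sub>R x \<in> K"
proof -
  obtain X where X: "\<And>n::nat. X n \<in> Cn" "X \<longlonglongrightarrow> x"
    using assms unfolding K_def closure_sequential by blast
  have "(\<lambda>n. s *\<^sub>R X n) \<longlonglongrightarrow> s *\<^sub>R x" using X by (intro tendsto_intros)
  moreover have "\<And>n. s *\<^sub>R X n \<in> Cn" using X Cn_scale assms by blast
  ultimately show ?thesis using K_seqI[of "\<lambda>n. s *\<^sub>R X n"] Cn_subset_K by blast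
qed

lemma zero_in_K: "0 \<in> K"
proof -
  obtain v where v: "v \<in> Cn" using Cn_ne by blast
  have "(\<lambda>n. inverse (real (Suc n)) *\<^sub>R v) \<longlonglongrightarrow> 0 *\<^sub>R v"
    by (intro tendsto_intros LIMSEQ_inverse_real_of_nat)
  moreover have "\<And>n. inverse (real (Suc n)) *\<^sub>R v \<in> Cn" using v by (intro Cn_scale) auto
  ultimately show ?thesis unfolding K_def using K_seqI[of "\<lambda>n. inverse (real (Suc n)) *\<^sub>R v"] Cn_subset_K by (metis K_def scaleR_zero_left)
qed

lemma K_scale: "x \<in> K \<Longrightarrow> 0 \<le> s \<Longrightarrow> s *\<^sub>R x \<in> K"
  using K_scale_pos[of x s] zero_in_K by (cases "s = 0") auto

lemma convex_Cn: "convex Cn"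
proof (rule convexI)
  fix x y :: 'a and s t :: real
  assume "x \<in> Cn" "y \<in> Cn" "0 \<le> s" "0 \<le> t" "s + t = 1"
  then show "s *\<^sub>R x + t *\<^sub>R y \<in> Cn"
    by (cases "s = 0"; cases "t = 0") (auto intro!: Cn_add Cn_scale)
qed

lemma convex_K: "convex K" unfolding K_def by (intro convex_closure convex_Cn)

text \<open>\<open>y\<close> is only a limit of points \<open>Y n\<close> of the open cone, but the
  error \<open>y - Y n\<close> can be absorbed by \<open>x\<close>, which is interior.\<close>

lemma Cn_K_add:
  assumes "x \<in> Cn" "y \<in> K" shows "x + y \<in> Cn"
proof -
  obtain Y where Y: "\<And>n::nat. Y n \<in> Cn" "Y \<longlonglongrightarrow> y"
    using assms unfolding K_def closure_sequential by blast
  have "(\<lambda>n. x + (y - Y n)) \<longlonglongrightarrow> x + (y - y)" using Y by (intro tendsto_intros)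
  then have "\<forall>\<^sub>F n in sequentially. x + (y - Y n) \<in> Cn"
    using open_Cn assms by (auto dest!: topological_tendstoD)
  then obtain n where "x + (y - Y n) \<in> Cn" by (auto simp: eventually_sequentially)
  from Cn_add[OF this Y(1)[of n]] show ?thesis by simp
qed

text \<open>\<open>Cn_bound\<close> says that the domain is bounded in the chart. It passes to the
  closure, where it forces \<open>u\<close> to be positive on nonzero vectors and makes slices
  compact.\<close>

lemma K_bound: obtains M where "0 < M" "\<And>x. x \<in> K \<Longrightarrow> norm x \<le> M * (u \<bullet> x)"
proof -
  obtain M where M: "0 < M" "\<forall>x\<in>Cn. norm x \<le> M * (u \<bullet> x)" using Cn_bound by blast
  have "closed {x. norm x \<le> M * (u \<bullet> x)}" by (intro closed_Collect_le continuous_intros)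
  then have "K \<subseteq> {x. norm x \<le> M * (u \<bullet> x)}"
    unfolding K_def using M by (intro closure_minimal) auto
  then show ?thesis using that M by blast
qed

lemma u_pos: assumes "x \<in> K" "x \<noteq> 0" shows "0 < u \<bullet> x"
proof -
  obtain M where M: "0 < M" "\<And>x. x \<in> K \<Longrightarrow> norm x \<le> M * (u \<bullet> x)" using K_bound by blast
  have "0 < norm x" using assms by simp
  also have "\<dots> \<le> M * (u \<bullet> x)" using M assms by blast
  finally show ?thesis using M by (simp add: zero_less_mult_iff)
qed

lemma u_nonneg: "x \<in> K \<Longrightarrow> 0 \<le> u \<bullet> x"
  using u_pos[of x] by (cases "x = 0") auto

lemma u_dual: "u \<in> dual" by (simp add: dual_def u_nonneg Cn_subset_K)

lemma Cn_nz: "x \<in> Cn \<Longrightarrow> x \<noteq> 0" using zero_notin by blast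

lemma u_pos_Cn: "x \<in> Cn \<Longrightarrow> 0 < u \<bullet> x" by (simp add: u_pos Cn_nz Cn_subset_K)

lemma K_add_nz: assumes "x \<in> K" "y \<in> K" "x \<noteq> 0" shows "x + y \<noteq> 0"
  using u_pos[OF assms(1,3)] u_nonneg[OF assms(2)]
  by (metis add_pos_nonneg inner_add_right inner_zero_right less_irrefl)

section \<open>Dual functionals and interior points\<close>

lemma dual_K: "f \<in> dual \<Longrightarrow> x \<in> K \<Longrightarrow> 0 \<le> f \<bullet> x"
proof -
  assume f: "f \<in> dual" and x: "x \<in> K"
  have "closed {x. 0 \<le> f \<bullet> x}" by (intro closed_Collect_le continuous_intros)
  then have "K \<subseteq> {x. 0 \<le> f \<bullet> x}"
    unfolding K_def using f by (intro closure_minimal) (auto simp: dual_def)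
  then show ?thesis using x by blast
qed

lemma Cn_small_perturb: assumes "x \<in> Cn" obtains e where "0 < e" "x + e *\<^sub>R y \<in> Cn"
proof -
  have "((\<lambda>e. x + e *\<^sub>R y) \<longlongrightarrow> x + 0 *\<^sub>R y) (at_right 0)" by (intro tendsto_intros)
  then have "\<forall>\<^sub>F e in at_right (0::real). x + e *\<^sub>R y \<in> Cn"
    using open_Cn assms by (auto dest!: topological_tendstoD)
  then obtain b where "b > 0" "\<And>e. 0 < e \<Longrightarrow> e < b \<Longrightarrow> x + e *\<^sub>R y \<in> Cn"
    unfolding eventually_at_right_field by blast
  then show thesis using that[of "b/2"] by simp
qed

text \<open>An interior point can be moved a little in the direction \<open>- f\<close>, which would
  make the value negative if it were zero at \<open>x\<close>.\<close>

lemma dual_pos: assumes "f \<in> dual" "f \<noteq> 0" "x \<in> Cn" shows "0 < f \<bullet> x"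
proof -
  obtain e where e: "0 < e" "x + e *\<^sub>R (- f) \<in> Cn" using Cn_small_perturb[OF assms(3)] by blast
  have "0 \<le> f \<bullet> (x + e *\<^sub>R (- f))" using e assms(1) by (auto simp: dual_def)
  moreover have "0 < e * (f \<bullet> f)" using e assms(2) by simp
  ultimately show ?thesis by (simp add: inner_diff_right)
qed

text \<open>The constant \<open>b\<close> of the separating hyperplane disappears by homogeneity:
  multiples of a single point of the cone would otherwise violate the separation.\<close>

lemma support: assumes "v \<notin> Cn" obtains f where "f \<in> dual" "f \<noteq> 0" "f \<bullet> v \<le> 0"
proof -
  have "\<exists>a b. a \<noteq> 0 \<and> (\<forall>x\<in>{v}. a \<bullet> x \<le> b) \<and> (\<forall>x\<in>Cn. b \<le> a \<bullet> x)"
    using assms Cn_ne convex_Cn by (intro separating_hyperplane_sets) auto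
  then obtain a b where ab: "a \<noteq> 0" "a \<bullet> v \<le> b" "\<And>x. x \<in> Cn \<Longrightarrow> b \<le> a \<bullet> x" by auto
  have *: "b \<le> s * (a \<bullet> x)" if "x \<in> Cn" "0 < s" for x s
    using ab(3)[OF Cn_scale[OF that]] by simp
  have "0 \<le> a \<bullet> x" if x: "x \<in> Cn" for x
  proof (rule ccontr)
    assume n: "\<not> 0 \<le> a \<bullet> x"
    have "b \<le> ((\<bar>b\<bar> + 1) / - (a \<bullet> x)) * (a \<bullet> x)" using n by (intro * x divide_pos_pos) auto
    also have "\<dots> = - (\<bar>b\<bar> + 1)" using n by simp
    finally show False by linarith
  qed
  moreover have "b \<le> 0"
  proof (rule ccontr)
    assume n: "\<not> b \<le> 0"
    obtain x where x: "x \<in> Cn" using Cn_ne by blast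
    have p: "0 < a \<bullet> x" using ab(3)[OF x] n by simp
    have "b \<le> (b / (2 * (a \<bullet> x))) * (a \<bullet> x)" using n p by (intro * x divide_pos_pos) auto
    also have "\<dots> = b / 2" using p by simp
    finally show False using n by simp
  qed
  ultimately show thesis using that[of a] ab by (auto simp: dual_def)
qed

lemma support_K: assumes "v \<in> K" "v \<notin> Cn" obtains f where "f \<in> dual" "f \<noteq> 0" "f \<bullet> v = 0"
  using support[OF assms(2)] dual_K[OF _ assms(1)] by (metis order_antisym)

lemma Cn_iff: assumes "x \<in> K" shows "x \<in> Cn \<longleftrightarrow> (\<forall>f\<in>dual. f \<bullet> x = 0 \<longrightarrow> f = 0)"
  using dual_pos support_K[OF assms] by (metis less_irrefl)

text \<open>Whether a combination with positive coefficients is interior depends only on the dual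
  functionals that vanish on both summands, hence not on the coefficients.\<close>

lemma Cn_of_sum: assumes "x \<in> K" "y \<in> K" "0 < s" "0 < t" "s *\<^sub>R x + t *\<^sub>R y \<in> Cn" shows "x + y \<in> Cn"
proof -
  have xy: "x + y \<in> K" using assms K_add by blast
  have "f = 0" if f: "f \<in> dual" "f \<bullet> (x + y) = 0" for f
  proof -
    have "f \<bullet> x = 0 \<and> f \<bullet> y = 0"
      using f dual_K[OF f(1) assms(1)] dual_K[OF f(1) assms(2)]
      by (simp add: inner_add_right add_nonneg_eq_0_iff)
    then have "f \<bullet> (s *\<^sub>R x + t *\<^sub>R y) = 0" by (simp add: inner_add_right)
    then show ?thesis using dual_pos[OF f(1) _ assms(5)] by force
  qed
  then show ?thesis using Cn_iff[OF xy] by blast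
qed

lemma Cn_of_sum': assumes "x \<in> K" "y \<in> K" "0 < s" "0 < t" "x + y \<in> Cn" shows "s *\<^sub>R x + t *\<^sub>R y \<in> Cn"
proof -
  have "inverse s *\<^sub>R (s *\<^sub>R x) + inverse t *\<^sub>R (t *\<^sub>R y) \<in> Cn" using assms by simp
  have "s *\<^sub>R x + t *\<^sub>R y \<in> Cn"
    by (rule Cn_of_sum[of _ _ "inverse s" "inverse t"]) (use assms K_scale in auto)
  then show ?thesis .
qed

subsection \<open>Bounds on cross ratios\<close>

lemma HB_D: "HB E x y \<Longrightarrow> f \<in> dual \<Longrightarrow> g \<in> dual \<Longrightarrow> (f \<bullet> x) * (g \<bullet> y) \<le> E * ((f \<bullet> y) * (g \<bullet> x))"
  by (simp add: HB_def)

lemma HB_sym: "HB E x y \<Longrightarrow> HB E y x"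
proof -
  assume h: "HB E x y"
  show ?thesis unfolding HB_def
  proof (intro ballI)
    fix f g assume "f \<in> dual" "g \<in> dual"
    then show "(f \<bullet> y) * (g \<bullet> x) \<le> E * ((f \<bullet> x) * (g \<bullet> y))"
      using HB_D[OF h, of g f] by (simp add: mult.commute)
  qed
qed

lemma HB_scale_left: "0 < s \<Longrightarrow> HB E (s *\<^sub>R x) y \<longleftrightarrow> HB E x y"
proof -
  assume s: "0 < s"
  have "(f \<bullet> (s *\<^sub>R x)) * (g \<bullet> y) \<le> E * ((f \<bullet> y) * (g \<bullet> (s *\<^sub>R x))) \<longleftrightarrow>
      s * ((f \<bullet> x) * (g \<bullet> y)) \<le> s * (E * ((f \<bullet> y) * (g \<bullet> x)))" for f g
    by (simp add: algebra_simps)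
  then show ?thesis using s by (simp add: HB_def)
qed

lemma HB_scale: "0 < s \<Longrightarrow> 0 < t \<Longrightarrow> HB E (s *\<^sub>R x) (t *\<^sub>R y) \<longleftrightarrow> HB E x y"
  using HB_scale_left[of s E x "t *\<^sub>R y"] HB_scale_left[of t E y x] HB_sym[of E x "t *\<^sub>R y"]
    HB_sym[of E "t *\<^sub>R y" x] HB_sym[of E x y] HB_sym[of E y x] by blast

lemma HB_mono: assumes "HB E x y" "E \<le> F" "x \<in> K" "y \<in> K" shows "HB F x y"
  unfolding HB_def
proof (intro ballI)
  fix f g assume fg: "f \<in> dual" "g \<in> dual"
  have "(f \<bullet> x) * (g \<bullet> y) \<le> E * ((f \<bullet> y) * (g \<bullet> x))" using HB_D[OF assms(1) fg] .
  also have "\<dots> \<le> F * ((f \<bullet> y) * (g \<bullet> x))"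
    using fg assms by (intro mult_right_mono) (auto intro!: mult_nonneg_nonneg dual_K)
  finally show "(f \<bullet> x) * (g \<bullet> y) \<le> F * ((f \<bullet> y) * (g \<bullet> x))" .
qed

lemma HB_ge1: assumes "HB E x y" "x \<in> K" "y \<in> K" "x \<noteq> 0" "y \<noteq> 0" shows "1 \<le> E"
proof -
  have p: "0 < u \<bullet> x" "0 < u \<bullet> y" using assms u_pos by auto
  have "(u \<bullet> x) * (u \<bullet> y) \<le> E * ((u \<bullet> y) * (u \<bullet> x))" using HB_D[OF assms(1) u_dual u_dual] .
  then have "1 * ((u \<bullet> y) * (u \<bullet> x)) \<le> E * ((u \<bullet> y) * (u \<bullet> x))" by (simp add: mult.commute)
  then show ?thesis using p by (simp only: mult_le_cancel_right) (simp add: zero_less_mult_iff not_less)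
qed

lemma HB_refl: "1 \<le> E \<Longrightarrow> x \<in> K \<Longrightarrow> HB E x x"
proof -
  assume E: "1 \<le> E" and x: "x \<in> K"
  have "1 * ((f \<bullet> x) * (g \<bullet> x)) \<le> E * ((f \<bullet> x) * (g \<bullet> x))" if "f \<in> dual" "g \<in> dual" for f g
    using E that x by (intro mult_right_mono) (auto intro!: mult_nonneg_nonneg dual_K)
  then show ?thesis by (simp add: HB_def)
qed

text \<open>Multiply the two bounds and cancel the values at \<open>y\<close>. They are positive as
  \<open>y\<close> is interior, while \<open>x\<close> and \<open>z\<close> may lie on the
  boundary.\<close>

lemma HB_trans:
  assumes "HB E x y" "HB F y z" "x \<in> K" "y \<in> Cn" "z \<in> K" "0 \<le> E" "0 \<le> F" shows "HB (E * F) x z"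
  unfolding HB_def
proof (intro ballI)
  fix f g assume fg: "f \<in> dual" "g \<in> dual"
  show "(f \<bullet> x) * (g \<bullet> z) \<le> E * F * ((f \<bullet> z) * (g \<bullet> x))"
  proof (cases "f = 0 \<or> g = 0")
    case False
    have p: "0 < f \<bullet> y" "0 < g \<bullet> y" using False fg assms dual_pos by auto
    have "((f \<bullet> x) * (g \<bullet> y)) * ((f \<bullet> y) * (g \<bullet> z)) \<le> (E * ((f \<bullet> y) * (g \<bullet> x))) * (F * ((f \<bullet> z) * (g \<bullet> y)))"
      using assms fg Cn_subset_K
      by (intro mult_mono HB_D) (auto intro!: mult_nonneg_nonneg dual_K)
    then have "((f \<bullet> x) * (g \<bullet> z)) * ((f \<bullet> y) * (g \<bullet> y)) \<le> (E * F * ((f \<bullet> z) * (g \<bullet> x))) * ((f \<bullet> y) * (g \<bullet> y))"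
      by (simp add: mult_ac)
    then show ?thesis using p by (simp add: mult_le_cancel_right not_less zero_less_mult_iff del: mult.assoc)
  qed auto
qed

text \<open>Taking \<open>g = u\<close> bounds \<open>f \<bullet> x\<close> by a multiple of
  \<open>f \<bullet> y\<close>. With \<open>HB_sym\<close>, a cross ratio bound puts two nonzero
  vectors on the same face of the closed cone.\<close>

lemma HB_face:
  assumes "HB E x y" "x \<in> K" "y \<in> K" "y \<noteq> 0" "f \<in> dual" "f \<bullet> y = 0" shows "f \<bullet> x = 0"
proof -
  have "(f \<bullet> x) * (u \<bullet> y) \<le> 0" using HB_D[OF assms(1,5) u_dual] assms by simp
  then show ?thesis using u_pos[OF assms(3,4)] dual_K[OF assms(5,2)] by (simp add: mult_le_0_iff)
qed

lemma HB_Cn: assumes "HB E x y" "x \<in> K" "y \<in> Cn" "x \<noteq> 0" shows "x \<in> Cn"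
proof -
  have "f = 0" if "f \<in> dual" "f \<bullet> x = 0" for f
    using HB_face[OF HB_sym[OF assms(1)] Cn_subset_K[OF assms(3)] assms(2,4) that] dual_pos[OF that(1) _ assms(3)]
    by force
  then show ?thesis using Cn_iff[OF assms(2)] by blast
qed

lemma HB_tendsto:
  assumes "X \<longlonglongrightarrow> x" "Y \<longlonglongrightarrow> y" "\<And>n::nat. HB E (X n) (Y n)" shows "HB E x y"
  unfolding HB_def
proof (intro ballI)
  fix f g assume fg: "f \<in> dual" "g \<in> dual"
  show "(f \<bullet> x) * (g \<bullet> y) \<le> E * ((f \<bullet> y) * (g \<bullet> x))"
    by (rule LIMSEQ_le[of "\<lambda>n. (f \<bullet> X n) * (g \<bullet> Y n)" _ "\<lambda>n. E * ((f \<bullet> Y n) * (g \<bullet> X n))"])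
       (use HB_D[OF assms(3) fg] in \<open>auto intro!: tendsto_intros assms(1,2)\<close>)
qed

text \<open>For fixed \<open>f\<close>, \<open>g\<close> and \<open>x\<close> the inequality is
  linear in the second argument; so a ball around \<open>x\<close> contains the segment from
  \<open>x\<close> to each of its points.\<close>

lemma HB_segment:
  assumes "HB E x y" "x \<in> K" "y \<in> K" "1 \<le> E" "0 \<le> s" "0 \<le> t" shows "HB E x (s *\<^sub>R x + t *\<^sub>R y)"
  unfolding HB_def
proof (intro ballI)
  fix f g assume fg: "f \<in> dual" "g \<in> dual"
  have "(f \<bullet> x) * (g \<bullet> x) \<le> E * ((f \<bullet> x) * (g \<bullet> x))" using HB_refl[OF assms(4,2)] fg by (rule HB_D)
  moreover have "(f \<bullet> x) * (g \<bullet> y) \<le> E * ((f \<bullet> y) * (g \<bullet> x))" using assms(1) fg by (rule HB_D)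
  ultimately have "s * ((f \<bullet> x) * (g \<bullet> x)) + t * ((f \<bullet> x) * (g \<bullet> y))
     \<le> s * (E * ((f \<bullet> x) * (g \<bullet> x))) + t * (E * ((f \<bullet> y) * (g \<bullet> x)))"
    using assms by (intro add_mono mult_left_mono)
  then show "(f \<bullet> x) * (g \<bullet> (s *\<^sub>R x + t *\<^sub>R y)) \<le> E * ((f \<bullet> (s *\<^sub>R x + t *\<^sub>R y)) * (g \<bullet> x))"
    by (simp add: inner_add_right algebra_simps)
qed

text \<open>The constant 3 is 3/2 times 2: interiority of \<open>3 y - 2 z\<close> gives
  \<open>2 f z \<le> 3 f y\<close>, and interiority of \<open>2 z - y\<close> gives
  \<open>g y \<le> 2 g z\<close>.\<close>

lemma HB_near:
  assumes "y \<in> Cn" shows "\<forall>\<^sub>F z in nhds y. HB 3 z y"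
proof -
  have "\<forall>\<^sub>F z in nhds y. y + 2 *\<^sub>R (z - y) \<in> Cn \<and> y - 2 *\<^sub>R (z - y) \<in> Cn"
  proof (rule eventually_conj)
    have "((\<lambda>z. y + 2 *\<^sub>R (z - y)) \<longlongrightarrow> y + 2 *\<^sub>R (y - y)) (nhds y)"
      by (intro tendsto_intros filterlim_ident)
    then show "\<forall>\<^sub>F z in nhds y. y + 2 *\<^sub>R (z - y) \<in> Cn"
      using open_Cn assms by (auto dest!: topological_tendstoD)
    have "((\<lambda>z. y - 2 *\<^sub>R (z - y)) \<longlongrightarrow> y - 2 *\<^sub>R (y - y)) (nhds y)"
      by (intro tendsto_intros filterlim_ident)
    then show "\<forall>\<^sub>F z in nhds y. y - 2 *\<^sub>R (z - y) \<in> Cn"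
      using open_Cn assms by (auto dest!: topological_tendstoD)
  qed
  then show ?thesis
  proof (rule eventually_mono)
    fix z assume z: "y + 2 *\<^sub>R (z - y) \<in> Cn \<and> y - 2 *\<^sub>R (z - y) \<in> Cn"
    show "HB 3 z y" unfolding HB_def
    proof (intro ballI)
      fix f g assume fg: "f \<in> dual" "g \<in> dual"
      have 1: "2 * (f \<bullet> z) \<le> 3 * (f \<bullet> y)"
        using z fg by (auto simp: dual_def inner_add_right inner_diff_right)
      have 2: "g \<bullet> y \<le> 2 * (g \<bullet> z)"
        using z fg by (fastforce simp: dual_def inner_add_right inner_diff_right)
      have "(2 * (f \<bullet> z)) * (g \<bullet> y) \<le> (3 * (f \<bullet> y)) * (2 * (g \<bullet> z))"
        using 1 2 dual_K[OF fg(1) Cn_subset_K[OF assms]] dual_K[OF fg(2) Cn_subset_K[OF assms]]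
        by (intro mult_mono[of "2 * (f \<bullet> z)"]) linarith+
      then show "(f \<bullet> z) * (g \<bullet> y) \<le> 3 * ((f \<bullet> y) * (g \<bullet> z))" by simp
    qed
  qed
qed

lemma dominate: assumes "x \<in> Cn" obtains e where "0 < e" "\<And>f. f \<in> dual \<Longrightarrow> e * (f \<bullet> y) \<le> f \<bullet> x"
proof -
  obtain e where e: "0 < e" "x + e *\<^sub>R (- y) \<in> Cn" using Cn_small_perturb[OF assms] by blast
  have "e * (f \<bullet> y) \<le> f \<bullet> x" if "f \<in> dual" for f
    using that e by (fastforce simp: dual_def inner_diff_right)
  then show thesis using e that by blast
qed

lemma HB_ex: assumes "x \<in> Cn" "y \<in> Cn" obtains E where "1 \<le> E" "HB E x y"
proof -
  obtain d where d: "0 < d" "\<And>f. f \<in> dual \<Longrightarrow> d * (f \<bullet> y) \<le> f \<bullet> x" using dominate[OF assms(1)] by blast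
  obtain e where e: "0 < e" "\<And>f. f \<in> dual \<Longrightarrow> e * (f \<bullet> x) \<le> f \<bullet> y" using dominate[OF assms(2)] by blast
  have "HB (1 / (d * e)) x y" unfolding HB_def
  proof (intro ballI)
    fix f g assume fg: "f \<in> dual" "g \<in> dual"
    have "(e * (f \<bullet> x)) * (d * (g \<bullet> y)) \<le> (f \<bullet> y) * (g \<bullet> x)"
      using d e fg assms by (intro mult_mono) (auto intro!: mult_nonneg_nonneg dual_K Cn_subset_K)
    then show "(f \<bullet> x) * (g \<bullet> y) \<le> 1 / (d * e) * ((f \<bullet> y) * (g \<bullet> x))"
      using d(1) e(1) by (simp add: field_simps)
  qed
  then show thesis using that HB_ge1 assms Cn_subset_K Cn_nz by metis
qed

subsection \<open>The Hilbert metric of the cone\<close>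

text \<open>The set of admissible \<open>E\<close> is closed and upward closed, so its infimum is
  attained. Through this equivalence the metric inherits its properties from \<open>HB\<close>; the
  factor 2 undoes the 1 / 2 in the metric.\<close>

lemma hd_le_iff: assumes "x \<in> Cn" "y \<in> Cn" shows "hd x y \<le> r \<longleftrightarrow> HB (exp (2 * r)) x y"
proof -
  let ?S = "{E. HB E x y}"
  let ?I = "Inf ?S"
  have xy: "x \<in> K" "y \<in> K" "x \<noteq> 0" "y \<noteq> 0" using assms Cn_subset_K Cn_nz by auto
  have ne: "?S \<noteq> {}" using HB_ex[OF assms] by blast
  have lb: "1 \<le> E" if "E \<in> ?S" for E using HB_ge1 that xy by blast
  have bdd: "bdd_below ?S" using lb by (intro bdd_belowI)
  have I1: "1 \<le> ?I" using lb ne by (intro cInf_greatest)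
  have cl: "?S = (\<Inter>f\<in>dual. \<Inter>g\<in>dual. {E. (f \<bullet> x) * (g \<bullet> y) \<le> E * ((f \<bullet> y) * (g \<bullet> x))})"
    by (auto simp: HB_def)
  have "closed ?S" unfolding cl by (intro closed_INT ballI closed_Collect_le continuous_intros)
  then have IS: "HB ?I x y" using closed_contains_Inf[OF ne bdd] by blast
  have "HB E x y \<longleftrightarrow> ?I \<le> E" for E
    using cInf_lower[OF _ bdd] HB_mono[OF IS _ xy(1,2)] by blast
  moreover have "hd x y \<le> r \<longleftrightarrow> ?I \<le> exp (2 * r)"
    using I1 ln_le_cancel_iff[of ?I "exp (2 * r)"] by (auto simp: hd_def)
  ultimately show ?thesis by blast
qed

lemma hd_eqI: assumes "x \<in> Cn" "y \<in> Cn" "0 < E" "\<And>F. HB F x y \<longleftrightarrow> E \<le> F"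
  shows "hd x y = 1 / 2 * ln E"
proof (rule antisym)
  show "hd x y \<le> 1 / 2 * ln E" unfolding hd_le_iff[OF assms(1,2)] assms(4) using assms(3) by simp
  have "HB (exp (2 * hd x y)) x y" unfolding hd_le_iff[OF assms(1,2), symmetric] by simp
  then have "ln E \<le> ln (exp (2 * hd x y))" unfolding assms(4) using assms(3) by (subst ln_le_cancel_iff) auto
  then show "1 / 2 * ln E \<le> hd x y" by simp
qed

lemma hd_HB: "x \<in> Cn \<Longrightarrow> y \<in> Cn \<Longrightarrow> hd x y \<le> r \<Longrightarrow> HB (exp (2 * r)) x y"
  by (simp add: hd_le_iff)

lemma hd_nonneg: assumes "x \<in> Cn" "y \<in> Cn" shows "0 \<le> hd x y"
proof -
  have "1 \<le> exp (2 * hd x y)"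
    using hd_HB[OF assms order_refl] HB_ge1 assms Cn_subset_K Cn_nz by blast
  then show ?thesis by simp
qed

lemma hd_sym: "x \<in> Cn \<Longrightarrow> y \<in> Cn \<Longrightarrow> hd x y = hd y x"
  using hd_le_iff[of x y "hd y x"] hd_le_iff[of y x "hd y x"] hd_le_iff[of x y "hd x y"]
    hd_le_iff[of y x "hd x y"] HB_sym[of _ x y] HB_sym[of _ y x] by fastforce

lemma hd_scale: assumes "x \<in> Cn" "y \<in> Cn" "0 < s" "0 < t" shows "hd (s *\<^sub>R x) (t *\<^sub>R y) = hd x y"
  using HB_scale[OF assms(3,4)] by (simp add: hd_def)

lemma hd_self: assumes "x \<in> Cn" shows "hd x x = 0"
  using hd_le_iff[OF assms assms, of 0] hd_nonneg[OF assms assms]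
    HB_refl[OF order_refl Cn_subset_K[OF assms]] by simp

lemma hd_triangle: assumes "x \<in> Cn" "y \<in> Cn" "z \<in> Cn" shows "hd x z \<le> hd x y + hd y z"
  unfolding hd_le_iff[OF assms(1,3)] distrib_left exp_add
  using assms by (intro HB_trans[of _ _ y]) (auto intro!: hd_HB Cn_subset_K)

lemma hd_near: assumes "y \<in> Cn" shows "\<forall>\<^sub>F z in nhds y. z \<in> Cn \<and> hd z y \<le> 1"
  using eventually_conj[OF eventually_nhds_in_open[OF open_Cn assms] HB_near[OF assms]]
proof (rule eventually_mono)
  fix z assume z: "z \<in> Cn \<and> HB 3 z y"
  have "(3::real) \<le> exp (2 * 1)" using exp_ge_add_one_self[of 2] by simp
  then show "z \<in> Cn \<and> hd z y \<le> 1"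
    using z assms HB_mono Cn_subset_K by (auto simp: hd_le_iff)
qed

lemma hd_segment:
  assumes "x \<in> Cn" "y \<in> Cn" "0 \<le> s" "0 \<le> t" "0 < s + t"
  shows "s *\<^sub>R x + t *\<^sub>R y \<in> Cn" "hd x (s *\<^sub>R x + t *\<^sub>R y) \<le> hd x y"
proof -
  show 1: "s *\<^sub>R x + t *\<^sub>R y \<in> Cn"
    using assms by (cases "s = 0"; cases "t = 0") (auto intro!: Cn_add Cn_scale)
  show "hd x (s *\<^sub>R x + t *\<^sub>R y) \<le> hd x y" unfolding hd_le_iff[OF assms(1) 1]
    using assms hd_nonneg[OF assms(1,2)] by (intro HB_segment hd_HB) (auto intro!: Cn_subset_K)
qed

subsection \<open>The compact base\<close>

definition base :: "'a set" where "base = {x \<in> K. u \<bullet> x = 1}"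

lemma compact_slice: assumes "closed X" "X \<subseteq> K" "\<And>x. x \<in> X \<Longrightarrow> u \<bullet> x \<le> c" shows "compact X"
proof -
  obtain M where M: "0 < M" "\<And>x. x \<in> K \<Longrightarrow> norm x \<le> M * (u \<bullet> x)" using K_bound by blast
  have "norm x \<le> M * c" if "x \<in> X" for x
    using M(2)[of x] assms(2) assms(3)[OF that] that M(1)
    by (meson mult_le_cancel_left_pos order_trans subsetD)
  then have "bounded X" unfolding bounded_iff by blast
  then show ?thesis using assms compact_eq_bounded_closed by blast
qed

lemma compact_base: "compact base"
proof (rule compact_slice)
  have "base = K \<inter> {x. u \<bullet> x = 1}" by (auto simp: base_def)
  then show "closed base" by (simp add: closed_K closed_Int closed_hyperplane)
qed (auto simp: base_def)

lemma base_nz: "x \<in> base \<Longrightarrow> x \<noteq> 0" by (auto simp: base_def)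

text \<open>This is the coordinate of the line of \<open>x\<close> in the affine chart of
  \<open>u\<close>.\<close>

definition nrm :: "'a \<Rightarrow> 'a" where "nrm x = inverse (u \<bullet> x) *\<^sub>R x"

lemma nrm_base: "x \<in> K \<Longrightarrow> x \<noteq> 0 \<Longrightarrow> nrm x \<in> base"
  using u_pos[of x] by (auto simp: nrm_def base_def intro!: K_scale)

lemma nrm_Cn: "x \<in> Cn \<Longrightarrow> nrm x \<in> Cn"
  using u_pos_Cn[of x] by (auto simp: nrm_def intro!: Cn_scale)

lemma hd_nrm: assumes "x \<in> Cn" "y \<in> Cn" shows "hd (nrm x) y = hd x y" "hd x (nrm y) = hd x y"
  using hd_scale[OF assms, of "inverse (u \<bullet> x)" 1] hd_scale[OF assms, of 1 "inverse (u \<bullet> y)"]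
    u_pos_Cn assms by (auto simp: nrm_def)

end

section \<open>Linear actions of the integers on a cone\<close>

text \<open>\<open>T k\<close> is the k-th power of a lift of the automorphism. Integer time makes
  the reversed flow another instance, so a statement about one end of an axis yields the one about
  the other end.\<close>

locale cone_flow = convex_open_cone Cn u for Cn :: "'a::euclidean_space set" and u +
  fixes T :: "int \<Rightarrow> 'a \<Rightarrow> 'a"
  assumes lin_T: "linear (T k)" and T_0: "T 0 x = x" and T_add: "T (j + k) x = T j (T k x)"
    and T_Cn: "x \<in> Cn \<Longrightarrow> T k x \<in> Cn"
begin

lemma T_lin: "T k (x + y) = T k x + T k y" "T k (s *\<^sub>R x) = s *\<^sub>R T k x"
  using lin_T by (auto simp: linear_add linear_scale)

lemma T_diff: "T k (x - y) = T k x - T k y"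
  using lin_T by (rule linear_diff)

lemma T_zero: "T k 0 = 0" using lin_T by (rule linear_0)

lemma T_inv: "T (- k) (T k x) = x" "T k (T (- k) x) = x"
  using T_add[of "- k" k x] T_add[of k "- k" x] T_0 by auto

lemma T_nz: "x \<noteq> 0 \<Longrightarrow> T k x \<noteq> 0" using T_inv(1)[of k x] T_zero by auto

lemma cont_T: "continuous_on S (T k)" using lin_T by (rule linear_continuous_on[OF linear_conv_bounded_linear[THEN iffD1]])

lemma tendsto_T: "(X \<longlongrightarrow> x) F \<Longrightarrow> ((\<lambda>n. T k (X n)) \<longlongrightarrow> T k x) F"
  using bounded_linear.tendsto[OF linear_conv_bounded_linear[THEN iffD1, OF lin_T]] .

lemma T_K: assumes "x \<in> K" shows "T k x \<in> K"
proof -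
  obtain X where X: "\<And>n::nat. X n \<in> Cn" "X \<longlonglongrightarrow> x"
    using assms unfolding K_def closure_sequential by blast
  show ?thesis using K_seqI[OF Cn_subset_K[OF T_Cn[OF X(1)]] tendsto_T[OF X(2)]] .
qed

lemma T_Cn_iff: "T k x \<in> Cn \<longleftrightarrow> x \<in> Cn"
  using T_Cn[of x k] T_Cn[of "T k x" "- k"] by (auto simp: T_inv)

text \<open>Moving \<open>T k\<close> to the functionals reduces the invariance of cross ratio
  bounds to that of the dual cone.\<close>

lemma adj: "adjoint (T k) f \<bullet> x = f \<bullet> T k x"
  using adjoint_works[OF lin_T, of x k f] by (simp add: inner_commute)

lemma adj_dual: "f \<in> dual \<Longrightarrow> adjoint (T k) f \<in> dual" by (simp add: dual_def adj T_Cn)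

lemma HB_T: assumes "HB E x y" shows "HB E (T k x) (T k y)"
  unfolding HB_def using HB_D[OF assms adj_dual adj_dual] by (simp add: adj)

lemma HB_T_iff: "HB E (T k x) (T k y) \<longleftrightarrow> HB E x y"
  using HB_T[of E x y k] HB_T[of E "T k x" "T k y" "- k"] by (auto simp: T_inv)

lemma hd_T: "hd (T k x) (T k y) = hd x y" by (simp add: hd_def HB_T_iff)

lemma hd_orbit: "hd (T j x) (T k x) = hd x (T (k - j) x)"
  using hd_T[of j x "T (k - j) x"] T_add[of j "k - j" x] by simp

lemma int_semiconj:
  fixes g :: "'a \<Rightarrow> 'b::real_vector"
  assumes "\<And>x. g (T 1 x) = m *\<^sub>R g x" "0 < m"
  shows "g (T k x) = (m powi k) *\<^sub>R g x"
proof (induction k rule: int_induct[where k = 0])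
  case base show ?case by (simp add: T_0)
next
  case (step1 i)
  have "g (T (i + 1) x) = m *\<^sub>R g (T i x)" using assms(1)[of "T i x"] T_add[of 1 i x] by (simp add: add.commute)
  then show ?case using step1 assms(2) by (simp add: power_int_add mult.commute)
next
  case (step2 i)
  have "m *\<^sub>R g (T (i - 1) x) = g (T i x)" using assms(1)[of "T (i - 1) x"] T_add[of 1 "i - 1" x] by simp
  also have "\<dots> = m *\<^sub>R (m powi (i - 1)) *\<^sub>R g x" using step2 assms(2) by (simp add: power_int_diff)
  finally show ?case using assms(2) by (simp del: scaleR_scaleR)
qed

lemma T_eigen:
  assumes "T 1 a = l *\<^sub>R a" "0 < l" shows "T k a = (l powi k) *\<^sub>R a"
proof (induction k rule: int_induct[where k = 0])
  case base show ?case by (simp add: T_0)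
next
  case (step1 i)
  then show ?case using assms T_add[of 1 i a] by (simp add: add.commute power_int_add T_lin mult.commute)
next
  case (step2 i)
  have "l *\<^sub>R T (i - 1) a = T i a" using assms T_add[of "i - 1" 1 a] by (simp add: T_lin)
  also have "\<dots> = l *\<^sub>R (l powi (i - 1)) *\<^sub>R a" using step2 assms(2) by (simp add: power_int_diff)
  finally show ?case using assms(2) by (simp del: scaleR_scaleR)
qed

lemma rev_flow: "cone_flow Cn u (\<lambda>k. T (- k))"
proof (intro cone_flow.intro cone_flow_axioms.intro convex_open_cone_axioms)
  show "T (- (j + k)) x = T (- j) (T (- k) x)" for j k x using T_add[of "- j" "- k" x] by simp
qed (simp_all add: lin_T T_0 T_Cn)

text \<open>Brouwer's theorem, applied to the compact convex set of functionals of the dual cone that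
  support the cone at \<open>a\<close>.\<close>

lemma invariant_functional:
  assumes a: "a \<in> K" "a \<notin> Cn" "T 1 a = l *\<^sub>R a" and b: "T 1 b = m *\<^sub>R b" "0 < m"
    and ab: "a + b \<in> Cn"
  obtains f where "f \<in> dual" "f \<bullet> a = 0" "f \<bullet> b = 1" "\<And>x. f \<bullet> T 1 x = m * (f \<bullet> x)"
proof -
  define S where "S = {f \<in> dual. f \<bullet> a = 0 \<and> f \<bullet> b = 1}"
  have S_eq: "S = (\<Inter>v\<in>Cn. {f. 0 \<le> f \<bullet> v}) \<inter> {f. f \<bullet> a = 0} \<inter> {f. f \<bullet> b = 1}"
    by (auto simp: S_def dual_def)
  have "closed S" unfolding S_eq
    by (intro closed_Int closed_INT ballI closed_Collect_le closed_Collect_eq continuous_intros)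
  moreover have "bounded S"
  proof -
    obtain e where e: "0 < e" "ball (a + b) e \<subseteq> Cn" using open_Cn ab open_contains_ball by blast
    have "norm f \<le> 2 / e" if f: "f \<in> S" for f
    proof (cases "f = 0")
      case False
      \<comment> \<open>\<open>f\<close> equals 1 at \<open>a + b\<close> and stays nonnegative
        after a step of length \<open>e / 2\<close> against \<open>f\<close>; hence
        \<open>norm f \<le> 2 / e\<close>.\<close>
      have "a + b - (e / 2 / norm f) *\<^sub>R f \<in> ball (a + b) e"
        using e False by (simp add: dist_norm)
      then have "a + b - (e / 2 / norm f) *\<^sub>R f \<in> Cn" using e by blast
      then have "0 \<le> f \<bullet> (a + b - (e / 2 / norm f) *\<^sub>R f)" using f by (simp add: S_def dual_def)
      also have "\<dots> = 1 - e / 2 * norm f"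
        using f False by (simp add: S_def inner_add_right inner_diff_right dot_square_norm power2_eq_square)
      finally show ?thesis using e by (simp add: field_simps)
    qed (use e in auto)
    then show ?thesis unfolding bounded_iff by blast
  qed
  ultimately have 1: "compact S" by (simp add: compact_eq_bounded_closed)
  have 2: "convex S" unfolding S_eq
    by (intro convex_Int convex_INT) (auto simp: convex_def inner_add_left)
  obtain f0 where f0: "f0 \<in> dual" "f0 \<noteq> 0" "f0 \<bullet> a = 0" using support_K a by blast
  have "0 < f0 \<bullet> b" using dual_pos[OF f0(1,2) ab] f0(3) by (simp add: inner_add_right)
  then have "inverse (f0 \<bullet> b) *\<^sub>R f0 \<in> S" using f0 by (auto simp: S_def dual_def)
  then have 3: "S \<noteq> {}" by blast
  \<comment> \<open>Dividing by \<open>m\<close> keeps the normalisation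
    \<open>f \<bullet> b = 1\<close>, so a fixed point is an eigenfunctional with the same
    eigenvalue as \<open>b\<close>.\<close>
  have "linear (\<lambda>f. inverse m *\<^sub>R adjoint (T 1) f)"
    by (intro linear_compose_scale_right adjoint_linear lin_T)
  then have 4: "continuous_on S (\<lambda>f. inverse m *\<^sub>R adjoint (T 1) f)"
    by (rule linear_continuous_on[OF linear_conv_bounded_linear[THEN iffD1]])
  have 5: "(\<lambda>f. inverse m *\<^sub>R adjoint (T 1) f) \<in> S \<rightarrow> S"
    using a b adj_dual by (auto simp: S_def adj dual_def)
  obtain f where f: "f \<in> S" "inverse m *\<^sub>R adjoint (T 1) f = f" using brouwer[OF 1 2 3 4 5] by blast
  have "f \<bullet> T 1 x = m * (f \<bullet> x)" for x
  proof -
    have "f \<bullet> x = inverse m * (f \<bullet> T 1 x)" using f(2) adj[of 1 f x] by (metis inner_scaleR_left)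
    then show ?thesis using b by simp
  qed
  then show thesis using that f by (auto simp: S_def)
qed

end

lemma powi_exp: "0 < (L::real) \<Longrightarrow> L powi k = exp (of_int k * ln L)"
  by (simp add: powr_real_of_int'[symmetric] powr_def)

text \<open>Multiplication by powers of \<open>L\<close> has [1, L] as a fundamental domain;
  \<open>k\<close> is a rounded logarithm.\<close>

lemma powi_normalise: assumes "1 < (L::real)" "0 < r" obtains k where "1 \<le> L powi k * r" "L powi k * r \<le> L"
proof -
  define k where "k = - \<lfloor>ln r / ln L\<rfloor>"
  have L: "0 < ln L" using assms by simp
  have e: "L powi k * r = exp (of_int k * ln L + ln r)"
    using assms by (simp add: exp_add powi_exp)
  have f: "real_of_int \<lfloor>ln r / ln L\<rfloor> * ln L \<le> ln r" "ln r \<le> (real_of_int \<lfloor>ln r / ln L\<rfloor> + 1) * ln L"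
    using floor_divide_lower[OF L, of "ln r"] floor_divide_upper[OF L, of "ln r"] by simp_all
  have "1 \<le> L powi k * r" unfolding e using f by (simp add: k_def)
  moreover have "exp (of_int k * ln L + ln r) \<le> exp (ln L)" using f by (simp add: k_def algebra_simps)
  ultimately show thesis using that[of k] e assms by simp
qed

section \<open>The axis of a rank one isometry is contracting\<close>

text \<open>\<open>fa\<close> and \<open>fb\<close> are the coordinates on the plane of the axis,
  extended to eigenfunctionals. As \<open>m < l\<close>, positive time moves the axis towards
  \<open>a\<close>. The last assumption excludes half triangles over the axis.\<close>

locale hyperbolic_flow = cone_flow Cn u T for Cn :: "'a::euclidean_space set" and u T +
  fixes a b fa fb :: 'a and l m :: real
  assumes a_K: "a \<in> K" and b_K: "b \<in> K" and ab: "a + b \<in> Cn"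
    and fa: "fa \<in> dual" "fa \<bullet> a = 1" "fa \<bullet> b = 0" "\<And>x. fa \<bullet> T 1 x = l * (fa \<bullet> x)"
    and fb: "fb \<in> dual" "fb \<bullet> a = 0" "fb \<bullet> b = 1" "\<And>x. fb \<bullet> T 1 x = m * (fb \<bullet> x)"
    and Ta: "T 1 a = l *\<^sub>R a" and Tb: "T 1 b = m *\<^sub>R b" and m_pos: "0 < m" and m_less: "m < l"
    and no_half_triangle: "\<And>z. z \<in> K \<Longrightarrow> z \<noteq> 0 \<Longrightarrow> a + z \<in> Cn \<or> z + b \<in> Cn"
begin

lemma l_pos: "0 < l" using m_pos m_less by simp

lemma Tk: "T k a = (l powi k) *\<^sub>R a" "T k b = (m powi k) *\<^sub>R b"
  by (rule T_eigen[OF Ta l_pos], rule T_eigen[OF Tb m_pos])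

lemma fk: "fa \<bullet> T k x = l powi k * (fa \<bullet> x)" "fb \<bullet> T k x = m powi k * (fb \<bullet> x)"
  using int_semiconj[of "\<lambda>x. fa \<bullet> x" l k x] int_semiconj[of "\<lambda>x. fb \<bullet> x" m k x]
  by (simp_all only: fa(4) fb(4) real_scaleR_def l_pos m_pos)

lemma f_nz: "fa \<noteq> 0" "fb \<noteq> 0" using fa fb by auto

lemma rev_hyperbolic: "hyperbolic_flow Cn u (\<lambda>k. T (- k)) b a fb fa (inverse m) (inverse l)"
proof (intro hyperbolic_flow.intro rev_flow hyperbolic_flow_axioms.intro)
  show "b + a \<in> Cn" using ab by (simp add: add.commute)
  show "b + z \<in> Cn \<or> z + a \<in> Cn" if "z \<in> K" "z \<noteq> 0" for z
    using no_half_triangle[OF that] by (metis add.commute)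
  show "inverse l < inverse m" using m_pos m_less by simp
  show "fa \<bullet> T (- 1) x = inverse l * (fa \<bullet> x)" "fb \<bullet> T (- 1) x = inverse m * (fb \<bullet> x)" for x
    using fk[of "- 1" x] by (simp_all add: power_int_minus)
  show "T (- 1) a = inverse l *\<^sub>R a" "T (- 1) b = inverse m *\<^sub>R b"
    using Tk[of "- 1"] by (simp_all add: power_int_minus)
qed (use a_K b_K fa fb l_pos in auto)

lemma f_pos: "x \<in> Cn \<Longrightarrow> 0 < fa \<bullet> x" "x \<in> Cn \<Longrightarrow> 0 < fb \<bullet> x"
  using dual_pos[OF fa(1) f_nz(1)] dual_pos[OF fb(1) f_nz(2)] by auto

lemma f_nonneg: "x \<in> K \<Longrightarrow> 0 \<le> fa \<bullet> x" "x \<in> K \<Longrightarrow> 0 \<le> fb \<bullet> x"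
  using dual_K[OF fa(1)] dual_K[OF fb(1)] by auto

text \<open>A common zero \<open>z\<close> would be the third vertex of a half triangle, since
  \<open>fb\<close> vanishes on \<open>a + z\<close> and \<open>fa\<close> on
  \<open>z + b\<close>.\<close>

lemma f_sum_pos: assumes "z \<in> K" "z \<noteq> 0" shows "0 < fa \<bullet> z + fb \<bullet> z"
proof (rule ccontr)
  assume "\<not> ?thesis"
  then have "fa \<bullet> z = 0" "fb \<bullet> z = 0" using f_nonneg[OF assms(1)] by auto
  then show False using no_half_triangle[OF assms] f_pos[of "a + z"] f_pos[of "z + b"] fa fb
    by (auto simp: inner_add_right)
qed

text \<open>On the compact base \<open>fa + fb\<close> has a positive minimum \<open>d\<close>, so
  it controls \<open>u\<close> on the whole closed cone. Unlike \<open>u\<close>, the functionals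
  \<open>fa\<close> and \<open>fb\<close> are only rescaled by the flow.\<close>

lemma compact_f_slice: assumes "closed X" "X \<subseteq> K" "\<And>x. x \<in> X \<Longrightarrow> fa \<bullet> x + fb \<bullet> x \<le> c" shows "compact X"
proof -
  obtain v where "v \<in> Cn" using Cn_ne by blast
  then have ne: "base \<noteq> {}" using nrm_base[of v] Cn_subset_K Cn_nz by blast
  have "continuous_on base (\<lambda>x. fa \<bullet> x + fb \<bullet> x)" by (intro continuous_intros)
  then obtain w where w: "w \<in> base" "\<And>x. x \<in> base \<Longrightarrow> fa \<bullet> w + fb \<bullet> w \<le> fa \<bullet> x + fb \<bullet> x"
    using continuous_attains_inf[OF compact_base ne] by blast
  define d where "d = fa \<bullet> w + fb \<bullet> w"
  have d: "0 < d" using f_sum_pos[of w] w(1) base_nz by (auto simp: d_def base_def)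
  have db: "d * (u \<bullet> x) \<le> fa \<bullet> x + fb \<bullet> x" if "x \<in> K" for x
  proof (cases "x = 0")
    case False
    have p: "0 < u \<bullet> x" using u_pos that False by blast
    have "d \<le> inverse (u \<bullet> x) * (fa \<bullet> x + fb \<bullet> x)"
      using w(2)[OF nrm_base[OF that False]] by (simp add: d_def nrm_def algebra_simps)
    then show ?thesis using p by (simp add: field_simps)
  qed auto
  have "u \<bullet> x \<le> c / d" if "x \<in> X" for x
    using db[of x] assms(2) assms(3)[OF that] that d by (auto simp: field_simps)
  then show ?thesis using compact_slice[OF assms(1,2)] by blast
qed

text \<open>A point \<open>z\<^sub>0\<close> of the slice farthest from \<open>b\<close> could otherwise be moved further away: this is
  possible near \<open>a\<close> by a uniform amount, and applying \<open>T (- n)\<close> removes \<open>a\<close> in the limit.\<close>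

lemma fa_zero: assumes "z \<in> K" "fa \<bullet> z = 0" shows "z = (fb \<bullet> z) *\<^sub>R b"
proof (cases "z = 0")
  case False
  define S where "S = {z \<in> K. fa \<bullet> z = 0 \<and> fb \<bullet> z = 1}"
  have "S = K \<inter> {z. fa \<bullet> z = 0} \<inter> {z. fb \<bullet> z = 1}" by (auto simp: S_def)
  then have "closed S" by (simp add: closed_K closed_Int closed_hyperplane)
  then have cS: "compact S" by (rule compact_f_slice) (auto simp: S_def)
  have bS: "b \<in> S" using b_K fa fb by (simp add: S_def)
  have "continuous_on S (\<lambda>z. dist z b)" by (intro continuous_intros)
  then obtain z0 where z0: "z0 \<in> S" "\<And>z. z \<in> S \<Longrightarrow> dist z b \<le> dist z0 b"
    using continuous_attains_sup[OF cS] bS by blast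
  have aS: "a + z \<in> Cn" if "z \<in> S" for z
  proof -
    have z: "z \<in> K" "z \<noteq> 0" "fa \<bullet> z = 0" using that by (auto simp: S_def)
    have "z + b \<notin> Cn" using f_pos(1)[of "z + b"] z fa by (auto simp: inner_add_right)
    then show ?thesis using no_half_triangle[OF z(1,2)] by blast
  qed
  have "compact ((\<lambda>z. a + z) ` S)" using cS by (intro compact_continuous_image continuous_intros)
  then obtain e where e: "0 < e" "(\<Union>x\<in>(\<lambda>z. a + z) ` S. ball x e) \<subseteq> Cn"
    using compact_subset_open_imp_ball_epsilon_subset[OF _ open_Cn, of "(\<lambda>z. a + z) ` S"] aS by blast
  \<comment> \<open>No point of \<open>S\<close> is farther from \<open>b\<close> than
    \<open>z0\<close>, so the displacement \<open>d (z - b)\<close> has length at most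
    \<open>e / 2\<close>.\<close>
  define d where "d = e / (2 * (dist z0 b + 1))"
  have d: "0 < d" using e by (simp add: d_def add_nonneg_pos)
  have perturb: "a + z + d *\<^sub>R (z - b) \<in> Cn" if "z \<in> S" for z
  proof -
    have "d * norm (z - b) \<le> d * (dist z0 b + 1)"
      using z0(2)[OF that] d by (intro mult_left_mono) (auto simp: dist_norm)
    also have "\<dots> = e / 2" unfolding d_def
      by (metis (no_types, opaque_lifting) add_nonneg_pos divide_divide_eq_left less_irrefl nonzero_eq_divide_eq zero_le_dist zero_less_one mult.commute)
    finally have "a + z + d *\<^sub>R (z - b) \<in> ball (a + z) e" using d e by (simp add: dist_norm)
    then show ?thesis using e that by blast
  qed
  have "(m / l) ^ n *\<^sub>R a + (z0 + d *\<^sub>R (z0 - b)) \<in> K" for n :: nat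
  proof -
    \<comment> \<open>\<open>z\<close> is the rescaled image of \<open>z0\<close> at time
      \<open>n\<close>. Pulling \<open>a + z + d (z - b)\<close> back and rescaling gives back
      \<open>z0\<close> and \<open>b\<close>, but multiplies \<open>a\<close> by (m / l)^n.\<close>
    define z where "z = inverse (m ^ n) *\<^sub>R T (int n) z0"
    have zS: "z \<in> S" using z0(1) m_pos by (auto simp: S_def z_def fk intro!: K_scale T_K)
    have "m ^ n *\<^sub>R T (- int n) (a + z + d *\<^sub>R (z - b)) \<in> Cn"
      using perturb[OF zS] m_pos by (intro Cn_scale T_Cn) auto
    moreover have "m ^ n *\<^sub>R T (- int n) (a + z + d *\<^sub>R (z - b))
       = (m / l) ^ n *\<^sub>R a + (z0 + d *\<^sub>R (z0 - b))"
      using m_pos l_pos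
      by (simp add: z_def T_lin T_diff T_inv Tk power_int_minus power_divide scaleR_add_right
          scaleR_diff_right inverse_eq_divide)
    ultimately show ?thesis using Cn_subset_K by metis
  qed
  moreover have "(\<lambda>n. (m / l) ^ n *\<^sub>R a + (z0 + d *\<^sub>R (z0 - b))) \<longlonglongrightarrow> 0 *\<^sub>R a + (z0 + d *\<^sub>R (z0 - b))"
    using m_pos m_less by (intro tendsto_intros LIMSEQ_realpow_zero) auto
  ultimately have "0 *\<^sub>R a + (z0 + d *\<^sub>R (z0 - b)) \<in> K" by (rule K_seqI)
  then have "z0 + d *\<^sub>R (z0 - b) \<in> S"
    using z0(1) fa fb by (simp add: S_def inner_add_right inner_diff_right)
  \<comment> \<open>The limit point is farther from \<open>b\<close> than \<open>z0\<close> by the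
    factor \<open>1 + d\<close>, which is impossible unless \<open>z0 = b\<close>.\<close>
  from z0(2)[OF this] have "norm ((1 + d) *\<^sub>R (z0 - b)) \<le> norm (z0 - b)"
    by (simp add: dist_norm scaleR_add_left algebra_simps)
  then have "(1 + d) * norm (z0 - b) \<le> 1 * norm (z0 - b)" using d by simp
  then have "norm (z0 - b) = 0" using d by (metis add_less_same_cancel1 less_add_same_cancel1 linorder_not_less mult_le_cancel_right norm_ge_zero order_antisym)
  then have Sb: "y = b" if "y \<in> S" for y using z0(2)[OF that] by (simp add: dist_norm)
  have p: "0 < fb \<bullet> z" using f_sum_pos[OF assms(1) False] assms(2) by simp
  then have "inverse (fb \<bullet> z) *\<^sub>R z \<in> S" using assms by (auto simp: S_def intro!: K_scale)
  then have "inverse (fb \<bullet> z) *\<^sub>R z = b" by (rule Sb)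
  then show ?thesis using p by (metis less_irrefl right_inverse scaleR_one scaleR_scaleR)
qed simp

lemma fb_zero: assumes "z \<in> K" "fb \<bullet> z = 0" shows "z = (fa \<bullet> z) *\<^sub>R a"
  using hyperbolic_flow.fa_zero[OF rev_hyperbolic assms] .

text \<open>Otherwise \<open>x + t b\<close> is on the boundary for every t > 0. Flowing forward and
  rescaling by powers of \<open>l\<close> pushes \<open>x\<close> to a positive multiple of
  \<open>a\<close>, and in the limit a positive combination of \<open>a\<close> and \<open>b\<close>
  would lie on the boundary.\<close>

lemma add_b_Cn: assumes "x \<in> K" "0 < fa \<bullet> x" shows "x + b \<in> Cn"
proof (rule ccontr)
  assume "x + b \<notin> Cn"
  then have nC: "x + t *\<^sub>R b \<notin> Cn" if "0 < t" for t
    using Cn_of_sum[OF assms(1) b_K zero_less_one that] by auto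
  define y where "y n = inverse (l ^ n) *\<^sub>R T (int n) x" for n
  define S where "S = {y \<in> K. fa \<bullet> y = fa \<bullet> x \<and> fb \<bullet> y \<le> fb \<bullet> x} - (\<lambda>y. y + b) -` Cn"
  have fy: "fa \<bullet> y n = fa \<bullet> x" "fb \<bullet> y n = (m / l) ^ n * (fb \<bullet> x)" for n
    using l_pos by (auto simp: y_def fk power_divide field_simps)
  have "y n + b \<notin> Cn" for n
  proof
    assume "y n + b \<in> Cn"
    then have "l ^ n *\<^sub>R T (- int n) (y n + b) \<in> Cn" using l_pos by (intro Cn_scale T_Cn) auto
    moreover have "l ^ n *\<^sub>R T (- int n) (y n + b) = x + (l / m) ^ n *\<^sub>R b"
      using l_pos m_pos
      by (simp add: y_def T_lin T_inv Tk power_int_minus power_divide scaleR_add_right inverse_eq_divide)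
    ultimately show False using nC[of "(l / m) ^ n"] l_pos m_pos by simp
  qed
  moreover have "(m / l) ^ n * (fb \<bullet> x) \<le> fb \<bullet> x" for n
    using m_pos m_less f_nonneg[OF assms(1)] by (intro mult_left_le_one_le power_le_one) auto
  moreover have "y n \<in> K" for n using assms(1) l_pos by (auto simp: y_def intro!: K_scale T_K)
  ultimately have yS: "\<forall>n. y n \<in> S" by (simp add: S_def fy)
  have "S = K \<inter> {y. fa \<bullet> y = fa \<bullet> x} \<inter> {y. fb \<bullet> y \<le> fb \<bullet> x} \<inter> - ((\<lambda>y. y + b) -` Cn)"
    by (auto simp: S_def)
  moreover have "open ((\<lambda>y. y + b) -` Cn)" by (intro open_vimage open_Cn continuous_intros)
  ultimately have "closed S" by (simp add: closed_K closed_Int closed_hyperplane closed_halfspace_le closed_Compl)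
  then have "compact S" by (rule compact_f_slice[where c = "fa \<bullet> x + fb \<bullet> x"]) (auto simp: S_def)
  then obtain p r where p: "p \<in> S" "strict_mono (r :: nat \<Rightarrow> nat)" "(y \<circ> r) \<longlonglongrightarrow> p"
    using yS unfolding compact_def by blast
  have "(\<lambda>n. fb \<bullet> y n) \<longlonglongrightarrow> 0 * (fb \<bullet> x)" unfolding fy
    using m_pos m_less by (intro tendsto_intros LIMSEQ_realpow_zero) auto
  then have "(\<lambda>n. fb \<bullet> (y \<circ> r) n) \<longlonglongrightarrow> 0" using LIMSEQ_subseq_LIMSEQ[OF _ p(2), of "\<lambda>n. fb \<bullet> y n"]
    by (simp add: o_def)
  moreover have "(\<lambda>n. fb \<bullet> (y \<circ> r) n) \<longlonglongrightarrow> fb \<bullet> p" using p(3) by (intro tendsto_intros)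
  ultimately have "fb \<bullet> p = 0" using LIMSEQ_unique by blast
  moreover have pK: "p \<in> K" "fa \<bullet> p = fa \<bullet> x" "p + b \<notin> Cn" using p(1) by (auto simp: S_def)
  ultimately have "p = (fa \<bullet> x) *\<^sub>R a" using fb_zero[of p] by simp
  then show False using pK(3) Cn_of_sum'[OF a_K b_K assms(2) zero_less_one ab] by simp
qed

lemma add_a_Cn: assumes "x \<in> K" "0 < fb \<bullet> x" shows "x + a \<in> Cn"
  using hyperbolic_flow.add_b_Cn[OF rev_hyperbolic assms] .

section \<open>Distances on the axis and the projection to it\<close>

lemma axis_Cn: "0 < s \<Longrightarrow> 0 < t \<Longrightarrow> s *\<^sub>R a + t *\<^sub>R b \<in> Cn"
  by (intro Cn_of_sum' a_K b_K ab)

text \<open>The pair \<open>fa\<close>, \<open>fb\<close> (in one of the two orders) attains the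
  largest cross ratio. Conversely, expand both sides in \<open>a\<close> and \<open>b\<close>: the
  mixed terms use the bounds on \<open>q\<close> and its inverse, the pure terms
  \<open>E \<ge> 1\<close>, which holds since \<open>q\<close> or its inverse is at least 1.\<close>

lemma hd_axis:
  assumes "0 < s" "0 < t" "0 < s'" "0 < t'"
  shows "hd (s *\<^sub>R a + t *\<^sub>R b) (s' *\<^sub>R a + t' *\<^sub>R b) = 1 / 2 * \<bar>ln (s * t' / (s' * t))\<bar>"
proof -
  define q where "q = s * t' / (s' * t)"
  have q: "0 < q" "1 / q = s' * t / (s * t')" using assms by (auto simp: q_def)
  have "HB E (s *\<^sub>R a + t *\<^sub>R b) (s' *\<^sub>R a + t' *\<^sub>R b) \<longleftrightarrow> max q (1 / q) \<le> E" for E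
  proof
    assume H: "HB E (s *\<^sub>R a + t *\<^sub>R b) (s' *\<^sub>R a + t' *\<^sub>R b)"
    have "s * t' \<le> E * (s' * t)" using HB_D[OF H fa(1) fb(1)] fa fb by (simp add: inner_add_right)
    moreover have "t * s' \<le> E * (t' * s)" using HB_D[OF H fb(1) fa(1)] fa fb by (simp add: inner_add_right)
    ultimately show "max q (1 / q) \<le> E" using assms unfolding q(2) q_def by (simp add: field_simps)
  next
    assume "max q (1 / q) \<le> E"
    then have 1: "s * t' \<le> E * (s' * t)" "s' * t \<le> E * (s * t')" and "q \<le> E" "1 / q \<le> E"
      using assms unfolding q(2) q_def by (auto simp: field_simps)
    then have E: "1 \<le> E" using q(1) by (metis le_divide_eq_1_pos linorder_le_cases order_trans)
    show "HB E (s *\<^sub>R a + t *\<^sub>R b) (s' *\<^sub>R a + t' *\<^sub>R b)" unfolding HB_def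
    proof (intro ballI)
      fix f g assume fg: "f \<in> dual" "g \<in> dual"
      note p = dual_K[OF fg(1) a_K] dual_K[OF fg(2) a_K] dual_K[OF fg(1) b_K] dual_K[OF fg(2) b_K]
      have "(s * s') * ((f \<bullet> a) * (g \<bullet> a)) * 1 \<le> (s * s') * ((f \<bullet> a) * (g \<bullet> a)) * E"
        using p assms E by (intro mult_left_mono mult_nonneg_nonneg) auto
      moreover have "(t * t') * ((f \<bullet> b) * (g \<bullet> b)) * 1 \<le> (t * t') * ((f \<bullet> b) * (g \<bullet> b)) * E"
        using p assms E by (intro mult_left_mono mult_nonneg_nonneg) auto
      moreover have "((f \<bullet> a) * (g \<bullet> b)) * (s * t') \<le> ((f \<bullet> a) * (g \<bullet> b)) * (E * (s' * t))"
        using p assms 1 by (intro mult_left_mono mult_nonneg_nonneg) auto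
      moreover have "((f \<bullet> b) * (g \<bullet> a)) * (s' * t) \<le> ((f \<bullet> b) * (g \<bullet> a)) * (E * (s * t'))"
        using p assms 1 by (intro mult_left_mono mult_nonneg_nonneg) auto
      ultimately show "(f \<bullet> (s *\<^sub>R a + t *\<^sub>R b)) * (g \<bullet> (s' *\<^sub>R a + t' *\<^sub>R b))
         \<le> E * ((f \<bullet> (s' *\<^sub>R a + t' *\<^sub>R b)) * (g \<bullet> (s *\<^sub>R a + t *\<^sub>R b)))"
        by (simp add: inner_add_right algebra_simps)
    qed
  qed
  then have "hd (s *\<^sub>R a + t *\<^sub>R b) (s' *\<^sub>R a + t' *\<^sub>R b) = 1 / 2 * ln (max q (1 / q))"
    using assms q by (intro hd_eqI axis_Cn) auto
  also have "ln (max q (1 / q)) = \<bar>ln q\<bar>"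
  proof (cases "1 \<le> q")
    case True
    then have "1 / q \<le> 1" using q(1) by simp
    then have "max q (1 / q) = q" using True by linarith
    then show ?thesis using True by simp
  next
    case False
    then have "1 \<le> 1 / q" using q(1) by simp
    then have "max q (1 / q) = 1 / q" using False by linarith
    then show ?thesis using False q(1) by (simp add: ln_div)
  qed
  finally show ?thesis by (simp add: q_def)
qed

text \<open>This is the linear projection along the common kernel of \<open>fa\<close> and
  \<open>fb\<close>, hence compatible with scaling and with the flow.\<close>

definition axis_proj :: "'a \<Rightarrow> 'a" where "axis_proj x = (fa \<bullet> x) *\<^sub>R a + (fb \<bullet> x) *\<^sub>R b"

lemma axis_proj_Cn: "x \<in> Cn \<Longrightarrow> axis_proj x \<in> Cn"
  unfolding axis_proj_def by (intro axis_Cn f_pos)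

lemma axis_proj_scale: "axis_proj (s *\<^sub>R x) = s *\<^sub>R axis_proj x"
  by (simp add: axis_proj_def scaleR_add_right)

lemma axis_proj_T: "axis_proj (T k x) = T k (axis_proj x)"
  by (simp add: axis_proj_def fk Tk T_lin mult.commute)

lemma tendsto_axis_proj: "(X \<longlongrightarrow> x) F \<Longrightarrow> ((\<lambda>n. axis_proj (X n)) \<longlongrightarrow> axis_proj x) F"
  unfolding axis_proj_def by (intro tendsto_intros)

text \<open>Counterexamples for c = n are moved by the flow and rescaled until the first point
  projects to a fixed compact part of the axis. Far apart projections then force the second point to
  tend to \<open>a\<close> or \<open>b\<close>, along a subsequence. By \<open>add_a_Cn\<close> and
  \<open>add_b_Cn\<close> the limit of the sums \<open>X n + Y n\<close> is interior, so their
  distances to the projections stay bounded.\<close>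

lemma axis_contracting:
  "\<exists>c. \<forall>x\<in>Cn. \<forall>y\<in>Cn. c \<le> hd (axis_proj x) (axis_proj y) \<longrightarrow>
     (\<exists>s\<ge>0. \<exists>t\<ge>0. 0 < s + t \<and> hd (s *\<^sub>R x + t *\<^sub>R y) (axis_proj x) \<le> c)"
proof (rule ccontr)
  define L where "L = l / m"
  have L: "1 < L" using m_pos m_less by (simp add: L_def)
  define Q where "Q = {x \<in> K. fa \<bullet> x + fb \<bullet> x = 1}"
  assume "\<not> ?thesis"
  then have neg: "\<exists>x\<in>Cn. \<exists>y\<in>Cn. c \<le> hd (axis_proj x) (axis_proj y) \<and>
      (\<forall>s\<ge>0. \<forall>t\<ge>0. 0 < s + t \<longrightarrow> c < hd (s *\<^sub>R x + t *\<^sub>R y) (axis_proj x))" for c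
    by (auto simp: not_le) (meson not_le)
  have "\<exists>x y. x \<in> Cn \<and> y \<in> Cn \<and> x \<in> Q \<and> y \<in> Q \<and> fb \<bullet> x \<le> fa \<bullet> x \<and> fa \<bullet> x \<le> L * (fb \<bullet> x) \<and>
      c \<le> hd (axis_proj x) (axis_proj y) \<and> c < hd (x + y) (axis_proj x)" for c
  proof -
    obtain x y where xy: "x \<in> Cn" "y \<in> Cn" "c \<le> hd (axis_proj x) (axis_proj y)"
      "\<And>s t. 0 \<le> s \<Longrightarrow> 0 \<le> t \<Longrightarrow> 0 < s + t \<Longrightarrow> c < hd (s *\<^sub>R x + t *\<^sub>R y) (axis_proj x)"
      using neg[of c] by blast
    obtain k where k: "1 \<le> L powi k * (fa \<bullet> x / (fb \<bullet> x))" "L powi k * (fa \<bullet> x / (fb \<bullet> x)) \<le> L"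
      using powi_normalise[OF L, of "fa \<bullet> x / (fb \<bullet> x)"] f_pos[OF xy(1)] by auto
    have T: "T k x \<in> Cn" "T k y \<in> Cn" using xy T_Cn by auto
    define s where "s = inverse (fa \<bullet> T k x + fb \<bullet> T k x)"
    define t where "t = inverse (fa \<bullet> T k y + fb \<bullet> T k y)"
    have st: "0 < s" "0 < t" unfolding s_def t_def using f_pos[OF T(1)] f_pos[OF T(2)] by auto
    have 1: "s *\<^sub>R T k x \<in> Cn" "t *\<^sub>R T k y \<in> Cn" using st T Cn_scale by auto
    have 2: "s *\<^sub>R T k x \<in> Q" "t *\<^sub>R T k y \<in> Q"
      using 1 Cn_subset_K f_pos[OF T(1)] f_pos[OF T(2)]
      by (auto simp: Q_def s_def t_def distrib_left[symmetric])
    have mk: "0 < m powi k" using m_pos by simp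
    have Lk: "L powi k * (fa \<bullet> x / (fb \<bullet> x)) = (fa \<bullet> T k x) / (fb \<bullet> T k x)"
      by (simp add: L_def fk power_int_divide_distrib)
    have 3: "fb \<bullet> (s *\<^sub>R T k x) \<le> fa \<bullet> (s *\<^sub>R T k x)" "fa \<bullet> (s *\<^sub>R T k x) \<le> L * (fb \<bullet> (s *\<^sub>R T k x))"
      using k st f_pos[OF T(1)] unfolding Lk by (auto simp: field_simps)
    have 4: "c \<le> hd (axis_proj (s *\<^sub>R T k x)) (axis_proj (t *\<^sub>R T k y))"
      using xy st T by (simp add: axis_proj_scale hd_scale axis_proj_Cn axis_proj_T hd_T T_Cn)
    have "hd (s *\<^sub>R T k x + t *\<^sub>R T k y) (axis_proj (s *\<^sub>R T k x)) = hd (T k (s *\<^sub>R x + t *\<^sub>R y)) (T k (axis_proj (s *\<^sub>R x)))"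
      by (simp add: T_lin axis_proj_T axis_proj_scale)
    also have "\<dots> = hd (1 *\<^sub>R (s *\<^sub>R x + t *\<^sub>R y)) (s *\<^sub>R axis_proj x)" by (simp add: hd_T axis_proj_scale)
    also have "\<dots> = hd (s *\<^sub>R x + t *\<^sub>R y) (axis_proj x)"
      using st xy by (intro hd_scale axis_proj_Cn Cn_add Cn_scale) auto
    finally have "c < hd (s *\<^sub>R T k x + t *\<^sub>R T k y) (axis_proj (s *\<^sub>R T k x))"
      using xy(4)[of s t] st by simp
    with 1 2 3 4 show ?thesis by blast
  qed
  then have "\<forall>n::nat. \<exists>x y. x \<in> Cn \<and> y \<in> Cn \<and> x \<in> Q \<and> y \<in> Q \<and> fb \<bullet> x \<le> fa \<bullet> x \<and> fa \<bullet> x \<le> L * (fb \<bullet> x) \<and>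
      real n \<le> hd (axis_proj x) (axis_proj y) \<and> real n < hd (x + y) (axis_proj x)" by blast
  then obtain X Y where XY: "\<And>n::nat. X n \<in> Cn" "\<And>n. Y n \<in> Cn" "\<And>n. X n \<in> Q" "\<And>n. Y n \<in> Q"
     "\<And>n. fb \<bullet> X n \<le> fa \<bullet> X n" "\<And>n. fa \<bullet> X n \<le> L * (fb \<bullet> X n)"
     "\<And>n. real n \<le> hd (axis_proj (X n)) (axis_proj (Y n))"
     "\<And>n. real n < hd (X n + Y n) (axis_proj (X n))"
    by metis
  have "Q = K \<inter> {x. (fa + fb) \<bullet> x = 1}" by (auto simp: Q_def inner_add_left)
  then have "closed Q" by (simp add: closed_K closed_Int closed_hyperplane)
  then have "compact Q" by (rule compact_f_slice[where c = 1]) (auto simp: Q_def)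
  then have "compact (Q \<times> Q)" by (intro compact_Times)
  then obtain p r where p: "p \<in> Q \<times> Q" "strict_mono (r :: nat \<Rightarrow> nat)" "((\<lambda>n. (X n, Y n)) \<circ> r) \<longlonglongrightarrow> p"
    using XY(3,4) unfolding compact_def by (metis (mono_tags, lifting) mem_Sigma_iff)
  obtain x y where pxy: "p = (x, y)" by (cases p)
  have X: "(\<lambda>n. X (r n)) \<longlonglongrightarrow> x" using tendsto_fst[OF p(3)] by (simp add: pxy o_def)
  have Y: "(\<lambda>n. Y (r n)) \<longlonglongrightarrow> y" using tendsto_snd[OF p(3)] by (simp add: pxy o_def)
  have xQ: "x \<in> K" "fa \<bullet> x + fb \<bullet> x = 1" and yQ: "y \<in> K" "fa \<bullet> y + fb \<bullet> y = 1"
    using p(1) by (auto simp: pxy Q_def)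
  have "fb \<bullet> x \<le> fa \<bullet> x" using XY(5) by (intro LIMSEQ_le[OF tendsto_inner[OF tendsto_const X] tendsto_inner[OF tendsto_const X]]) auto
  moreover have "fa \<bullet> x \<le> L * (fb \<bullet> x)" using XY(6)
    by (intro LIMSEQ_le[OF tendsto_inner[OF tendsto_const X] tendsto_mult[OF tendsto_const tendsto_inner[OF tendsto_const X]]]) auto
  ultimately have fx: "0 < fa \<bullet> x" "0 < fb \<bullet> x" using xQ f_nonneg[OF xQ(1)] by (auto simp: order_less_le)
  \<comment> \<open>Both coordinates of \<open>X n\<close> are at least 1 / (1 + L), so a distance
    of at least \<open>n\<close> on the axis leaves one coordinate of \<open>Y n\<close> of order
    exp (- 2 n).\<close>
  have prod: "(fa \<bullet> Y n) * (fb \<bullet> Y n) \<le> (1 + L) * exp (- (2 * real n))" for n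
  proof -
    define s t s' t' where st: "s = fa \<bullet> X n" "t = fb \<bullet> X n" "s' = fa \<bullet> Y n" "t' = fb \<bullet> Y n"
    have p: "0 < s" "0 < t" "0 < s'" "0 < t'" using f_pos XY(1,2) st by auto
    have q: "s + t = 1" "s' + t' = 1" "t \<le> s" "s \<le> L * t" using XY(3,4,5,6)[of n] st by (auto simp: Q_def)
    have t: "1 \<le> (1 + L) * t" using q by (simp add: algebra_simps)
    have s: "1 \<le> (1 + L) * s" using q L p t by (smt (verit) mult_left_mono)
    have "2 * real n \<le> \<bar>ln (s * t' / (s' * t))\<bar>"
      using XY(7)[of n] p by (simp add: axis_proj_def hd_axis st)
    then consider "2 * real n \<le> ln (s * t' / (s' * t))" | "2 * real n \<le> - ln (s * t' / (s' * t))" by linarith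
    then show ?thesis
    proof cases
      case 1
      then have "exp (2 * real n) \<le> s * t' / (s' * t)" using p by (simp add: ln_ge_iff)
      then have "exp (2 * real n) * (s' * t) \<le> s * t'" using p by (simp add: field_simps)
      also have "\<dots> \<le> 1 * 1" using p q by (intro mult_mono) auto
      finally have A: "s' * t \<le> exp (- (2 * real n))" by (simp add: exp_minus field_simps)
      have "s' * t' \<le> s' * 1" using p q by (intro mult_left_mono) auto
      also have "\<dots> \<le> s' * ((1 + L) * t)" using t p by (intro mult_left_mono) auto
      also have "\<dots> = (1 + L) * (s' * t)" by simp
      also have "\<dots> \<le> (1 + L) * exp (- (2 * real n))" using A L by (intro mult_left_mono) auto
      finally show ?thesis by (simp add: st)
    next
      case 2
      then have "ln (s * t' / (s' * t)) \<le> - (2 * real n)" by simp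
      then have "s * t' / (s' * t) \<le> exp (- (2 * real n))" using p by (metis divide_pos_pos exp_le_cancel_iff exp_ln mult_pos_pos)
      then have "s * t' \<le> exp (- (2 * real n)) * (s' * t)" using p by (simp add: field_simps)
      also have "\<dots> \<le> exp (- (2 * real n)) * (1 * 1)" using p q by (intro mult_left_mono mult_mono) auto
      finally have A: "s * t' \<le> exp (- (2 * real n))" by simp
      have "s' * t' \<le> 1 * t'" using p q by (intro mult_right_mono) auto
      also have "\<dots> \<le> ((1 + L) * s) * t'" using s p by (intro mult_right_mono) auto
      also have "\<dots> = (1 + L) * (s * t')" by simp
      also have "\<dots> \<le> (1 + L) * exp (- (2 * real n))" using A L by (intro mult_left_mono) auto
      finally show ?thesis by (simp add: st)
    qed
  qed
  have "(fa \<bullet> y) * (fb \<bullet> y) \<le> 0"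
  proof (rule LIMSEQ_le)
    show "(\<lambda>n. (fa \<bullet> Y (r n)) * (fb \<bullet> Y (r n))) \<longlonglongrightarrow> (fa \<bullet> y) * (fb \<bullet> y)" by (intro tendsto_intros Y)
    have "filterlim (\<lambda>n. 2 * real n) at_top sequentially"
      by (intro filterlim_tendsto_pos_mult_at_top[OF tendsto_const] filterlim_real_sequentially) auto
    then have "(\<lambda>n. (1 + L) * exp (- (2 * real n))) \<longlonglongrightarrow> (1 + L) * 0"
      by (intro tendsto_intros filterlim_compose[OF exp_at_bot]) (simp add: filterlim_uminus_at_bot)
    from LIMSEQ_subseq_LIMSEQ[OF this p(2)]
    show "(\<lambda>n. (1 + L) * exp (- (2 * real (r n)))) \<longlonglongrightarrow> 0" by (simp add: o_def)
  qed (use prod in auto)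
  then have "fa \<bullet> y = 0 \<or> fb \<bullet> y = 0"
    using f_nonneg[OF yQ(1)] by (metis mult_pos_pos not_le order_less_le)
  then have "y = b \<or> y = a" using fa_zero[OF yQ(1)] fb_zero[OF yQ(1)] yQ(2) by auto
  then have xyC: "x + y \<in> Cn" using add_a_Cn[OF xQ(1) fx(2)] add_b_Cn[OF xQ(1) fx(1)] by auto
  have pxC: "axis_proj x \<in> Cn" unfolding axis_proj_def by (intro axis_Cn fx)
  have "\<forall>\<^sub>F n in sequentially. hd (X (r n) + Y (r n)) (x + y) \<le> 1"
    using eventually_compose_filterlim[OF hd_near[OF xyC] tendsto_add[OF X Y]] by (auto elim: eventually_mono)
  moreover have "\<forall>\<^sub>F n in sequentially. hd (axis_proj (X (r n))) (axis_proj x) \<le> 1"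
    using eventually_compose_filterlim[OF hd_near[OF pxC] tendsto_axis_proj[OF X]] by (auto elim: eventually_mono)
  moreover have "\<forall>\<^sub>F n in sequentially. 2 + hd (x + y) (axis_proj x) \<le> real n"
    by (simp add: filterlim_real_sequentially[unfolded filterlim_at_top])
  ultimately have "\<forall>\<^sub>F n in sequentially. False"
  proof eventually_elim
    case (elim n)
    have C: "X (r n) + Y (r n) \<in> Cn" "axis_proj (X (r n)) \<in> Cn" using XY Cn_add axis_proj_Cn by auto
    have "real (r n) < hd (X (r n) + Y (r n)) (axis_proj (X (r n)))" using XY(8) .
    also have "\<dots> \<le> hd (X (r n) + Y (r n)) (x + y) + hd (x + y) (axis_proj (X (r n)))"
      using C xyC by (intro hd_triangle)
    also have "hd (x + y) (axis_proj (X (r n))) \<le> hd (x + y) (axis_proj x) + hd (axis_proj x) (axis_proj (X (r n)))"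
      using C xyC pxC by (intro hd_triangle)
    also have "hd (axis_proj x) (axis_proj (X (r n))) = hd (axis_proj (X (r n))) (axis_proj x)"
      using C pxC by (intro hd_sym)
    finally have "real (r n) < 2 + hd (x + y) (axis_proj x)" using elim by simp
    then show False using elim seq_suble[OF p(2), of n] by linarith
  qed
  then show False by simp
qed

end

section \<open>Segments, orbits and axes\<close>

context convex_open_cone
begin

lemma base_convex: "x \<in> base \<Longrightarrow> y \<in> base \<Longrightarrow> \<tau> \<in> {0..1} \<Longrightarrow> (1 - \<tau>) *\<^sub>R x + \<tau> *\<^sub>R y \<in> base"
  by (auto simp: base_def inner_add_right intro!: K_add K_scale)

text \<open>Trading homogeneous coefficients for a parameter in [0, 1] makes the position on a
  segment range over a compact set.\<close>

lemma segment_normal_form: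
  assumes x: "x \<in> K" "x \<noteq> 0" and y: "y \<in> K" "y \<noteq> 0" and "0 \<le> s" "0 \<le> t" "0 < s + t"
  obtains d \<tau> where "0 < d" "\<tau> \<in> {0..1}" "s *\<^sub>R x + t *\<^sub>R y = d *\<^sub>R ((1 - \<tau>) *\<^sub>R nrm x + \<tau> *\<^sub>R nrm y)"
proof -
  define d where "d = s * (u \<bullet> x) + t * (u \<bullet> y)"
  have p: "0 < u \<bullet> x" "0 < u \<bullet> y" using u_pos x y by auto
  have "0 < s \<or> 0 < t" using assms by linarith
  then have d: "0 < d" using p assms by (auto simp: d_def add_pos_nonneg add_nonneg_pos)
  have 1: "1 - t * (u \<bullet> y) / d = s * (u \<bullet> x) / d" using d by (simp add: d_def field_simps)
  have "s *\<^sub>R x + t *\<^sub>R y = d *\<^sub>R ((1 - t * (u \<bullet> y) / d) *\<^sub>R nrm x + (t * (u \<bullet> y) / d) *\<^sub>R nrm y)"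
    unfolding 1 using d p by (simp add: nrm_def scaleR_add_right mult.assoc)
  moreover have "t * (u \<bullet> y) / d \<in> {0..1}" using d p assms by (simp add: d_def field_simps)
  ultimately show thesis using that d by blast
qed

text \<open>The parameters have a convergent subsequence, and \<open>HB\<close> is closed under
  limits. The ends of the limit segment may lie on the boundary.\<close>

lemma HB_segment_limit:
  assumes X: "X \<longlonglongrightarrow> x" and Y: "Y \<longlonglongrightarrow> y"
    and ev: "\<forall>\<^sub>F n in sequentially. \<exists>\<tau>\<in>{0..1}. HB E ((1 - \<tau>) *\<^sub>R X n + \<tau> *\<^sub>R Y n) v"
  shows "\<exists>\<tau>\<in>{0..1}. HB E ((1 - \<tau>) *\<^sub>R x + \<tau> *\<^sub>R y) v"
proof -
  obtain N where "\<And>n. N \<le> n \<Longrightarrow> \<exists>\<tau>\<in>{0..1}. HB E ((1 - \<tau>) *\<^sub>R X n + \<tau> *\<^sub>R Y n) v"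
    using ev by (auto simp: eventually_sequentially)
  then have "\<forall>n. \<exists>\<tau>\<in>{0..1}. HB E ((1 - \<tau>) *\<^sub>R X (n + N) + \<tau> *\<^sub>R Y (n + N)) v" by simp
  then obtain t where t: "\<And>n. t n \<in> {0..1::real}" "\<And>n. HB E ((1 - t n) *\<^sub>R X (n + N) + t n *\<^sub>R Y (n + N)) v"
    by metis
  obtain \<tau> r where r: "\<tau> \<in> {0..1}" "strict_mono (r :: nat \<Rightarrow> nat)" "(t \<circ> r) \<longlonglongrightarrow> \<tau>"
    using t(1) compact_Icc[of 0 "1::real"] unfolding compact_def by blast
  have X': "(\<lambda>n. X (r n + N)) \<longlonglongrightarrow> x"
    using LIMSEQ_subseq_LIMSEQ[OF LIMSEQ_ignore_initial_segment[OF X, of N] r(2)] by (simp add: o_def)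
  have Y': "(\<lambda>n. Y (r n + N)) \<longlonglongrightarrow> y"
    using LIMSEQ_subseq_LIMSEQ[OF LIMSEQ_ignore_initial_segment[OF Y, of N] r(2)] by (simp add: o_def)
  have T': "(\<lambda>n. t (r n)) \<longlonglongrightarrow> \<tau>" using r(3) by (simp add: o_def)
  have "(\<lambda>n. (1 - t (r n)) *\<^sub>R X (r n + N) + t (r n) *\<^sub>R Y (r n + N)) \<longlonglongrightarrow> (1 - \<tau>) *\<^sub>R x + \<tau> *\<^sub>R y"
    by (intro tendsto_intros X' Y' T')
  then have "HB E ((1 - \<tau>) *\<^sub>R x + \<tau> *\<^sub>R y) v" using HB_tendsto[OF _ tendsto_const t(2)] by blast
  then show ?thesis using r(1) by blast
qed

lemma tendsto_nrm: assumes "(X \<longlongrightarrow> x) F" "x \<in> K" "x \<noteq> 0" shows "((\<lambda>n. nrm (X n)) \<longlongrightarrow> nrm x) F"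
  unfolding nrm_def using u_pos[OF assms(2,3)] by (intro tendsto_intros assms(1)) auto

end

context cone_flow
begin

lemma hd_orbit_upper:
  assumes "x \<in> Cn" shows "hd (T j x) (T k x) \<le> \<bar>of_int (k - j)\<bar> * hd x (T 1 x)"
proof -
  have *: "hd x (T (int n) x) \<le> real n * hd x (T 1 x)" for n
  proof (induction n)
    case 0 show ?case using assms by (simp add: T_0 hd_self)
  next
    case (Suc n)
    have "hd x (T (int (Suc n)) x) \<le> hd x (T (int n) x) + hd (T (int n) x) (T (int (Suc n)) x)"
      using assms T_Cn by (intro hd_triangle) auto
    also have "hd (T (int n) x) (T (int (Suc n)) x) = hd x (T 1 x)" by (subst hd_orbit) simp
    finally show ?case using Suc by (simp add: algebra_simps)
  qed
  have "hd x (T i x) \<le> \<bar>of_int i\<bar> * hd x (T 1 x)" for i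
  proof (cases "0 \<le> i")
    case True then show ?thesis using *[of "nat i"] by simp
  next
    case False
    have "hd x (T i x) = hd (T (- i) x) x" using hd_T[of "- i" x "T i x"] by (simp add: T_inv T_add[symmetric] T_0)
    also have "\<dots> = hd x (T (- i) x)" using assms T_Cn by (intro hd_sym) auto
    finally show ?thesis using False *[of "nat (- i)"] by simp
  qed
  then show ?thesis unfolding hd_orbit .
qed

text \<open>An invariant plane that meets the cone in the sector spanned by \<open>a\<close> and \<open>b\<close>: the two
  extreme rays cannot be exchanged, as there would be a fixed ray between them.\<close>

lemma axis_eigenvectors:
  assumes ab: "a \<in> K" "b \<in> K" "a \<notin> Cn" "b \<notin> Cn" "a + b \<in> Cn"
    and span: "T 1 a \<in> span {a, b}" "T 1 b \<in> span {a, b}"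
    and nofix: "\<And>x. x \<in> Cn \<Longrightarrow> 0 < hd x (T 1 x)"
  obtains l m where "0 < l" "0 < m" "l \<noteq> m" "T 1 a = l *\<^sub>R a" "T 1 b = m *\<^sub>R b"
proof -
  obtain f where f: "f \<in> dual" "f \<noteq> 0" "f \<bullet> a = 0" using support_K ab by blast
  obtain g where g: "g \<in> dual" "g \<noteq> 0" "g \<bullet> b = 0" using support_K ab by blast
  have fg: "0 < f \<bullet> b" "0 < g \<bullet> a"
    using dual_pos[OF f(1,2) ab(5)] dual_pos[OF g(1,2) ab(5)] f g by (auto simp: inner_add_right)
  have nz: "a \<noteq> 0" "b \<noteq> 0" using fg by auto
  \<comment> \<open>In this plane the closed cone is the sector between the rays of \<open>a\<close>
    and \<open>b\<close>; outside the open cone only these two rays remain.\<close>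
  have *: "\<exists>s t. 0 \<le> s \<and> 0 \<le> t \<and> s * t = 0 \<and> v = s *\<^sub>R a + t *\<^sub>R b"
    if v: "v \<in> K" "v \<notin> Cn" "v \<in> span {a, b}" for v
  proof -
    obtain s t where st: "v = s *\<^sub>R a + t *\<^sub>R b" using v(3) by (auto simp: span_insert span_singleton algebra_simps)
    have "0 \<le> t * (f \<bullet> b)" using dual_K[OF f(1) v(1)] f by (simp add: st inner_add_right)
    then have t: "0 \<le> t" using fg by (simp add: zero_le_mult_iff)
    have "0 \<le> s * (g \<bullet> a)" using dual_K[OF g(1) v(1)] g by (simp add: st inner_add_right)
    then have s: "0 \<le> s" using fg by (simp add: zero_le_mult_iff)
    have "\<not> (0 < s \<and> 0 < t)" using Cn_of_sum'[OF ab(1,2) _ _ ab(5)] v(2) st by blast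
    then have "s * t = 0" using s t by auto
    then show ?thesis using s t st by blast
  qed
  obtain s t where st: "0 \<le> s" "0 \<le> t" "s * t = 0" "T 1 a = s *\<^sub>R a + t *\<^sub>R b"
    using *[of "T 1 a"] T_K ab T_Cn_iff span by blast
  obtain s' t' where st': "0 \<le> s'" "0 \<le> t'" "s' * t' = 0" "T 1 b = s' *\<^sub>R a + t' *\<^sub>R b"
    using *[of "T 1 b"] T_K ab T_Cn_iff span by blast
  have n: "s \<noteq> 0 \<or> t \<noteq> 0" "s' \<noteq> 0 \<or> t' \<noteq> 0" using T_nz nz st(4) st'(4) by force+
  have C: "T 1 a + T 1 b \<in> Cn" using T_Cn[OF ab(5), of 1] by (simp add: T_lin)
  have nofix': "\<not> (x \<in> Cn \<and> 0 < c \<and> T 1 x = c *\<^sub>R x)" for x c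
    using nofix[of x] hd_scale[of x x 1 c] hd_self by force
  have "T 1 a + T 1 b = (s + s') *\<^sub>R a + (t + t') *\<^sub>R b" using st(4) st'(4) by (simp add: scaleR_add_left)
  then have "0 < f \<bullet> ((s + s') *\<^sub>R a + (t + t') *\<^sub>R b)" "0 < g \<bullet> ((s + s') *\<^sub>R a + (t + t') *\<^sub>R b)"
    using dual_pos[OF f(1,2) C] dual_pos[OF g(1,2) C] by simp_all
  then have ss: "0 < s + s'" "0 < t + t'" using f g fg by (simp_all add: inner_add_right zero_less_mult_iff)
  show thesis
  proof (cases "t = 0")
    case True
    then have t': "0 < t'" "s' = 0" using ss st' by auto
    then have s: "0 < s" using ss by simp
    have "T 1 (a + b) = s *\<^sub>R a + t' *\<^sub>R b" using st st' True t' by (simp add: T_lin)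
    \<comment> \<open>Equal eigenvalues would fix the ray of \<open>a + b\<close>.\<close>
    then have "s \<noteq> t'" using nofix'[of "a + b" s] ab(5) s by (auto simp: scaleR_add_right)
    then show ?thesis using that[of s t'] s t' st st' True by simp
  next
    case False
    then have t: "0 < t" "s = 0" using st by auto
    then have s': "0 < s'" "t' = 0" using ss st' by auto
    \<comment> \<open>If the rays are exchanged, \<open>T 1 a = t b\<close> and
      \<open>T 1 b = s' a\<close>, then for this \<open>q\<close> the vector \<open>a + q b\<close>
      is mapped to a multiple of itself, against \<open>nofix\<close>.\<close>
    define q where "q = sqrt (t / s')"
    have q: "0 < q" "q * q = t / s'" using t s' by (auto simp: q_def)
    have "T 1 (a + q *\<^sub>R b) = (q * s') *\<^sub>R a + t *\<^sub>R b" using st st' t s' by (simp add: T_lin)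
    also have "t = (q * s') * q" using q(2) s' by (simp add: field_simps)
    finally have "T 1 (a + q *\<^sub>R b) = (q * s') *\<^sub>R (a + q *\<^sub>R b)" by (simp add: scaleR_add_right)
    moreover have "a + q *\<^sub>R b \<in> Cn" using Cn_of_sum'[OF ab(1,2) zero_less_one q(1) ab(5)] by simp
    ultimately show ?thesis using nofix'[of "a + q *\<^sub>R b" "q * s'"] q s' by simp
  qed
qed

end

section \<open>Contracting orbits\<close>

text \<open>\<open>J x\<close> is the index of the orbit point to which \<open>x\<close> projects.\<close>

locale contracting_flow = cone_flow Cn u T for Cn :: "'a::euclidean_space set" and u T +
  fixes x0 :: 'a and J :: "'a \<Rightarrow> int" and c \<kappa> :: real
  assumes x0: "x0 \<in> Cn" and c_nonneg: "0 \<le> c" and \<kappa>_pos: "0 < \<kappa>"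
    and qi: "\<And>k. \<kappa> * \<bar>of_int k\<bar> - c \<le> hd x0 (T k x0)"
    and J_orbit: "\<And>k. \<bar>of_int (J (T k x0) - k)\<bar> \<le> c"
    and contr: "\<And>x y. x \<in> Cn \<Longrightarrow> y \<in> Cn \<Longrightarrow> c \<le> \<bar>of_int (J x - J y)\<bar> \<Longrightarrow>
       \<exists>s\<ge>0. \<exists>t\<ge>0. 0 < s + t \<and> hd (s *\<^sub>R x + t *\<^sub>R y) (T (J x) x0) \<le> c"
begin

abbreviation w :: "int \<Rightarrow> 'a" where "w k \<equiv> T k x0"

lemma w_Cn: "w k \<in> Cn" using T_Cn x0 by blast

lemma qi': "\<kappa> * \<bar>of_int (k - j)\<bar> - c \<le> hd (w j) (w k)"
  unfolding hd_orbit by (rule qi)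

lemma rev_contracting: "contracting_flow Cn u (\<lambda>k. T (- k)) x0 (\<lambda>x. - J x) c \<kappa>"
proof (intro contracting_flow.intro rev_flow contracting_flow_axioms.intro)
  show "\<kappa> * \<bar>of_int k\<bar> - c \<le> hd x0 (T (- k) x0)" for k using qi[of "- k"] by simp
  show "\<bar>of_int (- J (T (- k) x0) - k)\<bar> \<le> c" for k using J_orbit[of "- k"] by simp
  show "\<exists>s\<ge>0. \<exists>t\<ge>0. 0 < s + t \<and> hd (s *\<^sub>R x + t *\<^sub>R y) (T (- (- J x)) x0) \<le> c"
    if "x \<in> Cn" "y \<in> Cn" "c \<le> \<bar>of_int (- J x - - J y)\<bar>" for x y
    using contr[OF that(1,2)] that(3) by (simp add: abs_minus_commute)
qed (use x0 c_nonneg \<kappa>_pos in auto)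

lemma contr2:
  assumes "x \<in> Cn" "y \<in> Cn" "c \<le> \<bar>of_int (J x - J y)\<bar>"
  shows "\<exists>s\<ge>0. \<exists>t\<ge>0. 0 < s + t \<and> hd (s *\<^sub>R x + t *\<^sub>R y) (w (J y)) \<le> c"
proof -
  have "c \<le> \<bar>of_int (J y - J x)\<bar>" using assms(3) by simp
  from contr[OF assms(2,1) this] obtain s t where "0 \<le> s" "0 \<le> t" "0 < s + t" "hd (s *\<^sub>R y + t *\<^sub>R x) (w (J y)) \<le> c"
    by blast
  then show ?thesis by (metis add.commute)
qed

text \<open>The orbit points of \<open>x\<close> and \<open>y\<close> are within \<open>c\<close> of
  points of [x, y], which are within \<open>D\<close> of \<open>x\<close>; so they are at most 2 c +
  2 D apart. \<open>qi\<close> costs another \<open>c\<close> and the factor 1 / \<kappa>. The first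
  \<open>c\<close> covers indices too close for \<open>contr\<close>.\<close>

definition J_modulus :: "real \<Rightarrow> real" where "J_modulus D = c + (3 * c + 2 * D) / \<kappa>"

lemma J_modulus_nonneg: "0 \<le> D \<Longrightarrow> 0 \<le> J_modulus D" using c_nonneg \<kappa>_pos by (simp add: J_modulus_def)

lemma J_lipschitz:
  assumes "x \<in> Cn" "y \<in> Cn" "hd x y \<le> D" shows "\<bar>of_int (J x - J y)\<bar> \<le> J_modulus D"
proof (cases "c \<le> \<bar>of_int (J x - J y)\<bar>")
  case True
  obtain s t where 1: "0 \<le> s" "0 \<le> t" "0 < s + t" "hd (s *\<^sub>R x + t *\<^sub>R y) (w (J x)) \<le> c"
    using contr[OF assms(1,2) True] by blast
  obtain s' t' where 2: "0 \<le> s'" "0 \<le> t'" "0 < s' + t'" "hd (s' *\<^sub>R x + t' *\<^sub>R y) (w (J y)) \<le> c"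
    using contr2[OF assms(1,2) True] by blast
  let ?p = "s *\<^sub>R x + t *\<^sub>R y" and ?q = "s' *\<^sub>R x + t' *\<^sub>R y"
  note p = hd_segment[OF assms(1,2) 1(1-3)] and q = hd_segment[OF assms(1,2) 2(1-3)]
  have "hd (w (J x)) (w (J y)) \<le> hd (w (J x)) ?p + hd ?p (w (J y))" using p w_Cn by (intro hd_triangle) auto
  also have "hd ?p (w (J y)) \<le> hd ?p x + hd x (w (J y))" using p w_Cn assms by (intro hd_triangle) auto
  also have "hd x (w (J y)) \<le> hd x ?q + hd ?q (w (J y))" using q w_Cn assms by (intro hd_triangle) auto
  finally have "hd (w (J x)) (w (J y)) \<le> 2 * c + 2 * D"
    using p q 1 2 assms hd_sym[OF w_Cn p(1), of "J x"] hd_sym[OF p(1) assms(1)] by simp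
  then have "\<kappa> * \<bar>of_int (J x - J y)\<bar> \<le> 3 * c + 2 * D"
    using qi'[of "J x" "J y"] hd_sym[OF w_Cn w_Cn, of "J x" "J y"] by (simp add: abs_minus_commute)
  then have "\<bar>of_int (J x - J y)\<bar> \<le> (3 * c + 2 * D) / \<kappa>" using \<kappa>_pos by (simp add: field_simps)
  then show ?thesis using c_nonneg by (simp add: J_modulus_def)
next
  case False
  have "0 \<le> (3 * c + 2 * D) / \<kappa>" using hd_nonneg[OF assms(1,2)] assms(3) c_nonneg \<kappa>_pos by simp
  then show ?thesis using False by (simp add: J_modulus_def)
qed

text \<open>The orbit of \<open>x1\<close> stays at distance \<open>D\<close> from that of
  \<open>x0\<close>, so the same \<open>J\<close> serves with a larger constant. This allows the
  orbit to be placed on a given axis.\<close>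

lemma change_basepoint:
  assumes "x1 \<in> Cn" obtains c' where "contracting_flow Cn u T x1 J c' \<kappa>"
proof -
  define D where "D = hd x0 x1"
  have D: "0 \<le> D" using hd_nonneg[OF x0 assms] by (simp add: D_def)
  define c' where "c' = c + 2 * D + J_modulus D"
  have c': "c + 2 * D \<le> c'" "c + J_modulus D \<le> c'" using D J_modulus_nonneg[OF D] by (auto simp: c'_def)
  have x1: "T k x1 \<in> Cn" "hd (w k) (T k x1) = D" "hd (T k x1) (w k) = D" for k
    using assms T_Cn by (auto simp: hd_T D_def hd_sym[OF assms x0])
  have "contracting_flow Cn u T x1 J c' \<kappa>"
  proof (unfold_locales, goal_cases)
    case 1 show ?case by (rule assms)
  next
    case 2 show ?case using c' c_nonneg D by simp
  next
    case 3 show ?case by (rule \<kappa>_pos)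
  next
    case (4 k)
    have "hd x0 (w k) \<le> hd x0 x1 + hd x1 (w k)" using x0 assms w_Cn by (intro hd_triangle) auto
    also have "hd x1 (w k) \<le> hd x1 (T k x1) + hd (T k x1) (w k)" using assms x1 w_Cn by (intro hd_triangle) auto
    finally show ?case using qi[of k] x1 c' by (simp add: D_def)
  next
    case (5 k)
    have "\<bar>of_int (J (T k x1) - J (w k))\<bar> \<le> J_modulus D" using x1 w_Cn by (intro J_lipschitz) auto
    then show ?case using J_orbit[of k] c' by simp
  next
    case (6 x y)
    obtain s t where st: "0 \<le> s" "0 \<le> t" "0 < s + t" "hd (s *\<^sub>R x + t *\<^sub>R y) (w (J x)) \<le> c"
      using contr[of x y] 6 c' D by fastforce
    have "hd (s *\<^sub>R x + t *\<^sub>R y) (T (J x) x1) \<le> hd (s *\<^sub>R x + t *\<^sub>R y) (w (J x)) + hd (w (J x)) (T (J x) x1)"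
      using 6 st x1 w_Cn by (intro hd_triangle hd_segment) auto
    then have "hd (s *\<^sub>R x + t *\<^sub>R y) (T (J x) x1) \<le> c'" using st x1 c' D by simp
    then show ?case using st by blast
  qed
  then show thesis by (rule that)
qed

text \<open>A displacement below \<kappa> at \<open>x\<close> adds up over \<open>n\<close> steps to
  less than \<kappa> n minus any constant, for large \<open>n\<close>, while the orbits of
  \<open>x\<close> and \<open>x0\<close> stay at bounded distance. This makes the translation length
  positive and excludes fixed points in the domain.\<close>

lemma translation_lower: assumes "x \<in> Cn" shows "\<kappa> \<le> hd x (T 1 x)"
proof (rule ccontr)
  assume "\<not> \<kappa> \<le> hd x (T 1 x)"
  then have e: "0 < \<kappa> - hd x (T 1 x)" by simp
  obtain n :: nat where n: "2 * hd x0 x + c < real n * (\<kappa> - hd x (T 1 x))"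
    using reals_Archimedean3[OF e] by blast
  have "hd x0 (w (int n)) \<le> hd x0 x + hd x (w (int n))" using x0 assms w_Cn by (intro hd_triangle) auto
  also have "hd x (w (int n)) \<le> hd x (T (int n) x) + hd (T (int n) x) (w (int n))"
    using assms T_Cn w_Cn by (intro hd_triangle) auto
  also have "hd (T (int n) x) (w (int n)) = hd x0 x" by (simp add: hd_T hd_sym[OF assms x0])
  also have "hd x (T (int n) x) \<le> real n * hd x (T 1 x)" using hd_orbit_upper[OF assms, of 0 "int n"] by (simp add: T_0)
  finally show False using qi[of "int n"] n by (simp add: algebra_simps)
qed

subsection \<open>Segments between orbit points stay near the orbit\<close>

abbreviation \<delta> :: real where "\<delta> \<equiv> hd x0 (T 1 x0)"

text \<open>The summand \<open>c\<close> comes from one use of contraction, the rest from replacing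
  an orbit point by another whose index differs by at most
  \<open>2 * c + J_modulus 1\<close>.\<close>

definition morse_radius :: real where "morse_radius = c + (2 * c + J_modulus 1) * \<delta>"

lemma \<delta>_nonneg: "0 \<le> \<delta>" using hd_nonneg[OF x0 w_Cn] .

lemma hd_w_le: "\<bar>of_int (j - k)\<bar> \<le> r \<Longrightarrow> hd (w j) (w k) \<le> r * \<delta>"
proof -
  assume "\<bar>real_of_int (j - k)\<bar> \<le> r"
  then have "\<bar>real_of_int (k - j)\<bar> * \<delta> \<le> r * \<delta>" using \<delta>_nonneg by (intro mult_right_mono) auto
  then show ?thesis using hd_orbit_upper[OF x0, of j k] by linarith
qed

text \<open>An intermediate value argument for the discontinuous \<open>J\<close>: unless an end
  point serves, \<open>J\<close> passes along the segment from at most \<open>j\<close> to more than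
  \<open>j\<close>, and where this changes it is within \<open>J_modulus 1\<close> of
  \<open>j\<close>. Contraction is then applied to the part of the segment up to this point.\<close>

lemma morse:
  assumes "m \<le> j" "j \<le> n"
  shows "\<exists>s\<ge>0. \<exists>t\<ge>0. 0 < s + t \<and> hd (s *\<^sub>R w m + t *\<^sub>R w n) (w j) \<le> morse_radius"
proof -
  have L1: "0 \<le> J_modulus 1" by (simp add: J_modulus_nonneg)
  have Mo1: "r * \<delta> \<le> morse_radius" if "r \<le> 2 * c + J_modulus 1" for r
    using mult_right_mono[OF that \<delta>_nonneg] c_nonneg by (simp add: morse_radius_def)
  have near_m: ?thesis if "\<bar>of_int (m - j)\<bar> \<le> 2 * c + J_modulus 1"
    using hd_w_le[OF that] Mo1[of "2 * c + J_modulus 1"] by (intro exI[of _ 1] exI[of _ 0] conjI) auto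
  have near_n: ?thesis if "\<bar>of_int (n - j)\<bar> \<le> 2 * c + J_modulus 1"
    using hd_w_le[OF that] Mo1[of "2 * c + J_modulus 1"] by (intro exI[of _ 0] exI[of _ 1] conjI) auto
  define z where "z \<tau> = (1 - \<tau>) *\<^sub>R w m + \<tau> *\<^sub>R w n" for \<tau> :: real
  have z_Cn: "z \<tau> \<in> Cn" if "\<tau> \<in> {0..1}" for \<tau>
    unfolding z_def using that by (intro hd_segment(1) w_Cn) auto
  have z01: "z 0 = w m" "z 1 = w n" by (auto simp: z_def)
  show ?thesis
  proof (cases "J (z 0) \<le> j \<and> \<not> J (z 1) \<le> j")
    case False
    \<comment> \<open>If \<open>J\<close> does not cross \<open>j\<close>, then by
      \<open>J_orbit\<close> the index \<open>j\<close> is within \<open>c\<close> of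
      \<open>m\<close> or \<open>n\<close>, and an end point of the segment serves.\<close>
    then consider "j < J (w m)" | "J (w n) \<le> j" using z01 by force
    then show ?thesis
    proof cases
      case 1 then show ?thesis using J_orbit[of m] assms L1 c_nonneg by (intro near_m) linarith
    next
      case 2 then show ?thesis using J_orbit[of n] assms L1 c_nonneg by (intro near_n) linarith
    qed
  next
    case True
    \<comment> \<open>A predicate that is locally constant on [0, 1] is constant, but this one
      differs at the two ends.\<close>
    have "\<exists>\<tau>\<in>{0..1}. \<not> (\<forall>\<^sub>F \<sigma> in at \<tau> within {0..1}. (J (z \<tau>) \<le> j) = (J (z \<sigma>) \<le> j))"
    proof (rule ccontr)
      assume "\<not> ?thesis"
      then have "(J (z 0) \<le> j) = (J (z 1) \<le> j)"
        using connected_local_const[of "{0..1::real}" 0 1 "\<lambda>\<tau>. J (z \<tau>) \<le> j"] by auto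
      then show False using True by blast
    qed
    then obtain \<tau> where \<tau>: "\<tau> \<in> {0..1}" "\<not> (\<forall>\<^sub>F \<sigma> in at \<tau> within {0..1}. (J (z \<tau>) \<le> j) = (J (z \<sigma>) \<le> j))"
      by blast
    have "((\<lambda>\<sigma>. z \<sigma>) \<longlongrightarrow> z \<tau>) (at \<tau> within {0..1})" unfolding z_def by (intro tendsto_intros)
    then have "\<forall>\<^sub>F \<sigma> in at \<tau> within {0..1}. z \<sigma> \<in> Cn \<and> hd (z \<sigma>) (z \<tau>) \<le> 1"
      using eventually_compose_filterlim[OF hd_near[OF z_Cn[OF \<tau>(1)]]] by blast
    then have "\<exists>\<sigma>. (z \<sigma> \<in> Cn \<and> hd (z \<sigma>) (z \<tau>) \<le> 1) \<and> (J (z \<tau>) \<le> j) \<noteq> (J (z \<sigma>) \<le> j)"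
      using \<tau>(2) eventually_mono[of "\<lambda>\<sigma>. z \<sigma> \<in> Cn \<and> hd (z \<sigma>) (z \<tau>) \<le> 1" "at \<tau> within {0..1}"
        "\<lambda>\<sigma>. (J (z \<tau>) \<le> j) = (J (z \<sigma>) \<le> j)"] by meson
    then obtain \<sigma> where \<sigma>: "z \<sigma> \<in> Cn" "hd (z \<sigma>) (z \<tau>) \<le> 1" "(J (z \<tau>) \<le> j) \<noteq> (J (z \<sigma>) \<le> j)"
      by blast
    have "\<bar>of_int (J (z \<sigma>) - J (z \<tau>))\<bar> \<le> J_modulus 1" using \<sigma> z_Cn[OF \<tau>(1)] by (intro J_lipschitz)
    then have Jj: "\<bar>of_int (J (z \<tau>) - j)\<bar> \<le> J_modulus 1" using \<sigma>(3) by linarith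
    show ?thesis
    \<comment> \<open>Without this gap contraction does not apply, but then \<open>j\<close> is
      close to \<open>m\<close> and the end point \<open>w m\<close> serves.\<close>
    proof (cases "c \<le> \<bar>of_int (J (w m) - J (z \<tau>))\<bar>")
      case True
      obtain s t where st: "0 \<le> s" "0 \<le> t" "0 < s + t" "hd (s *\<^sub>R w m + t *\<^sub>R z \<tau>) (w (J (z \<tau>))) \<le> c"
        using contr2[OF w_Cn z_Cn[OF \<tau>(1)] True] by blast
      have C: "s *\<^sub>R w m + t *\<^sub>R z \<tau> \<in> Cn" using st by (intro hd_segment(1) w_Cn z_Cn[OF \<tau>(1)])
      have "hd (s *\<^sub>R w m + t *\<^sub>R z \<tau>) (w j)
        \<le> hd (s *\<^sub>R w m + t *\<^sub>R z \<tau>) (w (J (z \<tau>))) + hd (w (J (z \<tau>))) (w j)"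
        by (intro hd_triangle C w_Cn)
      also have "\<dots> \<le> c + J_modulus 1 * \<delta>" using st(4) hd_w_le[OF Jj] by simp
      also have "\<dots> \<le> morse_radius" using c_nonneg \<delta>_nonneg by (simp add: morse_radius_def algebra_simps)
      finally have "hd ((s + t * (1 - \<tau>)) *\<^sub>R w m + (t * \<tau>) *\<^sub>R w n) (w j) \<le> morse_radius"
        by (simp add: z_def scaleR_add_left scaleR_add_right add.assoc)
      moreover have "0 \<le> s + t * (1 - \<tau>)" "0 \<le> t * \<tau>" "0 < (s + t * (1 - \<tau>)) + t * \<tau>"
      proof -
        have "(s + t * (1 - \<tau>)) + t * \<tau> = s + t" by (simp add: algebra_simps)
        then show "0 < (s + t * (1 - \<tau>)) + t * \<tau>" using st by simp
      qed (use st \<tau>(1) in auto)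
      ultimately show ?thesis by blast
    next
      case False
      then show ?thesis using Jj J_orbit[of m] L1 c_nonneg by (intro near_m) linarith
    qed
  qed
qed

lemma morse_base:
  assumes "m \<le> j" "j \<le> n"
  shows "\<exists>\<tau>\<in>{0..1}. HB (exp (2 * morse_radius)) ((1 - \<tau>) *\<^sub>R nrm (w m) + \<tau> *\<^sub>R nrm (w n)) (w j)"
proof -
  obtain s t where st: "0 \<le> s" "0 \<le> t" "0 < s + t" "hd (s *\<^sub>R w m + t *\<^sub>R w n) (w j) \<le> morse_radius"
    using morse[OF assms] by blast
  obtain d \<tau> where d: "0 < d" "\<tau> \<in> {0..1}" "s *\<^sub>R w m + t *\<^sub>R w n = d *\<^sub>R ((1 - \<tau>) *\<^sub>R nrm (w m) + \<tau> *\<^sub>R nrm (w n))"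
    using segment_normal_form[OF Cn_subset_K[OF w_Cn] Cn_nz[OF w_Cn] Cn_subset_K[OF w_Cn] Cn_nz[OF w_Cn] st(1-3)] by metis
  have "HB (exp (2 * morse_radius)) (s *\<^sub>R w m + t *\<^sub>R w n) (w j)"
    by (intro hd_HB st(4) w_Cn hd_segment(1) st(1-3))
  then show ?thesis unfolding d(3) HB_scale_left[OF d(1)] using d(2) by blast
qed

subsection \<open>Fixed points on the boundary\<close>

text \<open>If the limit were interior, infinitely many orbit points would stay at bounded distance
  from \<open>x0\<close>, against \<open>qi\<close>.\<close>

lemma forward_limit:
  obtains a r where "a \<in> base" "a \<notin> Cn" "strict_mono (r :: nat \<Rightarrow> nat)" "(\<lambda>n. nrm (w (int (r n)))) \<longlonglongrightarrow> a"
proof -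
  define W where "W n = nrm (w (int n))" for n
  have "\<forall>n. W n \<in> base" unfolding W_def by (intro allI nrm_base Cn_subset_K w_Cn Cn_nz)
  then obtain a r where a: "a \<in> base" "strict_mono (r :: nat \<Rightarrow> nat)" "(W \<circ> r) \<longlonglongrightarrow> a"
    using compact_base unfolding compact_def by blast
  then have lim: "(\<lambda>n. nrm (w (int (r n)))) \<longlonglongrightarrow> a" by (simp add: o_def W_def)
  have "a \<notin> Cn"
  proof
    assume aC: "a \<in> Cn"
    have "\<forall>\<^sub>F n in sequentially. hd (nrm (w (int (r n)))) a \<le> 1"
      using eventually_compose_filterlim[OF hd_near[OF aC] lim] by (auto elim: eventually_mono)
    moreover have "\<forall>\<^sub>F n in sequentially. (2 + hd x0 a + c) / \<kappa> \<le> real n"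
      by (simp add: filterlim_real_sequentially[unfolded filterlim_at_top])
    ultimately have "\<forall>\<^sub>F n::nat in sequentially. False"
    proof eventually_elim
      case (elim n)
      have "hd x0 (w (int (r n))) \<le> hd x0 a + hd a (w (int (r n)))" using x0 aC w_Cn by (intro hd_triangle)
      also have "hd a (w (int (r n))) = hd (nrm (w (int (r n)))) a"
        using aC w_Cn by (simp add: hd_nrm hd_sym)
      finally have "\<kappa> * real (r n) \<le> 1 + hd x0 a + c" using elim(1) qi[of "int (r n)"] by simp
      moreover have "2 + hd x0 a + c \<le> \<kappa> * real n" using elim(2) \<kappa>_pos by (simp add: field_simps)
      moreover have "\<kappa> * real n \<le> \<kappa> * real (r n)" using seq_suble[OF a(2), of n] \<kappa>_pos by simp
      ultimately show False by linarith
    qed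
    then show False by simp
  qed
  then show thesis using that a lim by blast
qed

text \<open>Let the far end in \<open>morse_base\<close> tend to \<open>a\<close>: the segment from
  \<open>nrm x0\<close> to \<open>a\<close> passes near every \<open>w j\<close>, at a point
  \<open>p j\<close>. These points tend to \<open>a\<close>, because up to any parameter y < 1 the
  segment stays at bounded distance from \<open>x0\<close>, while the orbit escapes.\<close>

lemma ray_to_limit:
  assumes a: "a \<in> base" and r: "strict_mono (r :: nat \<Rightarrow> nat)" and lim: "(\<lambda>n. nrm (w (int (r n)))) \<longlonglongrightarrow> a"
  obtains p where "\<And>j::nat. p j \<in> base" "\<And>j. HB (exp (2 * morse_radius)) (p j) (w (int j))" "p \<longlonglongrightarrow> a"
proof -
  have "\<exists>\<tau>\<in>{0..1}. HB (exp (2 * morse_radius)) ((1 - \<tau>) *\<^sub>R nrm x0 + \<tau> *\<^sub>R a) (w (int j))" for j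
  proof (rule HB_segment_limit[OF tendsto_const lim])
    show "\<forall>\<^sub>F n in sequentially. \<exists>\<tau>\<in>{0..1}. HB (exp (2 * morse_radius)) ((1 - \<tau>) *\<^sub>R nrm x0 + \<tau> *\<^sub>R nrm (w (int (r n)))) (w (int j))"
      using eventually_ge_at_top[of j]
    proof eventually_elim
      case (elim n)
      have "int j \<le> int (r n)" using elim seq_suble[OF r, of n] by simp
      then show ?case using morse_base[of 0 "int j" "int (r n)"] by (simp add: T_0)
    qed
  qed
  then obtain t where t: "\<And>j. t j \<in> {0..1::real}"
    "\<And>j. HB (exp (2 * morse_radius)) ((1 - t j) *\<^sub>R nrm x0 + t j *\<^sub>R a) (w (int j))" by metis
  define x where "x = nrm x0"
  have xC: "x \<in> Cn" unfolding x_def using x0 by (rule nrm_Cn)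
  have xb: "x \<in> base" unfolding x_def using x0 by (intro nrm_base Cn_subset_K Cn_nz)
  define p where "p j = (1 - t j) *\<^sub>R x + t j *\<^sub>R a" for j
  have pb: "p j \<in> base" for j unfolding p_def by (intro base_convex xb a t)
  have pK: "p j \<in> K" for j using pb by (simp add: base_def)
  have aK: "a \<in> K" using a by (simp add: base_def)
  have pw: "HB (exp (2 * morse_radius)) (p j) (w (int j))" for j using t(2) by (simp add: p_def x_def)
  obtain e where e: "0 < e" "\<And>f. f \<in> dual \<Longrightarrow> e * (f \<bullet> a) \<le> f \<bullet> x" using dominate[OF xC] by blast
  have "t \<longlonglongrightarrow> 1"
  proof (rule order_tendstoI)
    fix y :: real assume "1 < y" then show "\<forall>\<^sub>F j in sequentially. t j < y"
      using t(1) by (intro always_eventually allI) (auto intro: le_less_trans)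
  next
    fix y :: real assume y: "y < 1"
    \<comment> \<open>On dual functionals \<open>p j\<close> is at least \<open>1 - y\<close> times
      and at most \<open>1 + 1 / e\<close> times \<open>x\<close>; the quotient bounds the cross
      ratios.\<close>
    define F where "F = (1 + 1 / e) / (1 - y)"
    have F: "0 \<le> F" using e y by (simp add: F_def)
    have "\<forall>\<^sub>F j in sequentially. (1 + 1 / 2 * ln (exp (2 * morse_radius) * F + 1) + c) / \<kappa> \<le> real j"
      by (simp add: filterlim_real_sequentially[unfolded filterlim_at_top])
    then show "\<forall>\<^sub>F j in sequentially. y < t j"
    proof eventually_elim
      case (elim j)
      show ?case
      proof (rule ccontr)
        assume "\<not> y < t j"
        then have ty: "t j \<le> y" by simp
        have "HB F x (p j)" unfolding HB_def
        proof (intro ballI)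
          fix f g assume fg: "f \<in> dual" "g \<in> dual"
          have n: "0 \<le> f \<bullet> x" "0 \<le> g \<bullet> x" "0 \<le> f \<bullet> a" "0 \<le> g \<bullet> a" "0 \<le> f \<bullet> p j" "0 \<le> g \<bullet> p j"
            using fg dual_K aK pK xC Cn_subset_K by auto
          have tj: "0 \<le> t j" "t j \<le> 1" using t(1)[of j] by auto
          have "(1 - y) * (f \<bullet> x) \<le> (1 - t j) * (f \<bullet> x)" using ty n by (intro mult_right_mono) auto
          also have "\<dots> \<le> f \<bullet> p j" using tj n by (simp add: p_def inner_add_right)
          finally have 1: "(1 - y) * (f \<bullet> x) \<le> f \<bullet> p j" .
          have "g \<bullet> p j \<le> 1 * (g \<bullet> x) + 1 * (g \<bullet> a)" unfolding p_def inner_add_right inner_scaleR_right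
            using tj n by (intro add_mono mult_right_mono) auto
          also have "\<dots> \<le> (1 + 1 / e) * (g \<bullet> x)" using e(2)[OF fg(2)] e(1) by (simp add: field_simps)
          finally have 2: "g \<bullet> p j \<le> (1 + 1 / e) * (g \<bullet> x)" .
          have "((1 - y) * (f \<bullet> x)) * (g \<bullet> p j) \<le> (f \<bullet> p j) * ((1 + 1 / e) * (g \<bullet> x))"
            using 1 2 n y by (intro mult_mono) auto
          then show "(f \<bullet> x) * (g \<bullet> p j) \<le> F * ((f \<bullet> p j) * (g \<bullet> x))"
            unfolding F_def times_divide_eq_left using y by (subst pos_le_divide_eq) (auto simp: mult_ac)
        qed
        then have "HB (exp (2 * morse_radius) * F) (w (int j)) x"
          using pw HB_sym F pK xC w_Cn Cn_subset_K
            HB_Cn[OF pw pK w_Cn base_nz[OF pb]] by (intro HB_trans[of _ _ "p j"]) auto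
        \<comment> \<open>Adding 1 makes the argument of the logarithm positive.\<close>
        then have "HB (exp (2 * morse_radius) * F + 1) x0 (w (int j))"
          using HB_sym HB_mono[of "exp (2 * morse_radius) * F" x "w (int j)" "exp (2 * morse_radius) * F + 1"] xC w_Cn Cn_subset_K
            HB_scale_left[of "inverse (u \<bullet> x0)" _ x0] u_pos_Cn[OF x0] by (auto simp: x_def nrm_def)
        moreover have "0 < exp (2 * morse_radius) * F + 1" using F by (simp add: add_nonneg_pos)
        ultimately have "hd x0 (w (int j)) \<le> 1 / 2 * ln (exp (2 * morse_radius) * F + 1)"
          unfolding hd_le_iff[OF x0 w_Cn] by simp
        moreover have "1 + 1 / 2 * ln (exp (2 * morse_radius) * F + 1) + c \<le> \<kappa> * real j" using elim \<kappa>_pos by (simp add: field_simps)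
        ultimately show False using qi[of "int j"] by simp
      qed
    qed
  qed
  then have "p \<longlonglongrightarrow> (1 - 1) *\<^sub>R x + 1 *\<^sub>R a" unfolding p_def by (intro tendsto_intros)
  then have "p \<longlonglongrightarrow> a" by simp
  then show thesis using that pb pw by blast
qed

text \<open>\<open>T k (p j)\<close> and \<open>p (j + k)\<close> are both near the orbit point
  \<open>w (j + k)\<close>. As \<open>j\<close> grows they tend to \<open>T k a\<close> and
  \<open>a\<close>, with a bound independent of \<open>k\<close>; negative \<open>k\<close> follow
  by applying \<open>T k\<close>.\<close>

lemma limit_quasi_fixed:
  assumes a: "a \<in> base" and r: "strict_mono (r :: nat \<Rightarrow> nat)" and lim: "(\<lambda>n. nrm (w (int (r n)))) \<longlonglongrightarrow> a"
  obtains E where "\<And>k. HB E a (T k a)"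
proof -
  obtain p where p: "\<And>j::nat. p j \<in> base" "\<And>j. HB (exp (2 * morse_radius)) (p j) (w (int j))" "p \<longlonglongrightarrow> a"
    using ray_to_limit[OF assms] by blast
  have pK: "p j \<in> K" for j using p(1) by (simp add: base_def)
  define E where "E = exp (2 * morse_radius) * exp (2 * morse_radius)"
  have *: "HB E (T (int k) a) a" for k
  proof (rule HB_tendsto)
    show "(\<lambda>j. T (int k) (p j)) \<longlonglongrightarrow> T (int k) a" by (rule tendsto_T[OF p(3)])
    show "(\<lambda>j. p (j + k)) \<longlonglongrightarrow> a" by (rule LIMSEQ_ignore_initial_segment[OF p(3)])
    show "HB E (T (int k) (p j)) (p (j + k))" for j unfolding E_def
    proof (rule HB_trans)
      show "HB (exp (2 * morse_radius)) (T (int k) (p j)) (w (int (j + k)))"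
        using HB_T[OF p(2)[of j], of "int k"] T_add[of "int k" "int j" x0] by (simp add: add.commute)
      show "HB (exp (2 * morse_radius)) (w (int (j + k))) (p (j + k))" by (rule HB_sym[OF p(2)])
    qed (auto intro: T_K pK w_Cn)
  qed
  have "HB E a (T k a)" for k
  proof (cases "0 \<le> k")
    case True then show ?thesis using HB_sym[OF *[of "nat k"]] by simp
  next
    case False
    then have "HB E (T (- k) a) a" using *[of "nat (- k)"] by simp
    from HB_T[OF this, of k] show ?thesis by (simp add: T_inv)
  qed
  then show thesis using that by blast
qed

text \<open>The bounds against the points \<open>T k a\<close> are linear conditions on
  \<open>v\<close>, so \<open>S\<close> is convex as well as compact; asking for all
  \<open>k\<close> makes it invariant. The ray fixed by Brouwer's theorem is an eigenvector, and
  \<open>HB E v a\<close> keeps it on the face of \<open>a\<close>.\<close>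

lemma quasi_fixed_imp_eigenvector:
  assumes a: "a \<in> base" and E: "\<And>k. HB E a (T k a)"
  obtains v l where "v \<in> base" "HB E v a" "0 < l" "T 1 v = l *\<^sub>R v"
proof -
  define S where "S = {v \<in> base. \<forall>k. HB E v (T k a)}"
  have S_eq: "S = base \<inter> (\<Inter>k. \<Inter>f\<in>dual. \<Inter>g\<in>dual. {v. (f \<bullet> v) * (g \<bullet> T k a) \<le> E * ((f \<bullet> T k a) * (g \<bullet> v))})"
    by (auto simp: S_def HB_def)
  have "closed (\<Inter>k. \<Inter>f\<in>dual. \<Inter>g\<in>dual. {v. (f \<bullet> v) * (g \<bullet> T k a) \<le> E * ((f \<bullet> T k a) * (g \<bullet> v))})"
    by (intro closed_INT ballI closed_Collect_le continuous_intros)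
  then have 1: "compact S" unfolding S_eq by (intro compact_Int_closed compact_base)
  have lin: "convex {v. (f \<bullet> v) * (g \<bullet> T k a) \<le> E * ((f \<bullet> T k a) * (g \<bullet> v))}" for f g k
  proof -
    have "{v. (f \<bullet> v) * (g \<bullet> T k a) \<le> E * ((f \<bullet> T k a) * (g \<bullet> v))}
      = {v. ((g \<bullet> T k a) *\<^sub>R f - (E * (f \<bullet> T k a)) *\<^sub>R g) \<bullet> v \<le> 0}"
      by (auto simp: inner_diff_left mult_ac)
    then show ?thesis by (simp add: convex_halfspace_le)
  qed
  have "base = K \<inter> {x. u \<bullet> x = 1}" by (auto simp: base_def)
  then have "convex base" by (simp add: convex_K convex_Int convex_hyperplane)
  then have 2: "convex S" unfolding S_eq by (intro convex_Int convex_INT lin)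
  have 3: "S \<noteq> {}" using a E by (auto simp: S_def)
  have nz: "T 1 v \<noteq> 0" "T 1 v \<in> K" "v \<in> K" "v \<noteq> 0" if "v \<in> S" for v
    using that T_nz base_nz T_K by (auto simp: S_def base_def)
  have 4: "continuous_on S (\<lambda>v. nrm (T 1 v))"
  proof -
    have "u \<bullet> T 1 v \<noteq> 0" if "v \<in> S" for v using u_pos[OF nz(2,1)[OF that]] by simp
    then show ?thesis unfolding nrm_def by (intro continuous_intros cont_T) auto
  qed
  have 5: "(\<lambda>v. nrm (T 1 v)) \<in> S \<rightarrow> S"
  proof
    fix v assume v: "v \<in> S"
    have "HB E (nrm (T 1 v)) (T k a)" for k
    proof -
      have "HB E v (T (k - 1) a)" using v by (simp add: S_def)
      from HB_T[OF this, of 1] have "HB E (T 1 v) (T k a)" using T_add[of 1 "k - 1" a] by simp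
      then show ?thesis using HB_scale_left[of "inverse (u \<bullet> T 1 v)"] u_pos[OF nz(2,1)[OF v]] by (simp add: nrm_def)
    qed
    then show "nrm (T 1 v) \<in> S" using nrm_base[OF nz(2,1)[OF v]] by (simp add: S_def)
  qed
  obtain v where v: "v \<in> S" "nrm (T 1 v) = v" using brouwer[OF 1 2 3 4 5] by blast
  have up: "0 < u \<bullet> T 1 v" using u_pos[OF nz(2,1)[OF v(1)]] .
  then have "T 1 v = (u \<bullet> T 1 v) *\<^sub>R nrm (T 1 v)" by (simp add: nrm_def)
  then have "T 1 v = (u \<bullet> T 1 v) *\<^sub>R v" unfolding v(2) .
  moreover have "HB E v a" using v(1) T_0 by (metis (mono_tags, lifting) S_def mem_Collect_eq)
  ultimately show thesis using that[of v "u \<bullet> T 1 v"] v(1) up by (simp add: S_def)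
qed

lemma exists_axis:
  obtains a b l m where "a \<in> K" "b \<in> K" "a \<notin> Cn" "b \<notin> Cn" "a + b \<in> Cn"
    "0 < l" "0 < m" "T 1 a = l *\<^sub>R a" "T 1 b = m *\<^sub>R b"
proof -
  interpret R: contracting_flow Cn u "\<lambda>k. T (- k)" x0 "\<lambda>x. - J x" c \<kappa> by (rule rev_contracting)
  obtain a r where a: "a \<in> base" "a \<notin> Cn" "strict_mono (r :: nat \<Rightarrow> nat)" "(\<lambda>n. nrm (w (int (r n)))) \<longlonglongrightarrow> a"
    by (rule forward_limit)
  obtain b r' where b: "b \<in> base" "b \<notin> Cn" "strict_mono (r' :: nat \<Rightarrow> nat)" "(\<lambda>n. nrm (w (- int (r' n)))) \<longlonglongrightarrow> b"
    by (rule R.forward_limit)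
  have aK: "a \<in> K" "a \<noteq> 0" and bK: "b \<in> K" "b \<noteq> 0" using a b base_nz by (auto simp: base_def)
  \<comment> \<open>Segments between orbit points far away in opposite directions pass near
    \<open>w 0\<close>; in the limit the segment from \<open>b\<close> to \<open>a\<close> contains
    an interior point.\<close>
  have "\<exists>\<tau>\<in>{0..1}. HB (exp (2 * morse_radius)) ((1 - \<tau>) *\<^sub>R b + \<tau> *\<^sub>R a) (w 0)"
    using morse_base[of _ 0] by (intro HB_segment_limit[OF b(4) a(4)] always_eventually allI) simp
  then obtain \<tau> where \<tau>: "\<tau> \<in> {0..1}" "HB (exp (2 * morse_radius)) ((1 - \<tau>) *\<^sub>R b + \<tau> *\<^sub>R a) (w 0)" by blast
  have qb: "(1 - \<tau>) *\<^sub>R b + \<tau> *\<^sub>R a \<in> base" by (intro base_convex a b \<tau>)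
  have q: "(1 - \<tau>) *\<^sub>R b + \<tau> *\<^sub>R a \<in> Cn"
    using HB_Cn[OF \<tau>(2) _ w_Cn base_nz[OF qb]] qb by (simp add: base_def)
  have "\<tau> \<noteq> 0" "\<tau> \<noteq> 1" using q a(2) b(2) by auto
  then have "b + a \<in> Cn" using Cn_of_sum[OF bK(1) aK(1) _ _ q] \<tau>(1) by simp
  then have ab: "a + b \<in> Cn" by (simp add: add.commute)
  obtain E where "\<And>k. HB E a (T k a)" using limit_quasi_fixed[OF a(1,3,4)] by blast
  then obtain a' l where a': "a' \<in> base" "HB E a' a" "0 < l" "T 1 a' = l *\<^sub>R a'"
    using quasi_fixed_imp_eigenvector[OF a(1)] by blast
  obtain F where "\<And>k. HB F b (T (- k) b)" using R.limit_quasi_fixed[OF b(1,3)] b(4) by auto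
  then have "HB F b (T k b)" for k by (metis minus_minus)
  then obtain b' m where b': "b' \<in> base" "HB F b' b" "0 < m" "T 1 b' = m *\<^sub>R b'"
    using quasi_fixed_imp_eigenvector[OF b(1)] by blast
  have a'K: "a' \<in> K" "a' \<noteq> 0" and b'K: "b' \<in> K" "b' \<noteq> 0" using a' b' base_nz by (auto simp: base_def)
  have "a' \<notin> Cn" using HB_Cn[OF HB_sym[OF a'(2)] aK(1) _ aK(2)] a(2) by blast
  moreover have "b' \<notin> Cn" using HB_Cn[OF HB_sym[OF b'(2)] bK(1) _ bK(2)] b(2) by blast
  \<comment> \<open>The eigenvectors lie on the faces of the limit points, so a dual functional that
    vanishes on both vanishes on \<open>a + b\<close>.\<close>
  moreover have "f = 0" if f: "f \<in> dual" "f \<bullet> (a' + b') = 0" for f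
  proof -
    have "f \<bullet> a' = 0" "f \<bullet> b' = 0"
      using f dual_K[OF f(1) a'K(1)] dual_K[OF f(1) b'K(1)] by (auto simp: inner_add_right add_nonneg_eq_0_iff)
    then have "f \<bullet> a = 0" "f \<bullet> b = 0"
      using HB_face[OF HB_sym[OF a'(2)] aK(1) a'K f(1)] HB_face[OF HB_sym[OF b'(2)] bK(1) b'K f(1)] by auto
    then show ?thesis using dual_pos[OF f(1) _ ab] by (force simp: inner_add_right)
  qed
  then have "a' + b' \<in> Cn" using Cn_iff[OF K_add[OF a'K(1) b'K(1)]] by blast
  ultimately show thesis using that a' b' a'K b'K by blast
qed

end

subsection \<open>No half triangles\<close>

text \<open>The ratio \<open>f2 / f1\<close> does not decrease along the segments that end in \<open>a\<close>, and such a
  segment passes near the orbit point to which its other end projects.\<close>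

lemma (in contracting_flow) functional_ratio_projection:
  assumes a: "a \<in> K" "a \<notin> Cn" "a \<noteq> 0" and lim: "(\<lambda>n. nrm (w (int n))) \<longlonglongrightarrow> nrm a"
    and f1: "f1 \<in> dual" "f1 \<noteq> 0" "f1 \<bullet> a = 0" and f2: "f2 \<in> dual" and x: "x \<in> Cn"
  shows "(f2 \<bullet> x) * (f1 \<bullet> w (J x)) \<le> exp (2 * c) * ((f2 \<bullet> w (J x)) * (f1 \<bullet> x))"
proof -
  have "\<exists>\<tau>\<in>{0..1}. HB (exp (2 * c)) ((1 - \<tau>) *\<^sub>R nrm x + \<tau> *\<^sub>R nrm a) (w (J x))"
  proof (rule HB_segment_limit[OF tendsto_const lim])
    have "\<forall>\<^sub>F n in sequentially. 2 * c + \<bar>of_int (J x)\<bar> \<le> real n"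
      by (simp add: filterlim_real_sequentially[unfolded filterlim_at_top])
    then show "\<forall>\<^sub>F n in sequentially. \<exists>\<tau>\<in>{0..1}. HB (exp (2 * c)) ((1 - \<tau>) *\<^sub>R nrm x + \<tau> *\<^sub>R nrm (w (int n))) (w (J x))"
    proof eventually_elim
      case (elim n)
      have "c \<le> \<bar>of_int (J x - J (w (int n)))\<bar>" using elim J_orbit[of "int n"] by simp
      then obtain s t where st: "0 \<le> s" "0 \<le> t" "0 < s + t" "hd (s *\<^sub>R x + t *\<^sub>R w (int n)) (w (J x)) \<le> c"
        using contr[OF x w_Cn] by blast
      obtain d \<tau> where d: "0 < d" "\<tau> \<in> {0..1}" "s *\<^sub>R x + t *\<^sub>R w (int n) = d *\<^sub>R ((1 - \<tau>) *\<^sub>R nrm x + \<tau> *\<^sub>R nrm (w (int n)))"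
        using segment_normal_form[OF Cn_subset_K[OF x] Cn_nz[OF x] Cn_subset_K[OF w_Cn] Cn_nz[OF w_Cn] st(1-3)] by metis
      have "HB (exp (2 * c)) (s *\<^sub>R x + t *\<^sub>R w (int n)) (w (J x))"
        by (intro hd_HB st(4) w_Cn hd_segment(1) st(1-3) x)
      then show ?case unfolding d(3) HB_scale_left[OF d(1)] using d(2) by blast
    qed
  qed
  then obtain \<tau> where \<tau>: "\<tau> \<in> {0..1}" "HB (exp (2 * c)) ((1 - \<tau>) *\<^sub>R nrm x + \<tau> *\<^sub>R nrm a) (w (J x))" by blast
  let ?q = "(1 - \<tau>) *\<^sub>R nrm x + \<tau> *\<^sub>R nrm a"
  have qb: "?q \<in> base" using \<tau>(1) by (intro base_convex nrm_base a Cn_subset_K[OF x] Cn_nz[OF x])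
  have q: "?q \<in> Cn" using HB_Cn[OF \<tau>(2) _ w_Cn base_nz[OF qb]] qb by (simp add: base_def)
  have ux: "0 < u \<bullet> x" and ua: "0 < u \<bullet> a" using u_pos_Cn[OF x] u_pos[OF a(1,3)] by auto
  have p: "0 < f1 \<bullet> ?q" "0 \<le> f1 \<bullet> x" "0 \<le> f2 \<bullet> a" "0 \<le> f1 \<bullet> w (J x)"
    using dual_pos[OF f1(1,2) q] dual_K[OF f1(1)] dual_K[OF f2] x a w_Cn Cn_subset_K by auto
  \<comment> \<open>From \<open>x\<close> to the point \<open>?q\<close> the functional
    \<open>f1\<close>, which vanishes at \<open>a\<close>, is multiplied by exactly the factor that
    bounds the change of \<open>f2\<close> from below.\<close>
  have q1: "f1 \<bullet> ?q = (1 - \<tau>) / (u \<bullet> x) * (f1 \<bullet> x)"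
    using f1 by (simp add: nrm_def inner_add_right divide_inverse)
  have q2: "(1 - \<tau>) / (u \<bullet> x) * (f2 \<bullet> x) \<le> f2 \<bullet> ?q"
    using p \<tau>(1) ua by (simp add: nrm_def inner_add_right divide_inverse)
  have "(f2 \<bullet> x) * (f1 \<bullet> ?q) = (1 - \<tau>) / (u \<bullet> x) * (f2 \<bullet> x) * (f1 \<bullet> x)" by (simp add: q1)
  also have "\<dots> \<le> (f2 \<bullet> ?q) * (f1 \<bullet> x)" using q2 p by (intro mult_right_mono)
  finally have 1: "(f2 \<bullet> x) * (f1 \<bullet> ?q) \<le> (f2 \<bullet> ?q) * (f1 \<bullet> x)" .
  have "((f2 \<bullet> x) * (f1 \<bullet> w (J x))) * (f1 \<bullet> ?q) = ((f2 \<bullet> x) * (f1 \<bullet> ?q)) * (f1 \<bullet> w (J x))" by simp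
  also have "\<dots> \<le> ((f2 \<bullet> ?q) * (f1 \<bullet> x)) * (f1 \<bullet> w (J x))" using 1 p by (intro mult_right_mono)
  also have "\<dots> = ((f2 \<bullet> ?q) * (f1 \<bullet> w (J x))) * (f1 \<bullet> x)" by simp
  also have "\<dots> \<le> (exp (2 * c) * ((f2 \<bullet> w (J x)) * (f1 \<bullet> ?q))) * (f1 \<bullet> x)"
    using HB_D[OF \<tau>(2) f2 f1(1)] p by (intro mult_right_mono)
  also have "\<dots> = (exp (2 * c) * ((f2 \<bullet> w (J x)) * (f1 \<bullet> x))) * (f1 \<bullet> ?q)" by simp
  finally show ?thesis using p(1) by (simp only: mult_le_cancel_right_pos)
qed

lemma (in contracting_flow) no_half_triangle_at_axis:
  assumes ab: "a \<in> K" "b \<in> K" "a \<notin> Cn" "b \<notin> Cn" "a + b \<in> Cn"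
    and T: "T 1 a = l *\<^sub>R a" "T 1 b = m *\<^sub>R b" "0 < m" "m < l"
    and z: "z \<in> K" "z \<noteq> 0"
  shows "a + z \<in> Cn \<or> z + b \<in> Cn"
proof (rule ccontr)
  assume n: "\<not> ?thesis"
  \<comment> \<open>With base point \<open>a + b\<close> the orbit lies on the axis, where
    \<open>f1\<close> and \<open>f2\<close> take explicit values.\<close>
  obtain c' where "contracting_flow Cn u T (a + b) J c' \<kappa>" using change_basepoint[OF ab(5)] by blast
  then interpret A: contracting_flow Cn u T "a + b" J c' \<kappa> .
  interpret R: contracting_flow Cn u "\<lambda>k. T (- k)" "a + b" "\<lambda>x. - J x" c' \<kappa> by (rule A.rev_contracting)
  obtain f1 where f1: "f1 \<in> dual" "f1 \<noteq> 0" "f1 \<bullet> (a + z) = 0" using support_K[OF K_add[OF ab(1) z(1)]] n by blast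
  obtain f2 where f2: "f2 \<in> dual" "f2 \<noteq> 0" "f2 \<bullet> (z + b) = 0" using support_K[OF K_add[OF z(1) ab(2)]] n by blast
  have f10: "f1 \<bullet> a = 0" "f1 \<bullet> z = 0"
    using f1 dual_K[OF f1(1) ab(1)] dual_K[OF f1(1) z(1)] by (auto simp: inner_add_right add_nonneg_eq_0_iff)
  have f20: "f2 \<bullet> b = 0" "f2 \<bullet> z = 0"
    using f2 dual_K[OF f2(1) ab(2)] dual_K[OF f2(1) z(1)] by (auto simp: inner_add_right add_nonneg_eq_0_iff)
  have fp: "0 < f1 \<bullet> b" "0 < f2 \<bullet> a"
    using dual_pos[OF f1(1,2) ab(5)] dual_pos[OF f2(1,2) ab(5)] f10 f20 by (auto simp: inner_add_right)
  have nz: "a \<noteq> 0" "b \<noteq> 0" using fp by auto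
  have l: "0 < l" using T by simp
  have Tk: "T k (a + b) = (l powi k) *\<^sub>R a + (m powi k) *\<^sub>R b" for k
    using T_eigen[OF T(1) l] T_eigen[OF T(2,3)] by (simp add: T_lin)
  define L where "L = l / m"
  have L: "1 < L" "0 < L" using T l by (auto simp: L_def)
  have Lk: "L powi k = l powi k / m powi k" for k by (simp add: L_def power_int_divide_distrib)
  have mk: "0 < m powi k" "0 < l powi k" for k using T l by auto
  have nrm_scale: "nrm (s *\<^sub>R x) = nrm x" if "0 < s" for s x using that by (simp add: nrm_def)
  have lim0: "(\<lambda>n. inverse L ^ n) \<longlonglongrightarrow> 0" using L by (intro LIMSEQ_realpow_zero) (auto simp: field_simps)
  have limA: "(\<lambda>n. nrm (T (int n) (a + b))) \<longlonglongrightarrow> nrm a"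
  proof -
    have "T (int n) (a + b) = l ^ n *\<^sub>R (a + inverse L ^ n *\<^sub>R b)" for n
      using l by (simp add: Tk L_def scaleR_add_right power_divide)
    then have "nrm (T (int n) (a + b)) = nrm (a + inverse L ^ n *\<^sub>R b)" for n using l by (simp add: nrm_scale)
    moreover have "(\<lambda>n. a + inverse L ^ n *\<^sub>R b) \<longlonglongrightarrow> a + 0 *\<^sub>R b" by (intro tendsto_intros lim0)
    ultimately show ?thesis using tendsto_nrm[OF _ ab(1) nz(1)] by simp
  qed
  have limB: "(\<lambda>n. nrm (T (- int n) (a + b))) \<longlonglongrightarrow> nrm b"
  proof -
    have "T (- int n) (a + b) = inverse (m ^ n) *\<^sub>R (b + inverse L ^ n *\<^sub>R a)" for n
    proof -
      have "inverse (l ^ n) = inverse (m ^ n) * inverse L ^ n" using T l by (simp add: L_def power_divide inverse_eq_divide)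
      then show ?thesis by (simp add: Tk scaleR_add_right power_int_minus)
    qed
    then have "nrm (T (- int n) (a + b)) = nrm (b + inverse L ^ n *\<^sub>R a)" for n using T by (simp add: nrm_scale)
    moreover have "(\<lambda>n. b + inverse L ^ n *\<^sub>R a) \<longlonglongrightarrow> b + 0 *\<^sub>R a" by (intro tendsto_intros lim0)
    ultimately show ?thesis using tendsto_nrm[OF _ ab(2) nz(2)] by simp
  qed
  \<comment> \<open>Along the orbit \<open>ln (f2 / f1)\<close> grows by \<open>ln L\<close> per
    step, so an error of \<open>2 c'\<close> in the logarithm moves the index by at most
    \<open>D\<close>.\<close>
  define D where "D = 2 * c' / ln L"
  have lnL: "0 < ln L" using L by simp
  have D: "0 \<le> D" "D * ln L = 2 * c'" using lnL A.c_nonneg by (auto simp: D_def)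
  \<comment> \<open>Both functionals vanish at \<open>z\<close>, so their ratio at this point does
    not depend on \<open>e\<close>, and the point may approach \<open>z\<close> freely. The forward
    and the backward flow bound its index from the two sides.\<close>
  have Jx: "\<bar>of_int (J (z + e *\<^sub>R T i (a + b)) - i)\<bar> \<le> D" if e: "0 < e" for e i
  proof -
    let ?x = "z + e *\<^sub>R T i (a + b)"
    have x: "?x \<in> Cn" using Cn_K_add[OF Cn_scale[OF T_Cn[OF ab(5)] e] z(1)] by (simp add: add.commute)
    have fx: "f1 \<bullet> ?x = e * (m powi i) * (f1 \<bullet> b)" "f2 \<bullet> ?x = e * (l powi i) * (f2 \<bullet> a)"
      using f10 f20 by (auto simp: Tk inner_add_right)
    let ?j = "J ?x"
    have fw: "f1 \<bullet> T ?j (a + b) = (m powi ?j) * (f1 \<bullet> b)" "f2 \<bullet> T ?j (a + b) = (l powi ?j) * (f2 \<bullet> a)"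
      using f10 f20 by (auto simp: Tk inner_add_right)
    have A: "(f2 \<bullet> ?x) * (f1 \<bullet> T ?j (a + b)) \<le> exp (2 * c') * ((f2 \<bullet> T ?j (a + b)) * (f1 \<bullet> ?x))"
      by (rule A.functional_ratio_projection[OF ab(1,3) nz(1) limA f1(1,2) f10(1) f2(1) x])
    have B: "(f1 \<bullet> ?x) * (f2 \<bullet> T ?j (a + b)) \<le> exp (2 * c') * ((f1 \<bullet> T ?j (a + b)) * (f2 \<bullet> ?x))"
      using R.functional_ratio_projection[OF ab(2,4) nz(2) limB f2(1,2) f20(1) f1(1) x] by simp
    have pe: "0 < e * (f1 \<bullet> b) * (f2 \<bullet> a)" using e fp by simp
    have "(e * (f1 \<bullet> b) * (f2 \<bullet> a)) * (l powi i * m powi ?j) \<le> (e * (f1 \<bullet> b) * (f2 \<bullet> a)) * (exp (2 * c') * (l powi ?j * m powi i))"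
      using A unfolding fx fw by (simp add: mult_ac)
    then have "l powi i * m powi ?j \<le> exp (2 * c') * (l powi ?j * m powi i)" using pe by (simp only: mult_le_cancel_left_pos)
    then have "L powi i \<le> exp (2 * c') * L powi ?j" unfolding Lk using mk by (simp add: field_simps)
    then have "exp (of_int i * ln L) \<le> exp (2 * c' + of_int ?j * ln L)" unfolding powi_exp[OF L(2)] exp_add .
    then have 1: "(of_int i - of_int ?j) * ln L \<le> D * ln L" unfolding D by (simp add: algebra_simps)
    have "(e * (f1 \<bullet> b) * (f2 \<bullet> a)) * (l powi ?j * m powi i) \<le> (e * (f1 \<bullet> b) * (f2 \<bullet> a)) * (exp (2 * c') * (l powi i * m powi ?j))"
      using B unfolding fx fw by (simp add: mult_ac)
    then have "l powi ?j * m powi i \<le> exp (2 * c') * (l powi i * m powi ?j)" using pe by (simp only: mult_le_cancel_left_pos)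
    then have "L powi ?j \<le> exp (2 * c') * L powi i" unfolding Lk using mk by (simp add: field_simps)
    then have "exp (of_int ?j * ln L) \<le> exp (2 * c' + of_int i * ln L)" unfolding powi_exp[OF L(2)] exp_add .
    then have 2: "(of_int ?j - of_int i) * ln L \<le> D * ln L" unfolding D by (simp add: algebra_simps)
    show ?thesis using 1 2 lnL by (simp add: mult_le_cancel_right)
  qed
  \<comment> \<open>\<open>X n\<close> and \<open>Y n\<close> both tend to \<open>z\<close>, but they project near the distant indices \<open>i\<close> and \<open>- i\<close>.\<close>
  define i where "i = \<lceil>c' + D\<rceil>"
  have i: "c' + D \<le> of_int i" by (simp add: i_def)
  \<comment> \<open>\<open>c'\<close> bounds the distance of the segment from the orbit point with
    index \<open>J (X n)\<close>, and \<open>D * A.\<delta>\<close> the distance from there to index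
    \<open>i\<close>.\<close>
  define F where "F = exp (2 * (c' + D * A.\<delta>))"
  define X where "X n = z + inverse (real (Suc n)) *\<^sub>R T i (a + b)" for n
  define Y where "Y n = z + inverse (real (Suc n)) *\<^sub>R T (- i) (a + b)" for n
  have limit: "(\<lambda>n. nrm (z + inverse (real (Suc n)) *\<^sub>R v)) \<longlonglongrightarrow> nrm z" for v
  proof -
    have "(\<lambda>n. z + inverse (real (Suc n)) *\<^sub>R v) \<longlonglongrightarrow> z + 0 *\<^sub>R v"
      by (intro tendsto_intros LIMSEQ_inverse_real_of_nat)
    then show ?thesis using tendsto_nrm[OF _ z] by simp
  qed
  have XY: "X n \<in> Cn" "Y n \<in> Cn" for n
    using Cn_K_add[OF Cn_scale[OF T_Cn[OF ab(5)]] z(1), of "inverse (real (Suc n))" i]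
      Cn_K_add[OF Cn_scale[OF T_Cn[OF ab(5)]] z(1), of "inverse (real (Suc n))" "- i"]
    by (simp_all add: X_def Y_def add.commute)
  have "\<exists>\<tau>\<in>{0..1}. HB F ((1 - \<tau>) *\<^sub>R nrm (X n) + \<tau> *\<^sub>R nrm (Y n)) (T i (a + b))" for n
  proof -
    have JX: "\<bar>of_int (J (X n) - i)\<bar> \<le> D" and JY: "\<bar>of_int (J (Y n) - (- i))\<bar> \<le> D"
      unfolding X_def Y_def by (intro Jx; simp)+
    have "c' \<le> \<bar>of_int (J (X n) - J (Y n))\<bar>" using JX JY i A.c_nonneg D(1) by simp
    then obtain s t where st: "0 \<le> s" "0 \<le> t" "0 < s + t" "hd (s *\<^sub>R X n + t *\<^sub>R Y n) (T (J (X n)) (a + b)) \<le> c'"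
      using A.contr[OF XY] by blast
    note sC = hd_segment(1)[OF XY st(1-3)]
    have "hd (s *\<^sub>R X n + t *\<^sub>R Y n) (T i (a + b))
       \<le> hd (s *\<^sub>R X n + t *\<^sub>R Y n) (T (J (X n)) (a + b)) + hd (T (J (X n)) (a + b)) (T i (a + b))"
      by (intro hd_triangle sC A.w_Cn)
    also have "\<dots> \<le> c' + D * A.\<delta>" using st(4) A.hd_w_le[OF JX] by simp
    finally have H: "HB F (s *\<^sub>R X n + t *\<^sub>R Y n) (T i (a + b))" unfolding F_def by (intro hd_HB sC A.w_Cn)
    obtain d \<tau> where d: "0 < d" "\<tau> \<in> {0..1}" "s *\<^sub>R X n + t *\<^sub>R Y n = d *\<^sub>R ((1 - \<tau>) *\<^sub>R nrm (X n) + \<tau> *\<^sub>R nrm (Y n))"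
      using segment_normal_form[OF Cn_subset_K[OF XY(1)] Cn_nz[OF XY(1)] Cn_subset_K[OF XY(2)] Cn_nz[OF XY(2)] st(1-3)] by metis
    show ?thesis using H unfolding d(3) HB_scale_left[OF d(1)] using d(2) by blast
  qed
  then have ev: "\<forall>\<^sub>F n in sequentially. \<exists>\<tau>\<in>{0..1}. HB F ((1 - \<tau>) *\<^sub>R nrm (X n) + \<tau> *\<^sub>R nrm (Y n)) (T i (a + b))"
    by (intro always_eventually allI)
  have "(\<lambda>n. nrm (X n)) \<longlonglongrightarrow> nrm z" "(\<lambda>n. nrm (Y n)) \<longlonglongrightarrow> nrm z"
    unfolding X_def Y_def by (rule limit)+
  \<comment> \<open>Both ends tend to \<open>z\<close>, so the limit segment is the single point
    \<open>nrm z\<close>, with a finite cross ratio bound to an interior point.\<close>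
  from HB_segment_limit[OF this ev]
  have "\<exists>\<tau>\<in>{0..1}. HB F ((1 - \<tau>) *\<^sub>R nrm z + \<tau> *\<^sub>R nrm z) (T i (a + b))" .
  then have "HB F (nrm z) (T i (a + b))" by (auto simp: scaleR_add_left[symmetric])
  then have "HB F z (T i (a + b))"
    using HB_scale_left[of "inverse (u \<bullet> z)"] u_pos[OF z] by (simp add: nrm_def)
  then have "z \<in> Cn" using HB_Cn[OF _ z(1) A.w_Cn z(2)] by blast
  then show False using Cn_K_add[OF _ ab(1), of z] n by (simp add: add.commute)
qed

section \<open>Properly convex domains as cones\<close>

lemma proj_of_scale: assumes "c \<noteq> 0" "v \<noteq> 0" shows "proj_of (c *\<^sub>R v) = proj_of v"
proof -
  have "span {c *\<^sub>R v} = span {v}"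
  proof (intro subset_antisym span_minimal subspace_span)
    show "{c *\<^sub>R v} \<subseteq> span {v}" by (simp add: span_base span_scale)
    have "inverse c *\<^sub>R (c *\<^sub>R v) \<in> span {c *\<^sub>R v}" by (intro span_scale span_base) simp
    then show "{v} \<subseteq> span {c *\<^sub>R v}" using assms by simp
  qed
  then show ?thesis by (simp add: proj_of_def)
qed

lemma proj_of_eqD: assumes "proj_of v = proj_of w" "v \<noteq> 0" "w \<noteq> 0" obtains c where "c \<noteq> 0" "v = c *\<^sub>R w"
proof -
  have "v \<in> span {w}" using assms Rep_proj_of by (metis insertI1 span_base)
  then obtain c where "v = c *\<^sub>R w" by (auto simp: span_singleton)
  then show thesis using that assms by auto
qed

lemma proj_of_cases: obtains v where "v \<noteq> 0" "x = proj_of v"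
proof -
  have s: "subspace (Rep_proj x)" "dim (Rep_proj x) = 1" using Rep_proj[of x] by auto
  have "Rep_proj x \<noteq> {0}"
  proof
    assume "Rep_proj x = {0}"
    then have "dim (Rep_proj x) = 0" by simp
    then show False using s(2) by simp
  qed
  moreover have "0 \<in> Rep_proj x" using s(1) by (rule subspace_0)
  ultimately obtain v where v: "v \<in> Rep_proj x" "v \<noteq> 0" by blast
  have "span {v} \<subseteq> Rep_proj x" using v(1) s(1) by (intro span_minimal) auto
  moreover have "dim (span {v}) = dim (Rep_proj x)" using v s(2) by (simp add: dim_insert)
  ultimately have "span {v} = Rep_proj x" using s(1) by (intro subspace_dim_equal) auto
  then have "proj_of v = x" by (simp add: proj_of_def Rep_proj_inverse)
  then show thesis using that v by blast
qed

lemma proj_of_in_subspace: assumes "subspace V" "v \<noteq> 0" shows "proj_of v \<in> proj_subspace V \<longleftrightarrow> v \<in> V"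
proof -
  have "span {v} \<subseteq> V \<longleftrightarrow> v \<in> V" using assms span_minimal[of "{v}" V] span_base[of v "{v}"] by blast
  then show ?thesis using assms by (simp add: proj_subspace_def Rep_proj_of)
qed

lemma subspace_kernel: "subspace {w. u \<bullet> w = (0::real)}"
  by (auto simp: subspace_def inner_add_right)

lemma proj_of_in_chart: "v \<noteq> 0 \<Longrightarrow> proj_of v \<in> affine_chart u \<longleftrightarrow> u \<bullet> v \<noteq> 0"
  by (simp add: affine_chart_def proj_of_in_subspace[OF subspace_kernel])

lemma chart_coord_proj_of: assumes "u \<bullet> v \<noteq> 0" shows "chart_coord u (proj_of v) = inverse (u \<bullet> v) *\<^sub>R v"
proof -
  have v: "v \<noteq> 0" using assms by auto
  show ?thesis unfolding chart_coord_def Rep_proj_of[OF v]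
  proof (rule the_equality)
    show "inverse (u \<bullet> v) *\<^sub>R v \<in> span {v} \<and> u \<bullet> (inverse (u \<bullet> v) *\<^sub>R v) = 1"
      using assms by (simp add: span_scale span_base)
  next
    fix w assume "w \<in> span {v} \<and> u \<bullet> w = 1"
    then have uw: "u \<bullet> w = 1" and "w \<in> range (\<lambda>k. k *\<^sub>R v)" by (simp_all add: span_singleton)
    then obtain c where c: "w = c *\<^sub>R v" by blast
    then have "c * (u \<bullet> v) = 1" using uw by simp
    then have "c = inverse (u \<bullet> v)" using assms by (simp add: field_simps)
    then show "w = inverse (u \<bullet> v) *\<^sub>R v" using c by simp
  qed
qed

text \<open>In an adapted chart \<open>u\<close> does not vanish over the domain, so the vectors
  over it split into two opposite cones; the sign of \<open>u\<close> selects one.\<close>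

definition cone_over :: "'n::finite proj set \<Rightarrow> real ^ 'n \<Rightarrow> (real ^ 'n) set" where
  "cone_over \<Omega> u = {v. 0 < u \<bullet> v \<and> proj_of v \<in> \<Omega>}"

text \<open>\<open>coord_eq\<close> makes \<open>u\<close> the functional of the chart that
  \<open>coord\<close> has chosen, so segments and cross ratios are computed in the slice where
  \<open>u\<close> is 1.\<close>

locale charted_domain =
  fixes \<Omega> :: "'n::finite proj set" and u :: "real ^ 'n"
  assumes nonempty: "\<Omega> \<noteq> {}" and open_\<Omega>: "open \<Omega>" and chart: "adapted_chart \<Omega> u"
    and coord_eq: "coord \<Omega> = chart_coord u"
begin

abbreviation Cn :: "(real ^ 'n) set" where "Cn \<equiv> cone_over \<Omega> u"

lemma closure_chart: "closure \<Omega> \<subseteq> affine_chart u" using chart by (simp add: adapted_chart_def)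

lemma in_\<Omega>_iff: assumes "0 < u \<bullet> v" shows "proj_of v \<in> \<Omega> \<longleftrightarrow> v \<in> Cn"
  using assms by (simp add: cone_over_def)

lemma proj_of_uminus: "v \<noteq> 0 \<Longrightarrow> proj_of (- v) = proj_of v"
  using proj_of_scale[of "- 1" v] by simp

lemma in_\<Omega>_cases: assumes "proj_of v \<in> \<Omega>" "v \<noteq> 0" shows "v \<in> Cn \<or> - v \<in> Cn"
proof -
  have "u \<bullet> v \<noteq> 0" using assms closure_chart closure_subset proj_of_in_chart by blast
  then have "0 < u \<bullet> v \<or> 0 < u \<bullet> (- v)" by auto
  then show ?thesis using assms proj_of_uminus[OF assms(2)] by (auto simp: cone_over_def)
qed

lemma coord_image: assumes "u \<bullet> w = 1" shows "w \<in> chart_coord u ` \<Omega> \<longleftrightarrow> w \<in> Cn"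
proof
  assume "w \<in> chart_coord u ` \<Omega>"
  then obtain x where x: "x \<in> \<Omega>" "w = chart_coord u x" by blast
  obtain v where v: "v \<noteq> 0" "x = proj_of v" by (rule proj_of_cases)
  have uv: "u \<bullet> v \<noteq> 0" using x v closure_chart closure_subset proj_of_in_chart by blast
  have "w = inverse (u \<bullet> v) *\<^sub>R v" using x v chart_coord_proj_of[OF uv] by simp
  then have "proj_of w = x" using v uv by (simp add: proj_of_scale)
  then show "w \<in> Cn" using x assms by (simp add: cone_over_def)
next
  assume "w \<in> Cn"
  then have "proj_of w \<in> \<Omega>" by (simp add: cone_over_def)
  moreover have "chart_coord u (proj_of w) = w" using assms by (simp add: chart_coord_proj_of)
  ultimately show "w \<in> chart_coord u ` \<Omega>" by force
qed

lemma Cn_scaleR: assumes "x \<in> Cn" "0 < s" shows "s *\<^sub>R x \<in> Cn"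
proof -
  have "x \<noteq> 0" using assms by (auto simp: cone_over_def)
  then show ?thesis using assms by (simp add: cone_over_def proj_of_scale)
qed

sublocale convex_open_cone Cn u
proof
  have "open {v. v \<noteq> 0 \<and> proj_of v \<in> \<Omega>}" using open_\<Omega> by (simp add: open_proj_def)
  moreover have "open {v. 0 < u \<bullet> v}" by (intro open_Collect_less continuous_intros)
  moreover have "Cn = {v. v \<noteq> 0 \<and> proj_of v \<in> \<Omega>} \<inter> {v. 0 < u \<bullet> v}" by (auto simp: cone_over_def)
  ultimately show "open Cn" by (simp add: open_Int)
  obtain x where x: "x \<in> \<Omega>" using nonempty by blast
  obtain v where "v \<noteq> 0" "x = proj_of v" by (rule proj_of_cases)
  then show "Cn \<noteq> {}" using in_\<Omega>_cases[of v] x by blast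
  show "0 \<notin> Cn" by (simp add: cone_over_def)
  show "s *\<^sub>R x \<in> Cn" if "x \<in> Cn" "0 < s" for x s using that by (rule Cn_scaleR)
  show "x + y \<in> Cn" if xy: "x \<in> Cn" "y \<in> Cn" for x y
  proof -
    define p q where "p = u \<bullet> x" and "q = u \<bullet> y"
    have pq: "0 < p" "0 < q" using xy by (auto simp: cone_over_def p_def q_def)
    have 1: "inverse p *\<^sub>R x \<in> chart_coord u ` \<Omega>" "inverse q *\<^sub>R y \<in> chart_coord u ` \<Omega>"
      using xy pq by (auto simp: coord_image p_def q_def intro!: Cn_scaleR)
    have "convex (chart_coord u ` \<Omega>)" using chart by (simp add: adapted_chart_def)
    \<comment> \<open>In the chart the line of \<open>x + y\<close> is the average of those of
      \<open>x\<close> and \<open>y\<close> with weights proportional to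
      \<open>u \<bullet> x\<close> and \<open>u \<bullet> y\<close>.\<close>
    then have "(p / (p + q)) *\<^sub>R (inverse p *\<^sub>R x) + (q / (p + q)) *\<^sub>R (inverse q *\<^sub>R y) \<in> chart_coord u ` \<Omega>"
      using 1 pq by (intro convexD) (auto simp: add_divide_distrib[symmetric])
    moreover have "(p / (p + q)) *\<^sub>R (inverse p *\<^sub>R x) + (q / (p + q)) *\<^sub>R (inverse q *\<^sub>R y) = inverse (p + q) *\<^sub>R (x + y)"
      using pq by (simp add: scaleR_add_right inverse_eq_divide)
    moreover have "u \<bullet> (inverse (p + q) *\<^sub>R (x + y)) = 1" using pq by (simp add: p_def q_def inner_add_right)
    ultimately have "inverse (p + q) *\<^sub>R (x + y) \<in> Cn" using coord_image by metis
    then have "(p + q) *\<^sub>R (inverse (p + q) *\<^sub>R (x + y)) \<in> Cn" by (rule Cn_scaleR) (use pq in simp)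
    moreover have "(p + q) * inverse (p + q) = 1" using pq by (intro right_inverse) simp
    ultimately show ?thesis by (simp only: scaleR_scaleR scaleR_one)
  qed
  have "bounded (chart_coord u ` \<Omega>)" using chart by (simp add: adapted_chart_def)
  then obtain M where M: "0 < M" "\<And>w. w \<in> chart_coord u ` \<Omega> \<Longrightarrow> norm w \<le> M"
    unfolding bounded_pos by blast
  have "norm x \<le> M * (u \<bullet> x)" if x: "x \<in> Cn" for x
  proof -
    have p: "0 < u \<bullet> x" using x by (simp add: cone_over_def)
    then have "norm (inverse (u \<bullet> x) *\<^sub>R x) \<le> M" using x by (intro M) (auto simp: coord_image intro!: Cn_scaleR)
    then show ?thesis using p by (simp add: field_simps)
  qed
  then show "\<exists>M>0. \<forall>x\<in>Cn. norm x \<le> M * (u \<bullet> x)" using M(1) by blast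
qed

lemma in_\<Omega>D: assumes "p \<in> \<Omega>" obtains v where "v \<in> Cn" "p = proj_of v"
proof -
  obtain v where v: "v \<noteq> 0" "p = proj_of v" by (rule proj_of_cases)
  then show thesis using in_\<Omega>_cases[of v] assms that proj_of_uminus[OF v(1)] by metis
qed

lemma proj_in_\<Omega>: "v \<in> Cn \<Longrightarrow> proj_of v \<in> \<Omega>" by (simp add: cone_over_def)

lemma proj_of_eq_pos: assumes "v \<in> K" "w \<in> K" "v \<noteq> 0" "w \<noteq> 0" "proj_of v = proj_of w"
  obtains c where "0 < c" "v = c *\<^sub>R w"
proof -
  obtain c where c: "c \<noteq> 0" "v = c *\<^sub>R w" using proj_of_eqD assms by blast
  have "0 < c * (u \<bullet> w)" using u_pos[OF assms(1,3)] c by simp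
  then have "0 < c" using u_pos[OF assms(2,4)] by (simp add: zero_less_mult_iff)
  then show thesis using that c by blast
qed

lemma proj_K_in_\<Omega>: "v \<in> K \<Longrightarrow> v \<noteq> 0 \<Longrightarrow> proj_of v \<in> \<Omega> \<longleftrightarrow> v \<in> Cn"
  using in_\<Omega>_iff u_pos by blast

text \<open>The nonzero vectors over the right-hand side are those of \<open>K\<close> and of
  \<open>- K\<close>, so this set is closed. Conversely, an open set of lines around one in
  \<open>K\<close> has an open preimage, which meets \<open>Cn\<close>.\<close>

lemma closure_eq: "closure \<Omega> = proj_of ` (K - {0})"
proof
  let ?P = "proj_of ` (K - {0})"
  have mem: "proj_of v \<in> ?P \<longleftrightarrow> v \<in> K \<or> - v \<in> K" if v: "v \<noteq> 0" for v
  proof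
    assume "proj_of v \<in> ?P"
    then obtain w where w: "w \<in> K" "w \<noteq> 0" "proj_of v = proj_of w" by auto
    obtain c where c: "c \<noteq> 0" "v = c *\<^sub>R w" using proj_of_eqD[OF w(3) v w(2)] by blast
    show "v \<in> K \<or> - v \<in> K"
    proof (cases "0 < c")
      case True then show ?thesis using c K_scale[OF w(1), of c] by simp
    next
      case False then show ?thesis using c K_scale[OF w(1), of "- c"] by simp
    qed
  next
    assume "v \<in> K \<or> - v \<in> K"
    then show "proj_of v \<in> ?P"
    proof
      assume "- v \<in> K"
      then have "proj_of (- v) \<in> ?P" using v by (intro imageI DiffI) auto
      then show ?thesis using proj_of_uminus[OF v] by simp
    next
      assume "v \<in> K"
      then show ?thesis using v by (intro imageI DiffI) auto
    qed
  qed
  have "{v. v \<noteq> 0 \<and> proj_of v \<in> - ?P} = - (K \<union> uminus ` K)"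
  proof -
    have "- v \<in> K \<longleftrightarrow> v \<in> uminus ` K" for v :: "real ^ 'n"
      by (metis (no_types, lifting) image_iff minus_minus)
    note key = this
    show ?thesis
    proof (rule Set.set_eqI)
      fix v :: "real ^ 'n"
      show "v \<in> {v. v \<noteq> 0 \<and> proj_of v \<in> - ?P} \<longleftrightarrow> v \<in> - (K \<union> uminus ` K)"
      proof (cases "v = 0")
        case True then show ?thesis using zero_in_K by simp
      next
        case False
        then show ?thesis unfolding mem_Collect_eq Compl_iff Un_iff using mem[OF False] key[of v] by simp
      qed
    qed
  qed
  moreover have "closed (uminus ` K)" using closed_negations[OF closed_K] by simp
  then have "open (- (K \<union> uminus ` K))" by (intro open_Compl closed_Un closed_K)
  ultimately have "open (- ?P)" by (simp only: open_proj_def)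
  then have "closed ?P" by (simp add: closed_def)
  moreover have "\<Omega> \<subseteq> ?P" using in_\<Omega>D Cn_subset_K Cn_nz by blast
  ultimately show "closure \<Omega> \<subseteq> ?P" by (intro closure_minimal)
  show "?P \<subseteq> closure \<Omega>"
  proof
    fix p assume "p \<in> ?P"
    then obtain v where v: "v \<in> K" "v \<noteq> 0" "p = proj_of v" by blast
    show "p \<in> closure \<Omega>"
    proof (rule ccontr)
      assume p: "p \<notin> closure \<Omega>"
      have "open (- closure \<Omega>)" by (rule open_Compl[OF closed_closure])
      then have "open {w. w \<noteq> 0 \<and> proj_of w \<in> - closure \<Omega>}" unfolding open_proj_def .
      then have "{w. w \<noteq> 0 \<and> proj_of w \<in> - closure \<Omega>} \<inter> Cn \<noteq> {}"
        using v p open_Int_closure_eq_empty[of "{w. w \<noteq> 0 \<and> proj_of w \<in> - closure \<Omega>}" Cn] by (auto simp: K_def)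
      then show False using proj_in_\<Omega> closure_subset by blast
    qed
  qed
qed

section \<open>Boundary points, segments and the Hilbert distance in terms of the cone\<close>

lemma frontier_iff: assumes "v \<in> K" "v \<noteq> 0" shows "proj_of v \<in> frontier \<Omega> \<longleftrightarrow> v \<notin> Cn"
  using assms closure_eq proj_K_in_\<Omega> open_\<Omega> by (auto simp: frontier_def interior_open)

lemma frontierD: assumes "p \<in> frontier \<Omega>" obtains v where "v \<in> K" "v \<noteq> 0" "v \<notin> Cn" "p = proj_of v"
proof -
  have "p \<in> closure \<Omega>" using assms by (simp add: frontier_def)
  then obtain v where "v \<in> K" "v \<noteq> 0" "p = proj_of v" unfolding closure_eq by blast
  then show thesis using that assms frontier_iff by blast
qed

lemma coord_proj_of: "v \<in> K \<Longrightarrow> v \<noteq> 0 \<Longrightarrow> coord \<Omega> (proj_of v) = nrm v"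
  using u_pos[of v] by (simp add: coord_eq chart_coord_proj_of nrm_def)

lemma proj_of_nrm: "v \<in> K \<Longrightarrow> v \<noteq> 0 \<Longrightarrow> proj_of (nrm v) = proj_of v"
  using u_pos[of v] by (simp add: nrm_def proj_of_scale)

lemma proj_segment_iff: assumes x: "x \<in> K" "x \<noteq> 0" and y: "y \<in> K" "y \<noteq> 0"
  shows "p \<in> proj_segment \<Omega> (proj_of x) (proj_of y) \<longleftrightarrow> (\<exists>s\<ge>0. \<exists>t\<ge>0. 0 < s + t \<and> p = proj_of (s *\<^sub>R x + t *\<^sub>R y))"
proof
  note ux = u_pos[OF x] and uy = u_pos[OF y]
  assume "p \<in> proj_segment \<Omega> (proj_of x) (proj_of y)"
  then obtain \<tau> where \<tau>: "0 \<le> \<tau>" "\<tau> \<le> 1" "p = proj_of ((1 - \<tau>) *\<^sub>R nrm x + \<tau> *\<^sub>R nrm y)"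
    unfolding proj_segment_def coord_proj_of[OF x] coord_proj_of[OF y] closed_segment_def by blast
  let ?s = "(1 - \<tau>) * inverse (u \<bullet> x)" and ?t = "\<tau> * inverse (u \<bullet> y)"
  have "p = proj_of (?s *\<^sub>R x + ?t *\<^sub>R y)" using \<tau> by (simp add: nrm_def)
  moreover have st: "0 \<le> ?s" "0 \<le> ?t" using \<tau> ux uy by auto
  moreover have "0 < ?s + ?t"
  proof (cases "\<tau> = 0")
    case False then show ?thesis using \<tau> uy st(1) by (intro add_nonneg_pos) auto
  qed (use ux in auto)
  ultimately show "\<exists>s\<ge>0. \<exists>t\<ge>0. 0 < s + t \<and> p = proj_of (s *\<^sub>R x + t *\<^sub>R y)" by blast
next
  note ux = u_pos[OF x] and uy = u_pos[OF y]
  assume "\<exists>s\<ge>0. \<exists>t\<ge>0. 0 < s + t \<and> p = proj_of (s *\<^sub>R x + t *\<^sub>R y)"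
  then obtain s t where st: "0 \<le> s" "0 \<le> t" "0 < s + t" "p = proj_of (s *\<^sub>R x + t *\<^sub>R y)" by blast
  obtain d \<tau> where d: "0 < d" "\<tau> \<in> {0..1}" "s *\<^sub>R x + t *\<^sub>R y = d *\<^sub>R ((1 - \<tau>) *\<^sub>R nrm x + \<tau> *\<^sub>R nrm y)"
    using segment_normal_form[OF x y st(1-3)] by blast
  have "(1 - \<tau>) *\<^sub>R nrm x + \<tau> *\<^sub>R nrm y \<in> base" by (intro base_convex nrm_base x y d)
  then have "p = proj_of ((1 - \<tau>) *\<^sub>R nrm x + \<tau> *\<^sub>R nrm y)"
    unfolding st(4) d(3) using d(1) base_nz by (simp add: proj_of_scale)
  then show "p \<in> proj_segment \<Omega> (proj_of x) (proj_of y)"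
    unfolding proj_segment_def coord_proj_of[OF x] coord_proj_of[OF y] closed_segment_def using d(2) by auto
qed

text \<open>The chord has the ends \<open>a = x - s (y - x)\<close> and
  \<open>b = y + t (y - x)\<close>, so |b - x| / |b - y| is (1 + t) / t and |y - a| / |x - a| is (1
  + s) / s. Functionals that support the cone at \<open>b\<close> and \<open>a\<close> attain the
  product; nonnegativity of any others at \<open>b\<close> and \<open>a\<close> gives the upper
  bound.\<close>

lemma hd_chord:
  assumes xy: "x \<in> Cn" "y \<in> Cn" and st: "0 < s" "0 < t"
    and a: "x - s *\<^sub>R (y - x) \<in> K" "x - s *\<^sub>R (y - x) \<notin> Cn" and b: "y + t *\<^sub>R (y - x) \<in> K" "y + t *\<^sub>R (y - x) \<notin> Cn"
  shows "hd x y = 1 / 2 * ln (((1 + t) * (1 + s)) / (t * s))"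
proof (rule hd_eqI[OF xy])
  show "0 < ((1 + t) * (1 + s)) / (t * s)" using st by simp
  obtain f where f: "f \<in> dual" "f \<noteq> 0" "f \<bullet> (y + t *\<^sub>R (y - x)) = 0" using support_K[OF b] by blast
  obtain g where g: "g \<in> dual" "g \<noteq> 0" "g \<bullet> (x - s *\<^sub>R (y - x)) = 0" using support_K[OF a] by blast
  have fp: "0 < f \<bullet> y" "0 < g \<bullet> x" using f g xy dual_pos by auto
  fix F
  show "HB F x y \<longleftrightarrow> ((1 + t) * (1 + s)) / (t * s) \<le> F"
  proof
    assume "HB F x y"
    then have H: "(f \<bullet> x) * (g \<bullet> y) \<le> F * ((f \<bullet> y) * (g \<bullet> x))" using f(1) g(1) by (rule HB_D)
    have 1: "t * (f \<bullet> x) = (1 + t) * (f \<bullet> y)" "s * (g \<bullet> y) = (1 + s) * (g \<bullet> x)"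
      using f(3) g(3) by (auto simp: inner_add_right inner_diff_right algebra_simps)
    have "((1 + t) * (1 + s)) * ((f \<bullet> y) * (g \<bullet> x)) = (t * (f \<bullet> x)) * (s * (g \<bullet> y))" unfolding 1 by simp
    also have "\<dots> = (t * s) * ((f \<bullet> x) * (g \<bullet> y))" by simp
    also have "\<dots> \<le> (t * s) * (F * ((f \<bullet> y) * (g \<bullet> x)))" using H st by (intro mult_left_mono) auto
    finally have "((1 + t) * (1 + s)) * ((f \<bullet> y) * (g \<bullet> x)) \<le> (F * (t * s)) * ((f \<bullet> y) * (g \<bullet> x))" by (simp add: mult_ac)
    then have "(1 + t) * (1 + s) \<le> F * (t * s)" using fp by (simp only: mult_le_cancel_right_pos mult_pos_pos)
    then show "((1 + t) * (1 + s)) / (t * s) \<le> F" using st by (simp add: pos_divide_le_eq)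
  next
    assume "((1 + t) * (1 + s)) / (t * s) \<le> F"
    then have F: "(1 + t) * (1 + s) \<le> F * (t * s)" using st by (simp add: pos_divide_le_eq)
    show "HB F x y" unfolding HB_def
    proof (intro ballI)
      fix f g assume fg: "f \<in> dual" "g \<in> dual"
      have n: "0 \<le> f \<bullet> x" "0 \<le> f \<bullet> y" "0 \<le> g \<bullet> x" "0 \<le> g \<bullet> y" using fg xy by (auto simp: dual_def)
      have 1: "t * (f \<bullet> x) \<le> (1 + t) * (f \<bullet> y)" "s * (g \<bullet> y) \<le> (1 + s) * (g \<bullet> x)"
        using dual_K[OF fg(1) b(1)] dual_K[OF fg(2) a(1)] by (auto simp: inner_add_right inner_diff_right algebra_simps)
      have "(t * s) * ((f \<bullet> x) * (g \<bullet> y)) = (t * (f \<bullet> x)) * (s * (g \<bullet> y))" by simp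
      also have "\<dots> \<le> ((1 + t) * (f \<bullet> y)) * ((1 + s) * (g \<bullet> x))" using 1 n st by (intro mult_mono[of "t * (f \<bullet> x)"]) auto
      also have "\<dots> = ((1 + t) * (1 + s)) * ((f \<bullet> y) * (g \<bullet> x))" by simp
      also have "\<dots> \<le> (F * (t * s)) * ((f \<bullet> y) * (g \<bullet> x))" using F n by (intro mult_right_mono) auto
      also have "\<dots> = (t * s) * (F * ((f \<bullet> y) * (g \<bullet> x)))" by simp
      finally show "(f \<bullet> x) * (g \<bullet> y) \<le> F * ((f \<bullet> y) * (g \<bullet> x))" using st by (simp only: mult_le_cancel_left_pos mult_pos_pos)
    qed
  qed
qed

text \<open>The line stays in the slice where \<open>u\<close> is 1, which is bounded, so it has a
  last point in the closed cone; from an interior point it could be continued.\<close>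

lemma chord_exists:
  assumes "x \<in> Cn" "u \<bullet> x = 1" "v \<noteq> 0" "u \<bullet> v = 0"
  obtains t where "0 < t" "x + t *\<^sub>R v \<in> K" "x + t *\<^sub>R v \<notin> Cn" "\<And>s. x + s *\<^sub>R v \<in> K \<Longrightarrow> s \<le> t"
proof -
  define S where "S = {s. 0 \<le> s \<and> x + s *\<^sub>R v \<in> K}"
  obtain M where M: "0 < M" "\<And>x. x \<in> K \<Longrightarrow> norm x \<le> M * (u \<bullet> x)" using K_bound by blast
  have bd: "\<bar>s\<bar> * norm v \<le> M + norm x" if "x + s *\<^sub>R v \<in> K" for s
    using M(2)[OF that] assms norm_triangle_ineq4[of "x + s *\<^sub>R v" x] by (simp add: inner_add_right)
  have "S = {0..} \<inter> (\<lambda>s. x + s *\<^sub>R v) -` K" by (auto simp: S_def)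
  moreover have "closed ((\<lambda>s. x + s *\<^sub>R v) -` K)" by (intro continuous_closed_vimage closed_K continuous_intros)
  ultimately have "closed S" using closed_Int[OF closed_atLeast] by metis
  moreover have "norm s \<le> (M + norm x) / norm v" if "s \<in> S" for s
    using bd[of s] that assms(3) by (simp add: S_def field_simps)
  then have "bounded S" unfolding bounded_iff by blast
  ultimately have "compact S" by (simp add: compact_eq_bounded_closed)
  moreover have "0 \<in> S" using assms Cn_subset_K by (simp add: S_def)
  ultimately obtain t where t: "t \<in> S" "\<And>s. s \<in> S \<Longrightarrow> s \<le> t" using compact_attains_sup[of S] by blast
  have max: "s \<le> t" if "x + s *\<^sub>R v \<in> K" for s
    using t(2)[of s] t(1) that by (cases "0 \<le> s") (auto simp: S_def)
  have nC: "x + t *\<^sub>R v \<notin> Cn"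
  proof
    assume "x + t *\<^sub>R v \<in> Cn"
    then obtain e where e: "0 < e" "x + t *\<^sub>R v + e *\<^sub>R v \<in> Cn" by (rule Cn_small_perturb)
    then have "x + (t + e) *\<^sub>R v \<in> K" using Cn_subset_K by (simp add: scaleR_add_left add.assoc)
    then show False using max e(1) by fastforce
  qed
  have "t \<noteq> 0" using nC assms(1) by auto
  then show thesis using that[of t] t(1) nC max by (auto simp: S_def)
qed

lemma chord_ends_exist:
  assumes x: "x \<in> Cn" "u \<bullet> x = 1" and y: "y \<in> Cn" "u \<bullet> y = 1" and ne: "x \<noteq> y"
  shows "\<exists>a b. chord_ends \<Omega> (proj_of x) (proj_of y) a b"
proof -
  have v: "y - x \<noteq> 0" "u \<bullet> (y - x) = 0" "x - y \<noteq> 0" "u \<bullet> (x - y) = 0" using x y ne by (auto simp: inner_diff_right)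
  obtain t where t: "0 < t" "y + t *\<^sub>R (y - x) \<in> K" "y + t *\<^sub>R (y - x) \<notin> Cn"
    "\<And>s. y + s *\<^sub>R (y - x) \<in> K \<Longrightarrow> s \<le> t" using chord_exists[OF y v(1,2)] by blast
  obtain s where s: "0 < s" "x + s *\<^sub>R (x - y) \<in> K" "x + s *\<^sub>R (x - y) \<notin> Cn"
    "\<And>r. x + r *\<^sub>R (x - y) \<in> K \<Longrightarrow> r \<le> s" using chord_exists[OF x v(3,4)] by blast
  define a where "a = x + s *\<^sub>R (x - y)"
  define b where "b = y + t *\<^sub>R (y - x)"
  have a: "a \<in> K" "a \<notin> Cn" "u \<bullet> a = 1" and b: "b \<in> K" "b \<notin> Cn" "u \<bullet> b = 1"
    using s t x y by (simp_all add: a_def b_def inner_add_right inner_diff_right)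
  have nz: "a \<noteq> 0" "b \<noteq> 0" using a(3) b(3) by auto
  note a = a nz(1) and b = b nz(2)
  have xK: "x \<in> K" "x \<noteq> 0" and yK: "y \<in> K" "y \<noteq> 0" using x y Cn_subset_K Cn_nz by auto
  have line: "proj_line (proj_of x) (proj_of y) = proj_subspace (span {x, y})"
  proof -
    have "span (span {x} \<union> span {y}) = span {x, y}"
    proof (intro subset_antisym span_minimal subspace_span)
      show "span {x} \<union> span {y} \<subseteq> span {x, y}" by (intro Un_least span_mono) auto
      show "{x, y} \<subseteq> span (span {x} \<union> span {y})" by (auto intro!: span_base)
    qed
    then show ?thesis by (simp add: proj_line_def Rep_proj_of xK yK)
  qed
  have ab_span: "a \<in> span {x, y}" "b \<in> span {x, y}" unfolding a_def b_def
    by (intro span_add span_scale span_diff span_base; simp)+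
  have "proj_line (proj_of x) (proj_of y) \<inter> closure \<Omega> = proj_segment \<Omega> (proj_of a) (proj_of b)"
  proof (intro subset_antisym subsetI)
    fix p assume "p \<in> proj_line (proj_of x) (proj_of y) \<inter> closure \<Omega>"
    then obtain w where w: "w \<in> K" "w \<noteq> 0" "p = proj_of w" "proj_of w \<in> proj_subspace (span {x, y})"
      unfolding line closure_eq by blast
    then have "w \<in> span {x, y}" by (simp add: proj_of_in_subspace)
    then obtain k1 k2 where k: "w = k1 *\<^sub>R x + k2 *\<^sub>R y" by (auto simp: span_insert span_singleton algebra_simps)
    define d where "d = k1 + k2"
    have d: "0 < d" using u_pos[OF w(1,2)] x y by (simp add: k d_def inner_add_right)
    \<comment> \<open>The two forms give the parameter of the normalised \<open>w\<close> measured
      from \<open>y\<close> and from \<open>x\<close>; maximality of \<open>t\<close> and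
      \<open>s\<close> then makes its coordinates with respect to \<open>a\<close> and
      \<open>b\<close> nonnegative.\<close>
    have e: "inverse d *\<^sub>R w = y + (- k1 / d) *\<^sub>R (y - x)" "inverse d *\<^sub>R w = x + (- k2 / d) *\<^sub>R (x - y)"
    proof -
      have 1: "1 - k1 / d = k2 / d" "1 - k2 / d = k1 / d" using d by (auto simp: d_def field_simps)
      have "y + (- k1 / d) *\<^sub>R (y - x) = (k1 / d) *\<^sub>R x + (1 - k1 / d) *\<^sub>R y" by (simp add: algebra_simps)
      also have "\<dots> = inverse d *\<^sub>R w" unfolding 1 k by (simp add: divide_inverse scaleR_add_right mult.commute)
      finally show "inverse d *\<^sub>R w = y + (- k1 / d) *\<^sub>R (y - x)" by simp
      have "x + (- k2 / d) *\<^sub>R (x - y) = (1 - k2 / d) *\<^sub>R x + (k2 / d) *\<^sub>R y" by (simp add: algebra_simps)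
      also have "\<dots> = inverse d *\<^sub>R w" unfolding 1 k by (simp add: divide_inverse scaleR_add_right mult.commute)
      finally show "inverse d *\<^sub>R w = x + (- k2 / d) *\<^sub>R (x - y)" by simp
    qed
    have "inverse d *\<^sub>R w \<in> K" using w d by (intro K_scale) auto
    then have "- k1 / d \<le> t" "- k2 / d \<le> s" using t(4) s(4) e by metis+
    then have kk: "0 \<le> t * d + k1" "0 \<le> s * d + k2" using d by (auto simp: field_simps)
    have "(t * d + k1) *\<^sub>R a + (s * d + k2) *\<^sub>R b = (d * (1 + s + t)) *\<^sub>R ((k1 / d) *\<^sub>R x + (k2 / d) *\<^sub>R y)"
    proof -
      have c: "(t * d + k1) * (1 + s) - (s * d + k2) * t = (1 + s + t) * k1"
              "(s * d + k2) * (1 + t) - (t * d + k1) * s = (1 + s + t) * k2"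
        by (simp_all add: d_def algebra_simps)
      have "(t * d + k1) *\<^sub>R a + (s * d + k2) *\<^sub>R b = ((t * d + k1) * (1 + s) - (s * d + k2) * t) *\<^sub>R x
         + ((s * d + k2) * (1 + t) - (t * d + k1) * s) *\<^sub>R y"
        by (simp add: a_def b_def algebra_simps)
      then show ?thesis unfolding c using d by (simp add: scaleR_add_right)
    qed
    also have "\<dots> = (1 + s + t) *\<^sub>R w" using d by (simp add: k scaleR_add_right)
    finally have eq: "(t * d + k1) *\<^sub>R a + (s * d + k2) *\<^sub>R b = (1 + s + t) *\<^sub>R w" .
    have "p = proj_of ((t * d + k1) *\<^sub>R a + (s * d + k2) *\<^sub>R b)" unfolding eq using w s t by (simp add: proj_of_scale)
    moreover have "0 < (t * d + k1) + (s * d + k2)"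
    proof -
      have "(t * d + k1) + (s * d + k2) = (1 + s + t) * d" by (simp add: d_def algebra_simps)
      then show ?thesis using d s t by simp
    qed
    ultimately show "p \<in> proj_segment \<Omega> (proj_of a) (proj_of b)"
      unfolding proj_segment_iff[OF a(1,4) b(1,4)] using kk by blast
  next
    fix p assume "p \<in> proj_segment \<Omega> (proj_of a) (proj_of b)"
    then obtain k1 k2 where k: "0 \<le> k1" "0 \<le> k2" "0 < k1 + k2" "p = proj_of (k1 *\<^sub>R a + k2 *\<^sub>R b)"
      unfolding proj_segment_iff[OF a(1,4) b(1,4)] by blast
    have "k1 *\<^sub>R a + k2 *\<^sub>R b \<in> K" using k a b by (intro K_add K_scale)
    moreover have "u \<bullet> (k1 *\<^sub>R a + k2 *\<^sub>R b) = k1 + k2" using a b by (simp add: inner_add_right)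
    then have nz: "k1 *\<^sub>R a + k2 *\<^sub>R b \<noteq> 0" using k by auto
    ultimately have "p \<in> closure \<Omega>" unfolding closure_eq k by blast
    moreover have "k1 *\<^sub>R a + k2 *\<^sub>R b \<in> span {x, y}" by (intro span_add span_scale ab_span)
    ultimately show "p \<in> proj_line (proj_of x) (proj_of y) \<inter> closure \<Omega>"
      unfolding line k using nz by (simp add: proj_of_in_subspace)
  qed
  moreover have "proj_of x \<in> proj_segment \<Omega> (proj_of a) (proj_of y)"
  proof -
    have "a + s *\<^sub>R y = (1 + s) *\<^sub>R x" by (simp add: a_def algebra_simps)
    then have "proj_of x = proj_of (1 *\<^sub>R a + s *\<^sub>R y)" using xK s by (simp add: proj_of_scale)
    then show ?thesis unfolding proj_segment_iff[OF a(1,4) yK] using s by (intro exI[of _ 1] exI[of _ s] conjI) auto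
  qed
  moreover have "proj_of y \<in> proj_segment \<Omega> (proj_of x) (proj_of b)"
  proof -
    have "t *\<^sub>R x + b = (1 + t) *\<^sub>R y" by (simp add: b_def algebra_simps)
    then have "proj_of y = proj_of (t *\<^sub>R x + 1 *\<^sub>R b)" using yK t by (simp add: proj_of_scale)
    then show ?thesis unfolding proj_segment_iff[OF xK b(1,4)] using t by (intro exI[of _ 1] exI[of _ t] conjI) auto
  qed
  moreover have "proj_of a \<in> frontier \<Omega>" "proj_of b \<in> frontier \<Omega>" using frontier_iff a b by auto
  ultimately show ?thesis unfolding chord_ends_def by blast
qed

text \<open>Any admissible pair of ends gives the same value, as the definite description in
  \<open>hilbert_dist\<close> requires: each end lies beyond \<open>x\<close> or \<open>y\<close> on
  their line, so \<open>hd_chord\<close> applies.\<close>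

lemma chord_ends_value:
  assumes x: "x \<in> Cn" "u \<bullet> x = 1" and y: "y \<in> Cn" "u \<bullet> y = 1" and ne: "x \<noteq> y"
    and ends: "chord_ends \<Omega> (proj_of x) (proj_of y) p q"
  shows "1 / 2 * ln ((norm (coord \<Omega> q - coord \<Omega> (proj_of x)) * norm (coord \<Omega> (proj_of y) - coord \<Omega> p)) /
                        (norm (coord \<Omega> q - coord \<Omega> (proj_of y)) * norm (coord \<Omega> (proj_of x) - coord \<Omega> p))) = hd x y"
proof -
  have xK: "x \<in> K" "x \<noteq> 0" and yK: "y \<in> K" "y \<noteq> 0" using x y Cn_subset_K Cn_nz by auto
  have extend: "\<exists>a s. 0 < s \<and> a \<in> K \<and> a \<notin> Cn \<and> a \<noteq> 0 \<and> coord \<Omega> r = a \<and> a = x - s *\<^sub>R (y - x)"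
    if x: "x \<in> Cn" "u \<bullet> x = 1" and y: "y \<in> Cn" "u \<bullet> y = 1" and ne: "x \<noteq> y" and r: "r \<in> frontier \<Omega>"
      and seg: "proj_of x \<in> proj_segment \<Omega> r (proj_of y) \<or> proj_of x \<in> proj_segment \<Omega> (proj_of y) r" for x y r
  proof -
    have xK: "x \<in> K" "x \<noteq> 0" and yK: "y \<in> K" "y \<noteq> 0" using x y Cn_subset_K Cn_nz by auto
    obtain a0 where a0: "a0 \<in> K" "a0 \<noteq> 0" "a0 \<notin> Cn" "r = proj_of a0" using frontierD[OF r] by blast
    define a where "a = nrm a0"
    have ra: "coord \<Omega> r = a" using a0 coord_proj_of by (simp add: a_def)
    have ab: "a \<in> base" unfolding a_def using a0 by (intro nrm_base)
    then have a: "a \<in> K" "u \<bullet> a = 1" "a \<noteq> 0" using base_nz by (auto simp: base_def)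
    have aC: "a \<notin> Cn"
    proof
      assume "a \<in> Cn"
      then have "(u \<bullet> a0) *\<^sub>R a \<in> Cn" using u_pos[OF a0(1,2)] by (intro Cn_scale)
      then show False using a0 u_pos[OF a0(1,2)] by (simp add: a_def nrm_def)
    qed
    have rp: "r = proj_of a" using a0 proj_of_nrm by (simp add: a_def)
    have "\<exists>k1 k2. 0 \<le> k1 \<and> 0 \<le> k2 \<and> 0 < k1 + k2 \<and> proj_of x = proj_of (k1 *\<^sub>R a + k2 *\<^sub>R y)"
      using seg unfolding rp proj_segment_iff[OF a(1,3) yK] proj_segment_iff[OF yK a(1,3)] by (metis add.commute)
    then obtain k1 k2 where k: "0 \<le> k1" "0 \<le> k2" "0 < k1 + k2" "proj_of x = proj_of (k1 *\<^sub>R a + k2 *\<^sub>R y)" by blast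
    have uk: "u \<bullet> (k1 *\<^sub>R a + k2 *\<^sub>R y) = k1 + k2" using a y by (simp add: inner_add_right)
    have nz: "k1 *\<^sub>R a + k2 *\<^sub>R y \<noteq> 0" using uk k by auto
    have "k1 *\<^sub>R a + k2 *\<^sub>R y \<in> K" using k a yK by (intro K_add K_scale)
    then obtain d where d: "0 < d" "k1 *\<^sub>R a + k2 *\<^sub>R y = d *\<^sub>R x" using proj_of_eq_pos[OF _ xK(1) nz xK(2) k(4)[symmetric]] by blast
    have dd: "d = k1 + k2" using uk x by (simp add: d(2))
    have "k1 \<noteq> 0" using d dd ne by auto
    then have k1: "0 < k1" using k by simp
    have "k2 \<noteq> 0" using d dd k1 aC x(1) by auto
    then have k2: "0 < k2" using k by simp
    have "k1 *\<^sub>R a = k1 *\<^sub>R (x - (k2 / k1) *\<^sub>R (y - x))"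
    proof -
      have "k1 *\<^sub>R a = d *\<^sub>R x - k2 *\<^sub>R y" using d(2) by (simp add: algebra_simps)
      then show ?thesis using k1 by (simp add: dd algebra_simps)
    qed
    then have "a = x - (k2 / k1) *\<^sub>R (y - x)" using k1 by simp
    then show ?thesis using a aC ra k1 k2 by (intro exI[of _ a] exI[of _ "k2 / k1"]) simp
  qed
  have "p \<in> frontier \<Omega>" "q \<in> frontier \<Omega>" "proj_of x \<in> proj_segment \<Omega> p (proj_of y)" "proj_of y \<in> proj_segment \<Omega> (proj_of x) q"
    using ends by (auto simp: chord_ends_def)
  then obtain a s b t where a: "0 < s" "a \<in> K" "a \<notin> Cn" "coord \<Omega> p = a" "a = x - s *\<^sub>R (y - x)"
    and b: "0 < t" "b \<in> K" "b \<notin> Cn" "coord \<Omega> q = b" "b = y - t *\<^sub>R (x - y)"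
    using extend[OF x y ne, of p] extend[OF y x ne[symmetric], of q] by metis
  have b': "b = y + t *\<^sub>R (y - x)" unfolding b(5) by (simp add: algebra_simps)
  have c: "coord \<Omega> (proj_of x) = x" "coord \<Omega> (proj_of y) = y"
    using coord_proj_of xK yK x y by (simp_all add: nrm_def)
  define v where "v = y - x"
  have v: "0 < norm v" using ne by (simp add: v_def)
  have 1: "b - x = (1 + t) *\<^sub>R v" "y - a = (1 + s) *\<^sub>R v" "b - y = t *\<^sub>R v" "x - a = s *\<^sub>R v"
    unfolding b' a(5) v_def by (simp_all add: algebra_simps)
  have "(norm (b - x) * norm (y - a)) / (norm (b - y) * norm (x - a)) = ((1 + t) * (1 + s)) / (t * s)"
    unfolding 1 using v a(1) b(1) by simp
  then show ?thesis unfolding c a(4) b(4) using hd_chord[OF x(1) y(1) a(1) b(1)] a b b' by simp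
qed

lemma hilbert_dist_hd: assumes "x \<in> Cn" "y \<in> Cn" shows "hilbert_dist \<Omega> (proj_of x) (proj_of y) = hd x y"
proof -
  define X Y where "X = nrm x" and "Y = nrm y"
  have xK: "x \<in> K" "x \<noteq> 0" "y \<in> K" "y \<noteq> 0" using assms Cn_subset_K Cn_nz by auto
  have P: "proj_of x = proj_of X" "proj_of y = proj_of Y" using proj_of_nrm xK by (auto simp: X_def Y_def)
  have XY: "X \<in> Cn" "Y \<in> Cn" "u \<bullet> X = 1" "u \<bullet> Y = 1"
    using nrm_Cn nrm_base xK assms by (auto simp: X_def Y_def base_def)
  have H: "hd x y = hd X Y" using hd_nrm assms XY by (simp add: X_def Y_def)
  show ?thesis
  proof (cases "proj_of X = proj_of Y")
    case True
    then obtain c where "X = c *\<^sub>R Y" using proj_of_eqD XY Cn_nz by metis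
    then have "X = Y" using XY by auto
    then show ?thesis using H hd_self XY by (simp add: hilbert_dist_def P)
  next
    case False
    then have ne: "X \<noteq> Y" by auto
    obtain a b where ab: "chord_ends \<Omega> (proj_of X) (proj_of Y) a b"
      using chord_ends_exist[OF XY(1,3,2,4) ne] by blast
    have "(THE r. \<exists>a b. chord_ends \<Omega> (proj_of X) (proj_of Y) a b \<and>
        r = 1 / 2 * ln ((norm (coord \<Omega> b - coord \<Omega> (proj_of X)) * norm (coord \<Omega> (proj_of Y) - coord \<Omega> a)) /
                        (norm (coord \<Omega> b - coord \<Omega> (proj_of Y)) * norm (coord \<Omega> (proj_of X) - coord \<Omega> a)))) = hd X Y"
    proof (rule the_equality, goal_cases)
      case 1 then show ?case using ab chord_ends_value[OF XY(1,3,2,4) ne ab] by metis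
    next
      case (2 r) then show ?case using chord_ends_value[OF XY(1,3,2,4) ne] by metis
    qed
    then show ?thesis unfolding P H hilbert_dist_def using False by (simp only: if_False)
  qed
qed

end

section \<open>Lifting an automorphism to the cone\<close>

lemma carrier_PGL: "carrier PGL = (\<lambda>A. scalars #>\<^bsub>GL\<^esub> A) ` {A. invertible A}"
  unfolding PGL_def by (subst carrier_FactGroup) (simp add: GL_def)

lemma PGL_int_pow:
  assumes "invertible A" shows "(scalars #>\<^bsub>GL\<^esub> A) [^]\<^bsub>PGL\<^esub> (k :: int) = scalars #>\<^bsub>GL\<^esub> (A [^]\<^bsub>GL\<^esub> k)"
  unfolding PGL_def using assms by (intro normal.FactGroup_int_pow[OF normal_scalars]) (simp add: GL_def)

lemma scalars_coset_uminus: "scalars #>\<^bsub>GL\<^esub> (- A) = scalars #>\<^bsub>GL\<^esub> A"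
proof -
  have "{c *\<^sub>R (- A) | c. c \<noteq> 0} = {c *\<^sub>R A | c. c \<noteq> 0}"
    by (metis (no_types, opaque_lifting) minus_equation_iff neg_equal_0_iff_equal scaleR_minus_left scaleR_minus_right)
  then show ?thesis unfolding scalars_r_coset .
qed

lemma invertible_mult_nz:
  fixes A :: "real ^ 'n::finite ^ 'n"
  assumes "invertible A" "v \<noteq> 0" shows "A *v v \<noteq> 0"
proof
  assume "A *v v = 0"
  obtain B where "B ** A = mat 1" using assms(1) by (auto simp: invertible_def)
  then have "v = B *v (A *v v)" by (simp add: matrix_vector_mul_assoc)
  then show False using \<open>A *v v = 0\<close> assms(2) by simp
qed

context charted_domain
begin

text \<open>A matrix over \<open>g\<close> is determined up to a scalar; its sign is fixed by one
  point \<open>v0\<close> of the cone, and convexity prevents the sign from changing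
  elsewhere.\<close>

lemma lift_to_cone:
  assumes g: "g \<in> Aut \<Omega>"
  obtains A where "invertible A" "g = scalars #>\<^bsub>GL\<^esub> A" "\<And>v. A *v v \<in> Cn \<longleftrightarrow> v \<in> Cn"
proof -
  obtain A0 where A0: "invertible A0" "g = scalars #>\<^bsub>GL\<^esub> A0" using g by (auto simp: Aut_def carrier_PGL)
  have g\<Omega>: "pgl_act g ` \<Omega> = \<Omega>" using g by (simp add: Aut_def)
  obtain v0 where v0: "v0 \<in> Cn" using Cn_ne by blast
  have "proj_of (A0 *v v0) \<in> \<Omega>"
    using g\<Omega> proj_in_\<Omega>[OF v0] pgl_act_proj_of[OF Cn_nz[OF v0], of A0] A0(2) by (metis imageI)
  then have "A0 *v v0 \<in> Cn \<or> - (A0 *v v0) \<in> Cn"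
    using in_\<Omega>_cases invertible_mult_nz[OF A0(1) Cn_nz[OF v0]] by blast
  moreover have "(- A0) *v v0 = - (A0 *v v0)" by (metis minus_equation_iff scaleR_mat_mult(3) scaleR_minus1_left)
  moreover have "invertible (- A0)" using scalar_invertible[OF _ A0(1), of "- 1"] by simp
  moreover have "g = scalars #>\<^bsub>GL\<^esub> (- A0)" using A0(2) scalars_coset_uminus[of A0] by simp
  ultimately obtain A where A: "invertible A" "g = scalars #>\<^bsub>GL\<^esub> A" "A *v v0 \<in> Cn" using A0 by metis
  have act: "pgl_act g (proj_of v) = proj_of (A *v v)" if "v \<noteq> 0" for v using pgl_act_proj_of[OF that] A(2) by simp
  have in\<Omega>: "proj_of (A *v v) \<in> \<Omega>" if "v \<in> Cn" for v
    using g\<Omega> proj_in_\<Omega>[OF that] act[OF Cn_nz[OF that]] by (metis imageI)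
  have AC: "A *v v \<in> Cn" if v: "v \<in> Cn" for v
  proof (rule ccontr)
    assume "A *v v \<notin> Cn"
    then have "- (A *v v) \<in> Cn" using in_\<Omega>_cases[OF in\<Omega>[OF v]] invertible_mult_nz[OF A(1) Cn_nz[OF v]] by blast
    then have p: "0 < - (u \<bullet> (A *v v))" "0 < u \<bullet> (A *v v0)" using u_pos_Cn A(3) by force+
    \<comment> \<open>If \<open>A *v v\<close> lay in the opposite cone, this point between
      \<open>v0\<close> and \<open>v\<close> would be mapped to the kernel of \<open>u\<close>,
      which the domain avoids.\<close>
    define x where "x = (- (u \<bullet> (A *v v))) *\<^sub>R v0 + (u \<bullet> (A *v v0)) *\<^sub>R v"
    have x: "x \<in> Cn" unfolding x_def by (intro Cn_add Cn_scale v v0 p)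
    have "u \<bullet> (A *v x) = 0"
      by (simp add: x_def matrix_vector_right_distrib matrix_vector_mult_diff_distrib matrix_vector_mult_scaleR inner_add_right inner_diff_right)
    then show False using in\<Omega>[OF x] closure_chart closure_subset
      proj_of_in_chart[OF invertible_mult_nz[OF A(1) Cn_nz[OF x]], of u] by blast
  qed
  have "v \<in> Cn" if v: "A *v v \<in> Cn" for v
  proof -
    \<comment> \<open>\<open>g\<close> maps onto the domain, so \<open>A *v v\<close> is a multiple
      of some \<open>A *v w\<close> with \<open>w\<close> in the cone, and the multiple is positive
      because both images lie in the cone.\<close>
    obtain p where p: "p \<in> \<Omega>" "proj_of (A *v v) = pgl_act g p" using g\<Omega> proj_in_\<Omega>[OF v] by blast
    obtain w where w: "w \<in> Cn" "p = proj_of w" using in_\<Omega>D[OF p(1)] by blast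
    have "proj_of (A *v v) = proj_of (A *v w)" using p w act Cn_nz by simp
    then obtain c where c: "0 < c" "A *v v = c *\<^sub>R (A *v w)"
      using proj_of_eq_pos[of "A *v v" "A *v w"] v AC[OF w(1)] Cn_subset_K Cn_nz by metis
    have "A *v (v - c *\<^sub>R w) = 0" using c by (simp add: matrix_vector_mult_diff_distrib matrix_vector_mult_scaleR)
    then have "v = c *\<^sub>R w" using invertible_mult_nz[OF A(1), of "v - c *\<^sub>R w"] by auto
    then show ?thesis using c w Cn_scale by simp
  qed
  then show thesis using that A(1,2) AC by blast
qed

end

locale lifted_automorphism = charted_domain \<Omega> u + cone_flow "cone_over \<Omega> u" u T
  for \<Omega> :: "'n::finite proj set" and u :: "real ^ 'n" and T :: "int \<Rightarrow> real ^ 'n \<Rightarrow> real ^ 'n" +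
  fixes g :: "(real ^ 'n ^ 'n) set"
  assumes g_Aut: "g \<in> Aut \<Omega>"
    and act: "v \<noteq> 0 \<Longrightarrow> pgl_act (g [^]\<^bsub>PGL\<^esub> (k :: int)) (proj_of v) = proj_of (T k v)"
    and g_eq: "\<exists>A. g = scalars #>\<^bsub>GL\<^esub> A \<and> (\<forall>v. A *v v = T 1 v)"

lemma (in charted_domain) lift_automorphism:
  assumes g: "g \<in> Aut \<Omega>" obtains T where "lifted_automorphism \<Omega> u T g"
proof -
  interpret G: group "GL :: (real ^ 'n ^ 'n) monoid" by (rule group_GL)
  obtain A where A: "invertible A" "g = scalars #>\<^bsub>GL\<^esub> A" "\<And>v. A *v v \<in> Cn \<longleftrightarrow> v \<in> Cn"
    using lift_to_cone[OF g] by blast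
  have AG: "A \<in> carrier GL" using A by (simp add: GL_def)
  define T where "T k v = (A [^]\<^bsub>GL\<^esub> k) *v v" for k :: int and v
  have add: "T (j + k) v = T j (T k v)" for j k v
    using G.int_pow_mult[OF AG, of j k] by (simp add: T_def GL_def matrix_vector_mul_assoc)
  have T0: "T 0 v = v" for v by (simp add: T_def GL_def)
  have T1: "T 1 v = A *v v" for v using G.int_pow_1[OF AG] by (simp add: T_def)
  have TC: "T k v \<in> Cn" if v: "v \<in> Cn" for k v
  proof (induction k rule: int_induct[where k = 0])
    case base then show ?case using v T0 by simp
  next
    case (step1 i)
    then show ?case using A(3) add[of 1 i v] T1 by (simp add: add.commute)
  next
    case (step2 i)
    then show ?case using A(3)[of "T (i - 1) v"] add[of 1 "i - 1" v] T1 by simp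
  qed
  have "lifted_automorphism \<Omega> u T g"
  proof (intro lifted_automorphism.intro charted_domain_axioms cone_flow.intro convex_open_cone_axioms
      cone_flow_axioms.intro lifted_automorphism_axioms.intro)
    show "linear (T k)" for k unfolding T_def by (rule matrix_vector_mul_linear)
    show "pgl_act (g [^]\<^bsub>PGL\<^esub> k) (proj_of v) = proj_of (T k v)" if "v \<noteq> 0" for k :: int and v
      unfolding A(2) PGL_int_pow[OF A(1)] T_def by (rule pgl_act_proj_of[OF that])
    show "\<exists>A. g = scalars #>\<^bsub>GL\<^esub> A \<and> (\<forall>v. A *v v = T 1 v)" using A(2) T1 by auto
  qed (use T0 add TC g in auto)
  then show thesis by (rule that)
qed

context lifted_automorphism
begin

lemma g_carrier: "g \<in> carrier PGL" using g_Aut by (simp add: Aut_def)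

lemma act1: "v \<noteq> 0 \<Longrightarrow> pgl_act g (proj_of v) = proj_of (T 1 v)"
  using act[of v 1] group.int_pow_1[OF group_PGL g_carrier] by simp

lemma generate_iff: "h \<in> generate PGL {g} \<longleftrightarrow> (\<exists>k::int. h = g [^]\<^bsub>PGL\<^esub> k)"
  using group.generate_pow[OF group_PGL g_carrier] by auto

section \<open>Translation length, half triangles and axes in terms of the cone\<close>

lemma translation_length_le: assumes "v \<in> Cn" shows "translation_length \<Omega> g \<le> hd v (T 1 v)"
proof -
  have "translation_length \<Omega> g \<le> hilbert_dist \<Omega> (proj_of v) (pgl_act g (proj_of v))"
    unfolding translation_length_def
  proof (rule cINF_lower[OF bdd_belowI[of _ 0] proj_in_\<Omega>[OF assms]])
    fix r assume "r \<in> (\<lambda>x. hilbert_dist \<Omega> x (pgl_act g x)) ` \<Omega>"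
    then obtain p where p: "p \<in> \<Omega>" "r = hilbert_dist \<Omega> p (pgl_act g p)" by blast
    obtain w where "w \<in> Cn" "p = proj_of w" using in_\<Omega>D[OF p(1)] by blast
    then show "0 \<le> r" using p(2) by (simp add: act1 Cn_nz hilbert_dist_hd T_Cn hd_nonneg)
  qed
  then show ?thesis using assms by (simp add: act1 Cn_nz hilbert_dist_hd T_Cn)
qed

lemma translation_length_ge: assumes "\<And>v. v \<in> Cn \<Longrightarrow> r \<le> hd v (T 1 v)" shows "r \<le> translation_length \<Omega> g"
  unfolding translation_length_def
proof (rule cINF_greatest[OF nonempty])
  fix p assume "p \<in> \<Omega>"
  then obtain w where "w \<in> Cn" "p = proj_of w" using in_\<Omega>D by blast
  then show "r \<le> hilbert_dist \<Omega> p (pgl_act g p)" using assms by (simp add: act1 Cn_nz hilbert_dist_hd T_Cn)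
qed

text \<open>By \<open>Cn_of_sum\<close> a segment between boundary points lies in the boundary as
  soon as its point over \<open>x + y\<close> does. A vector \<open>z\<close> of the open cone
  satisfies the disjunction anyway, so \<open>z\<close> may range over the closed cone.\<close>

lemma not_in_half_triangle_iff:
  assumes ab: "a \<in> K" "b \<in> K" "a \<notin> Cn" "b \<notin> Cn" "a \<noteq> 0" "b \<noteq> 0"
  shows "\<not> in_half_triangle \<Omega> (proj_of a) (proj_of b) \<longleftrightarrow> (\<forall>z\<in>K. z \<noteq> 0 \<longrightarrow> a + z \<in> Cn \<or> z + b \<in> Cn)"
proof -
  have seg: "proj_segment \<Omega> (proj_of x) (proj_of y) \<subseteq> frontier \<Omega> \<longleftrightarrow> x + y \<notin> Cn"
    if x: "x \<in> K" "x \<noteq> 0" "x \<notin> Cn" and y: "y \<in> K" "y \<noteq> 0" "y \<notin> Cn" for x y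
  proof
    assume H: "proj_segment \<Omega> (proj_of x) (proj_of y) \<subseteq> frontier \<Omega>"
    have "proj_of (x + y) \<in> proj_segment \<Omega> (proj_of x) (proj_of y)"
      unfolding proj_segment_iff[OF x(1,2) y(1,2)] by (intro exI[of _ 1] conjI) auto
    then show "x + y \<notin> Cn" using H frontier_iff[OF K_add[OF x(1) y(1)] K_add_nz[OF x(1) y(1) x(2)]] by blast
  next
    assume n: "x + y \<notin> Cn"
    show "proj_segment \<Omega> (proj_of x) (proj_of y) \<subseteq> frontier \<Omega>"
    proof
      fix p assume "p \<in> proj_segment \<Omega> (proj_of x) (proj_of y)"
      then obtain s t where st: "0 \<le> s" "0 \<le> t" "0 < s + t" "p = proj_of (s *\<^sub>R x + t *\<^sub>R y)"
        unfolding proj_segment_iff[OF x(1,2) y(1,2)] by blast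
      have cone: "z \<in> Cn" if "0 < r" "r *\<^sub>R z \<in> Cn" for r z
        using Cn_scale[OF that(2), of "inverse r"] that(1) by simp
      have "s *\<^sub>R x + t *\<^sub>R y \<notin> Cn"
      proof (cases "s = 0 \<or> t = 0")
        case True then show ?thesis using st cone x(3) y(3) by auto
      next
        case False then show ?thesis using st Cn_of_sum[OF x(1) y(1), of s t] n by auto
      qed
      moreover have "s *\<^sub>R x + t *\<^sub>R y \<in> K" using st x y by (intro K_add K_scale)
      moreover have "s *\<^sub>R x + t *\<^sub>R y \<noteq> 0"
      proof (cases "s = 0")
        case True then show ?thesis using st y by auto
      next
        case False then show ?thesis using st x y by (intro K_add_nz K_scale) auto
      qed
      ultimately show "p \<in> frontier \<Omega>" using frontier_iff st(4) by blast
    qed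
  qed
  show ?thesis
  proof
    assume H: "\<not> in_half_triangle \<Omega> (proj_of a) (proj_of b)"
    show "\<forall>z\<in>K. z \<noteq> 0 \<longrightarrow> a + z \<in> Cn \<or> z + b \<in> Cn"
    proof (intro ballI impI, rule ccontr)
      fix z assume z: "z \<in> K" "z \<noteq> 0" and n: "\<not> (a + z \<in> Cn \<or> z + b \<in> Cn)"
      have zC: "z \<notin> Cn" using n Cn_K_add[OF _ ab(2), of z] by blast
      have "proj_of z \<in> frontier \<Omega>" using frontier_iff z zC by blast
      moreover have "proj_segment \<Omega> (proj_of a) (proj_of z) \<union> proj_segment \<Omega> (proj_of z) (proj_of b) \<subseteq> frontier \<Omega>"
        using seg[OF ab(1,5,3) z zC] seg[OF z zC ab(2,6,4)] n by blast
      ultimately show False using H unfolding in_half_triangle_def by blast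
    qed
  next
    assume H: "\<forall>z\<in>K. z \<noteq> 0 \<longrightarrow> a + z \<in> Cn \<or> z + b \<in> Cn"
    show "\<not> in_half_triangle \<Omega> (proj_of a) (proj_of b)"
    proof
      assume "in_half_triangle \<Omega> (proj_of a) (proj_of b)"
      then obtain p where p: "p \<in> frontier \<Omega>" "proj_segment \<Omega> (proj_of a) p \<subseteq> frontier \<Omega>" "proj_segment \<Omega> p (proj_of b) \<subseteq> frontier \<Omega>"
        unfolding in_half_triangle_def by blast
      obtain z where z: "z \<in> K" "z \<noteq> 0" "z \<notin> Cn" "p = proj_of z" using frontierD[OF p(1)] by blast
      show False using H z(1,2) p(2,3) seg[OF ab(1,5,3) z(1-3)] seg[OF z(1-3) ab(2,6,4)] z(4) by blast
    qed
  qed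
qed

lemma is_axisD:
  assumes "is_axis \<Omega> g p q"
  obtains a b where "p = proj_of a" "q = proj_of b" "a \<in> K" "b \<in> K" "a \<notin> Cn" "b \<notin> Cn" "a \<noteq> 0" "b \<noteq> 0" "a + b \<in> Cn"
    "T 1 a \<in> span {a, b}" "T 1 b \<in> span {a, b}"
proof -
  have pq: "p \<in> frontier \<Omega>" "q \<in> frontier \<Omega>" "p \<noteq> q" using assms by (auto simp: is_axis_def)
  obtain V where V: "subspace V" "dim V = 2" "\<And>A. A \<in> g \<Longrightarrow> (\<lambda>v. A *v v) ` V \<subseteq> V"
    "proj_subspace V \<inter> \<Omega> = open_proj_segment \<Omega> p q"
    using assms by (auto simp: is_axis_def)
  obtain a where a: "a \<in> K" "a \<noteq> 0" "a \<notin> Cn" "p = proj_of a" using frontierD[OF pq(1)] by blast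
  obtain b where b: "b \<in> K" "b \<noteq> 0" "b \<notin> Cn" "q = proj_of b" using frontierD[OF pq(2)] by blast
  have ndep: "a \<noteq> c *\<^sub>R b" for c
  proof
    assume e: "a = c *\<^sub>R b"
    then have "c \<noteq> 0" using a by auto
    then show False using e a b pq(3) proj_of_scale[of c b] by simp
  qed
  have ndep': "b \<noteq> c *\<^sub>R a" for c
  proof
    assume e: "b = c *\<^sub>R a"
    then have "c \<noteq> 0" using b by auto
    then show False using e a b pq(3) proj_of_scale[of c a] by simp
  qed
  have mid: "s *\<^sub>R a + t *\<^sub>R b \<in> V \<and> s *\<^sub>R a + t *\<^sub>R b \<in> Cn" if st: "0 < s" "0 < t" for s t
  proof -
    let ?w = "s *\<^sub>R a + t *\<^sub>R b"
    have w: "?w \<in> K" using st a b by (intro K_add K_scale) auto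
    have w: "?w \<in> K" "?w \<noteq> 0" using w K_add_nz[of "s *\<^sub>R a" "t *\<^sub>R b"] K_scale st a b by auto
    have "proj_of ?w \<noteq> p"
    proof
      assume "proj_of ?w = p"
      then obtain c where "?w = c *\<^sub>R a" using proj_of_eqD[OF _ w(2) a(2)] a(4) by blast
      then have "t *\<^sub>R b = (c - s) *\<^sub>R a" by (simp add: algebra_simps)
      then have "b = ((c - s) / t) *\<^sub>R a" using st by (metis divide_inverse_commute less_irrefl real_vector_eq_affinity scaleR_scaleR scaleR_left_imp_eq right_inverse scaleR_one mult.commute)
      then show False using ndep' by blast
    qed
    moreover have "proj_of ?w \<noteq> q"
    proof
      assume "proj_of ?w = q"
      then obtain c where "?w = c *\<^sub>R b" using proj_of_eqD[OF _ w(2) b(2)] b(4) by blast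
      then have "s *\<^sub>R a = (c - t) *\<^sub>R b" by (simp add: algebra_simps)
      then have "inverse s *\<^sub>R (s *\<^sub>R a) = inverse s *\<^sub>R ((c - t) *\<^sub>R b)" by simp
      then have "a = (inverse s * (c - t)) *\<^sub>R b" using st by simp
      then show False using ndep by blast
    qed
    moreover have "proj_of ?w \<in> proj_segment \<Omega> p q"
      unfolding a(4) b(4) proj_segment_iff[OF a(1,2) b(1,2)] using st by (intro exI[of _ s] exI[of _ t] conjI) auto
    ultimately have "proj_of ?w \<in> proj_subspace V \<inter> \<Omega>" unfolding V(4) open_proj_segment_def by blast
    then show ?thesis using proj_of_in_subspace[OF V(1) w(2)] proj_K_in_\<Omega>[OF w] by blast
  qed
  have m1: "a + b \<in> V" "a + b \<in> Cn" using mid[of 1 1] by simp_all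
  have m2: "2 *\<^sub>R a + b \<in> V" "a + 2 *\<^sub>R b \<in> V" using mid[of 2 1] mid[of 1 2] by simp_all
  \<comment> \<open>The definition of an axis only places the open segment in \<open>V\<close>; its
    ends are recovered as differences.\<close>
  have "a = (2 *\<^sub>R a + b) - (a + b)" "b = (a + 2 *\<^sub>R b) - (a + b)" by (simp_all add: scaleR_2)
  then have abV: "a \<in> V" "b \<in> V" using subspace_diff[OF V(1)] m1(1) m2 by metis+
  have "a \<notin> span {b}" using ndep by (auto simp: span_singleton)
  then have "dim (span {a, b}) = 2" using b(2) by (simp add: dim_insert)
  moreover have "span {a, b} \<subseteq> V" using abV V(1) by (intro span_minimal) auto
  ultimately have spV: "span {a, b} = V" using V(1,2) by (intro subspace_dim_equal) auto
  obtain A where A: "g = scalars #>\<^bsub>GL\<^esub> A" "\<And>v. A *v v = T 1 v" using g_eq by blast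
  have "A \<in> g" unfolding A(1) scalars_r_coset by (auto intro!: exI[of _ 1])
  then have "T 1 a \<in> V" "T 1 b \<in> V" using V(3)[of A] A(2) abV by auto
  then show thesis using that[OF a(4) b(4) a(1) b(1) a(3) b(3) a(2) b(2) m1(2)] spV by simp
qed

lemma is_axisI:
  assumes ab: "a \<in> K" "b \<in> K" "a \<notin> Cn" "b \<notin> Cn" "a + b \<in> Cn"
    and T: "T 1 a = l *\<^sub>R a" "T 1 b = m *\<^sub>R b"
  shows "is_axis \<Omega> g (proj_of a) (proj_of b)"
proof -
  obtain f where f: "f \<in> dual" "f \<noteq> 0" "f \<bullet> a = 0" using support_K ab by blast
  obtain h where h: "h \<in> dual" "h \<noteq> 0" "h \<bullet> b = 0" using support_K ab by blast
  have fh: "0 < f \<bullet> b" "0 < h \<bullet> a"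
    using dual_pos[OF f(1,2) ab(5)] dual_pos[OF h(1,2) ab(5)] f h by (auto simp: inner_add_right)
  have nz: "a \<noteq> 0" "b \<noteq> 0" using fh by auto
  have nsp: "a \<notin> span {b}" using h fh by (auto simp: span_singleton)
  have ne: "proj_of a \<noteq> proj_of b"
  proof
    assume "proj_of a = proj_of b"
    then obtain c where "a = c *\<^sub>R b" using proj_of_eqD nz by blast
    then show False using h fh by simp
  qed
  define V where "V = span {a, b}"
  have d: "dim V = 2" unfolding V_def using nsp nz by (simp add: dim_insert)
  have inv: "(\<lambda>v. A *v v) ` V \<subseteq> V" if A: "A \<in> g" for A
  proof -
    obtain A0 where A0: "g = scalars #>\<^bsub>GL\<^esub> A0" "\<And>v. A0 *v v = T 1 v" using g_eq by blast
    then obtain c where c: "A = c *\<^sub>R A0" using A unfolding A0(1) scalars_r_coset by blast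
    then have Av: "A *v v = c *\<^sub>R T 1 v" for v using A0 by (simp add: scaleR_mat_mult)
    have "(\<lambda>v. A *v v) ` V = span ((\<lambda>v. A *v v) ` {a, b})"
      unfolding V_def by (rule linear_span_image[symmetric, OF matrix_vector_mul_linear])
    also have "\<dots> \<subseteq> V" unfolding V_def using span_scale[OF span_base[of a "{a, b}"]] span_scale[OF span_base[of b "{a, b}"]]
      by (intro span_minimal) (auto simp: Av T)
    finally show ?thesis .
  qed
  have "proj_subspace V \<inter> \<Omega> = open_proj_segment \<Omega> (proj_of a) (proj_of b)"
  proof (intro subset_antisym subsetI)
    fix p assume p: "p \<in> proj_subspace V \<inter> \<Omega>"
    then obtain v where v: "v \<in> Cn" "p = proj_of v" using in_\<Omega>D by blast
    have "v \<in> V" using p v proj_of_in_subspace[of V v] Cn_nz by (simp add: V_def)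
    then obtain s t where st: "v = s *\<^sub>R a + t *\<^sub>R b" by (auto simp: V_def span_insert span_singleton algebra_simps)
    have "0 < t * (f \<bullet> b)" "0 < s * (h \<bullet> a)"
      using dual_pos[OF f(1,2) v(1)] dual_pos[OF h(1,2) v(1)] f h by (auto simp: st inner_add_right)
    then have "0 < t" "0 < s" using fh by (auto simp: zero_less_mult_iff)
    then have "p \<in> proj_segment \<Omega> (proj_of a) (proj_of b)"
      unfolding proj_segment_iff[OF ab(1) nz(1) ab(2) nz(2)] v(2) st by (intro exI[of _ s] exI[of _ t] conjI) auto
    moreover have "p \<noteq> proj_of a" "p \<noteq> proj_of b" using p proj_K_in_\<Omega> ab nz by auto
    ultimately show "p \<in> open_proj_segment \<Omega> (proj_of a) (proj_of b)" by (simp add: open_proj_segment_def)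
  next
    fix p assume p: "p \<in> open_proj_segment \<Omega> (proj_of a) (proj_of b)"
    then obtain s t where st: "0 \<le> s" "0 \<le> t" "0 < s + t" "p = proj_of (s *\<^sub>R a + t *\<^sub>R b)"
      unfolding open_proj_segment_def using proj_segment_iff[OF ab(1) nz(1) ab(2) nz(2)] by blast
    have "s \<noteq> 0" using p st nz proj_of_scale[of t b] by (auto simp: open_proj_segment_def)
    moreover have "t \<noteq> 0" using p st nz proj_of_scale[of s a] by (auto simp: open_proj_segment_def)
    ultimately have C: "s *\<^sub>R a + t *\<^sub>R b \<in> Cn" using st by (intro Cn_of_sum' ab) auto
    have "s *\<^sub>R a + t *\<^sub>R b \<in> V" unfolding V_def by (intro span_add span_scale span_base) auto
    then show "p \<in> proj_subspace V \<inter> \<Omega>"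
      using C st(4) proj_in_\<Omega> proj_of_in_subspace[of V] Cn_nz by (simp add: V_def)
  qed
  moreover have "proj_of a \<in> frontier \<Omega>" "proj_of b \<in> frontier \<Omega>" using frontier_iff ab nz by auto
  moreover have "subspace V" by (simp add: V_def)
  ultimately show ?thesis unfolding is_axis_def using ne d inv by blast
qed

section \<open>The two implications for a lifted automorphism\<close>

lemma setdist_le:
  assumes "x \<in> Cn" "y \<in> Cn" "q \<in> Cn" "0 \<le> s" "0 \<le> t" "0 < s + t" "hd (s *\<^sub>R x + t *\<^sub>R y) q \<le> r"
  shows "hilbert_setdist \<Omega> (proj_segment \<Omega> (proj_of x) (proj_of y)) (proj_of q) \<le> r"
  unfolding hilbert_setdist_def
proof (rule cINF_lower2[OF bdd_belowI[of _ 0]])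
  note xy = Cn_subset_K[OF assms(1)] Cn_nz[OF assms(1)] Cn_subset_K[OF assms(2)] Cn_nz[OF assms(2)]
  show "proj_of (s *\<^sub>R x + t *\<^sub>R y) \<in> proj_segment \<Omega> (proj_of x) (proj_of y)"
    unfolding proj_segment_iff[OF xy] using assms by blast
  show "hilbert_dist \<Omega> (proj_of (s *\<^sub>R x + t *\<^sub>R y)) (proj_of q) \<le> r"
    using hilbert_dist_hd[OF hd_segment(1)[OF assms(1,2,4-6)] assms(3)] assms(7) by simp
  fix d assume "d \<in> (\<lambda>z. hilbert_dist \<Omega> z (proj_of q)) ` proj_segment \<Omega> (proj_of x) (proj_of y)"
  then obtain s' t' where st: "0 \<le> s'" "0 \<le> t'" "0 < s' + t'" "d = hilbert_dist \<Omega> (proj_of (s' *\<^sub>R x + t' *\<^sub>R y)) (proj_of q)"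
    using proj_segment_iff[OF xy] by auto
  then show "0 \<le> d" using hilbert_dist_hd[OF hd_segment(1)[OF assms(1,2) st(1-3)] assms(3)]
    hd_nonneg[OF hd_segment(1)[OF assms(1,2) st(1-3)] assms(3)] by simp
qed

text \<open>The distance to a segment is an infimum; the slack of 1 yields a point whether or not it
  is attained.\<close>

lemma setdist_leD:
  assumes "x \<in> Cn" "y \<in> Cn" "q \<in> Cn" "hilbert_setdist \<Omega> (proj_segment \<Omega> (proj_of x) (proj_of y)) (proj_of q) \<le> r"
  shows "\<exists>s\<ge>0. \<exists>t\<ge>0. 0 < s + t \<and> hd (s *\<^sub>R x + t *\<^sub>R y) q \<le> r + 1"
proof (rule ccontr)
  assume n: "\<not> ?thesis"
  note xy = Cn_subset_K[OF assms(1)] Cn_nz[OF assms(1)] Cn_subset_K[OF assms(2)] Cn_nz[OF assms(2)]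
  have "proj_of (1 *\<^sub>R x + 1 *\<^sub>R y) \<in> proj_segment \<Omega> (proj_of x) (proj_of y)"
    unfolding proj_segment_iff[OF xy] by (intro exI[of _ 1] conjI) auto
  then have "r + 1 \<le> hilbert_setdist \<Omega> (proj_segment \<Omega> (proj_of x) (proj_of y)) (proj_of q)"
    unfolding hilbert_setdist_def
  proof (intro cINF_greatest)
    fix p assume "p \<in> proj_segment \<Omega> (proj_of x) (proj_of y)"
    then obtain s t where st: "0 \<le> s" "0 \<le> t" "0 < s + t" "p = proj_of (s *\<^sub>R x + t *\<^sub>R y)"
      using proj_segment_iff[OF xy] by auto
    have "r + 1 < hd (s *\<^sub>R x + t *\<^sub>R y) q" using n st(1-3) by (meson not_le)
    then show "r + 1 \<le> hilbert_dist \<Omega> p (proj_of q)"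
      using hilbert_dist_hd[OF hd_segment(1)[OF assms(1,2) st(1-3)] assms(3)] st(4) by simp
  qed auto
  then show False using assms(4) by simp
qed

lemma orbit_dist:
  assumes "v \<in> Cn"
  shows "hilbert_dist \<Omega> (pgl_act (g [^]\<^bsub>PGL\<^esub> (m::int)) (proj_of v)) (pgl_act (g [^]\<^bsub>PGL\<^esub> (n::int)) (proj_of v)) = hd (T m v) (T n v)"
  using assms by (simp add: act Cn_nz hilbert_dist_hd T_Cn)

lemma hyperbolic_imp_contracting:
  assumes "hyperbolic_flow Cn u T a b fa fb l m"
  shows "contracting_element \<Omega> g"
proof -
  interpret H: hyperbolic_flow Cn u T a b fa fb l m by (rule assms)
  define L where "L = l / m"
  have L: "1 < L" using H.m_pos H.m_less by (simp add: L_def)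
  then have lnL: "0 < ln L" by simp
  have lm: "0 < l" "0 < m" using H.l_pos H.m_pos by auto
  define x0 where "x0 = proj_of (a + b)"
  \<comment> \<open>\<open>A\<close> is the axis and \<open>B\<close> a fundamental domain in it:
    one step of the flow multiplies the ratio \<open>s / t\<close> by \<open>L\<close>.\<close>
  define A where "A = {proj_of (s *\<^sub>R a + t *\<^sub>R b) | s t. 0 < s \<and> 0 < t}"
  define B where "B = {proj_of (s *\<^sub>R a + t *\<^sub>R b) | s t. 0 < t \<and> t \<le> s \<and> s \<le> L * t}"
  have Tab: "T k (s *\<^sub>R a + t *\<^sub>R b) = (s * l powi k) *\<^sub>R a + (t * m powi k) *\<^sub>R b" for k s t
    by (simp add: T_lin H.Tk)
  have x0\<Omega>: "x0 \<in> \<Omega>" using proj_in_\<Omega>[OF H.ab] by (simp add: x0_def)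
  have A\<Omega>: "A \<subseteq> \<Omega>" unfolding A_def using H.axis_Cn proj_in_\<Omega> by blast
  have x0A: "x0 \<in> A" unfolding A_def x0_def by (intro CollectI exI[of _ 1] conjI) auto
  have orbit: "hd (T i (a + b)) (T j (a + b)) = ln L / 2 * \<bar>of_int i - of_int j\<bar>" for i j
  proof -
    have "hd (T i (a + b)) (T j (a + b)) = 1 / 2 * \<bar>ln ((l powi i * m powi j) / (l powi j * m powi i))\<bar>"
      using Tab[of i 1 1] Tab[of j 1 1] lm by (simp add: H.hd_axis)
    also have "(l powi i * m powi j) / (l powi j * m powi i) = L powi (i - j)"
      using lm L by (simp add: L_def power_int_divide_distrib power_int_diff field_simps)
    also have "ln (L powi (i - j)) = (of_int i - of_int j) * ln L" using L powi_exp[of L "i - j"] by simp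
    finally show ?thesis using lnL by (simp add: abs_mult)
  qed
  have "infinite (generate PGL {g})"
  proof -
    have "inj (\<lambda>k::int. g [^]\<^bsub>PGL\<^esub> k)"
    proof (rule injI)
      fix i j :: int assume "g [^]\<^bsub>PGL\<^esub> i = g [^]\<^bsub>PGL\<^esub> j"
      then have "ln L / 2 * \<bar>real_of_int i - of_int j\<bar> = ln L / 2 * \<bar>real_of_int i - of_int i\<bar>"
        unfolding orbit[symmetric] orbit_dist[OF H.ab, symmetric] by simp
      then show "i = j" using lnL by simp
    qed
    moreover have "generate PGL {g} = range (\<lambda>k::int. g [^]\<^bsub>PGL\<^esub> k)" using generate_iff by auto
    ultimately show ?thesis using finite_imageD infinite_UNIV_int by metis
  qed
  moreover have "qi_embedded_orbit \<Omega> g x0"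
  proof -
    define \<theta> where "\<theta> = ln L / 2"
    have \<theta>: "0 < \<theta>" using lnL by (simp add: \<theta>_def)
    define Q where "Q = max 1 (max \<theta> (1 / \<theta>))"
    have Q: "1 \<le> Q" "\<theta> \<le> Q" "1 / \<theta> \<le> Q" by (auto simp: Q_def)
    then have Q': "1 / Q \<le> \<theta>" using \<theta> by (simp add: field_simps)
    have "1 / Q * \<bar>real_of_int i - real_of_int j\<bar> - 0 \<le> \<theta> * \<bar>real_of_int i - real_of_int j\<bar>" for i j
      using mult_right_mono[OF Q', of "\<bar>real_of_int i - real_of_int j\<bar>"] by simp
    moreover have "\<theta> * \<bar>real_of_int i - real_of_int j\<bar> \<le> Q * \<bar>real_of_int i - real_of_int j\<bar> + 0" for i j
      using mult_right_mono[OF Q(2), of "\<bar>real_of_int i - real_of_int j\<bar>"] by simp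
    ultimately show ?thesis unfolding qi_embedded_orbit_def Let_def x0_def orbit_dist[OF H.ab] orbit \<theta>_def[symmetric]
      using Q(1) by (intro exI[of _ Q] exI[of _ 0]) simp
  qed
  moreover have A_inv: "pgl_act (g [^]\<^bsub>PGL\<^esub> k) ` A = A" for k :: int
  proof -
    have sub: "pgl_act (g [^]\<^bsub>PGL\<^esub> k) p \<in> A" if p: "p \<in> A" for k :: int and p
    proof -
      obtain s t where st: "0 < s" "0 < t" "p = proj_of (s *\<^sub>R a + t *\<^sub>R b)" using p by (auto simp: A_def)
      have "pgl_act (g [^]\<^bsub>PGL\<^esub> k) p = proj_of ((s * l powi k) *\<^sub>R a + (t * m powi k) *\<^sub>R b)"
        unfolding st(3) act[OF Cn_nz[OF H.axis_Cn[OF st(1,2)]]] Tab ..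
      then show ?thesis using st lm unfolding A_def by fastforce
    qed
    have "p \<in> pgl_act (g [^]\<^bsub>PGL\<^esub> k) ` A" if p: "p \<in> A" for p
    proof -
      obtain s t where st: "0 < s" "0 < t" "p = proj_of (s *\<^sub>R a + t *\<^sub>R b)" using p by (auto simp: A_def)
      note C = H.axis_Cn[OF st(1,2)]
      have "pgl_act (g [^]\<^bsub>PGL\<^esub> k) (pgl_act (g [^]\<^bsub>PGL\<^esub> (- k)) p) = p"
        unfolding st(3) using C by (simp add: act Cn_nz T_Cn T_nz T_inv del: T_lin)
      then show ?thesis using sub[OF p, of "- k"] by (metis imageI)
    qed
    then show ?thesis using sub by blast
  qed
  moreover have "\<exists>C. PS_contracting \<Omega> C A"
  proof -
    obtain c where c: "\<And>x y. x \<in> Cn \<Longrightarrow> y \<in> Cn \<Longrightarrow> c \<le> hd (H.axis_proj x) (H.axis_proj y) \<Longrightarrow>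
     \<exists>s\<ge>0. \<exists>t\<ge>0. 0 < s + t \<and> hd (s *\<^sub>R x + t *\<^sub>R y) (H.axis_proj x) \<le> c" using H.axis_contracting by blast
    define C where "C = max c 0"
    have C: "c \<le> C" "0 \<le> C" by (auto simp: C_def)
    \<comment> \<open>\<open>axis_proj\<close> is linear, so passing to the normalised coordinate
      does not change the line of the image.\<close>
    define \<pi> where "\<pi> p = proj_of (H.axis_proj (coord \<Omega> p))" for p
    have \<pi>: "\<pi> (proj_of v) = proj_of (H.axis_proj v)" if v: "v \<in> Cn" for v
      using coord_proj_of[OF Cn_subset_K[OF v] Cn_nz[OF v]] u_pos_Cn[OF v] H.axis_proj_Cn[OF v]
      by (simp add: \<pi>_def nrm_def H.axis_proj_scale proj_of_scale Cn_nz)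
    have contr: "\<exists>s\<ge>0. \<exists>t\<ge>0. 0 < s + t \<and> hd (s *\<^sub>R x + t *\<^sub>R y) (H.axis_proj x) \<le> C"
      if "x \<in> Cn" "y \<in> Cn" "C \<le> hd (H.axis_proj x) (H.axis_proj y)" for x y
      using c[OF that(1,2)] that(3) C by (meson order_trans)
    have "PS_contracting \<Omega> C A" unfolding PS_contracting_def
    proof (intro conjI A\<Omega> exI[of _ \<pi>] ballI impI)
      show "\<pi> ` \<Omega> \<subseteq> A"
      proof
        fix p assume "p \<in> \<pi> ` \<Omega>"
        then obtain v where v: "v \<in> Cn" "p = \<pi> (proj_of v)" using in_\<Omega>D by blast
        then show "p \<in> A" using H.f_pos[OF v(1)] unfolding \<pi>[OF v(1)] v(2) A_def H.axis_proj_def by blast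
      qed
      fix x assume "x \<in> A"
      then obtain s t where st: "0 < s" "0 < t" "x = proj_of (s *\<^sub>R a + t *\<^sub>R b)" by (auto simp: A_def)
      note Ca = H.axis_Cn[OF st(1,2)]
      have "H.axis_proj (s *\<^sub>R a + t *\<^sub>R b) = s *\<^sub>R a + t *\<^sub>R b"
        using H.fa H.fb by (simp add: H.axis_proj_def inner_add_right)
      then show "hilbert_dist \<Omega> x (\<pi> x) \<le> C" unfolding st(3) \<pi>[OF Ca] using hilbert_dist_hd[OF Ca Ca] hd_self[OF Ca] C by simp
    next
      fix x y assume "x \<in> \<Omega>" "y \<in> \<Omega>" and far: "C \<le> hilbert_dist \<Omega> (\<pi> x) (\<pi> y)"
      then obtain v w where v: "v \<in> Cn" "x = proj_of v" and w: "w \<in> Cn" "y = proj_of w" using in_\<Omega>D by metis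
      have far': "C \<le> hd (H.axis_proj v) (H.axis_proj w)"
        using far unfolding v(2) w(2) \<pi>[OF v(1)] \<pi>[OF w(1)] by (simp add: hilbert_dist_hd H.axis_proj_Cn v w)
      obtain s t where 1: "0 \<le> s" "0 \<le> t" "0 < s + t" "hd (s *\<^sub>R v + t *\<^sub>R w) (H.axis_proj v) \<le> C"
        using contr[OF v(1) w(1) far'] by blast
      then show "hilbert_setdist \<Omega> (proj_segment \<Omega> x y) (\<pi> x) \<le> C"
        unfolding v(2) w(2) \<pi>[OF v(1)] by (intro setdist_le[OF v(1) w(1) H.axis_proj_Cn[OF v(1)]])
      \<comment> \<open>The estimate at the second point is the first one with the two points
        exchanged.\<close>
      have "C \<le> hd (H.axis_proj w) (H.axis_proj v)" using far' hd_sym H.axis_proj_Cn v w by simp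
      then obtain s t where 2: "0 \<le> s" "0 \<le> t" "0 < s + t" "hd (s *\<^sub>R w + t *\<^sub>R v) (H.axis_proj w) \<le> C"
        using contr[OF w(1) v(1)] by blast
      have "hd (t *\<^sub>R v + s *\<^sub>R w) (H.axis_proj w) \<le> C" using 2(4) by (simp add: add.commute)
      then show "hilbert_setdist \<Omega> (proj_segment \<Omega> x y) (\<pi> y) \<le> C"
        unfolding v(2) w(2) \<pi>[OF w(1)] using 2 by (intro setdist_le[OF v(1) w(1) H.axis_proj_Cn[OF w(1)], of t s]) auto
    qed
    then show ?thesis by blast
  qed
  moreover have "acts_coboundedly \<Omega> (generate PGL {g}) A" unfolding acts_coboundedly_def
  proof (intro exI[of _ B] conjI)
    show BA: "B \<subseteq> A" unfolding A_def B_def by fastforce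
    show "\<exists>R. \<forall>x\<in>B. \<forall>y\<in>B. hilbert_dist \<Omega> x y \<le> R"
    proof (intro exI[of _ "ln L / 2"] ballI)
      fix x y assume "x \<in> B" "y \<in> B"
      then obtain s t s' t' where st: "0 < t" "t \<le> s" "s \<le> L * t" "x = proj_of (s *\<^sub>R a + t *\<^sub>R b)"
        and st': "0 < t'" "t' \<le> s'" "s' \<le> L * t'" "y = proj_of (s' *\<^sub>R a + t' *\<^sub>R b)"
        unfolding B_def by blast
      have p: "0 < s" "0 < s'" using st st' by auto
      let ?q = "s * t' / (s' * t)"
      have q: "0 < ?q" using p st st' by simp
      have "s * t' \<le> (L * t) * s'" using st st' p by (intro mult_mono) auto
      then have "?q \<le> L" using p st by (simp add: field_simps)
      then have 1: "ln ?q \<le> ln L" using q by simp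
      have "s' * t \<le> (L * t') * s" using st st' p by (intro mult_mono) auto
      then have "1 / ?q \<le> L" using p st st' by (simp add: field_simps)
      then have "ln (1 / ?q) \<le> ln L" using q L p st(1) st'(1) by (subst ln_le_cancel_iff) auto
      moreover have "ln (1 / r) = - ln r" if "0 < r" for r :: real using that by (simp add: ln_div)
      ultimately have 2: "- ln ?q \<le> ln L" using q by metis
      have "hilbert_dist \<Omega> x y = 1 / 2 * \<bar>ln ?q\<bar>"
        using hilbert_dist_hd[OF H.axis_Cn[OF p(1) st(1)] H.axis_Cn[OF p(2) st'(1)]]
          H.hd_axis[OF p(1) st(1) p(2) st'(1)] st(4) st'(4) by simp
      then show "hilbert_dist \<Omega> x y \<le> ln L / 2" using 1 2 by linarith
    qed
    show "A = (\<Union>h\<in>generate PGL {g}. pgl_act h ` B)"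
    proof (intro subset_antisym subsetI)
      fix p assume p: "p \<in> A"
      then obtain s t where st: "0 < s" "0 < t" "p = proj_of (s *\<^sub>R a + t *\<^sub>R b)" by (auto simp: A_def)
      obtain k where k: "1 \<le> L powi k * (s / t)" "L powi k * (s / t) \<le> L" using powi_normalise[OF L, of "s / t"] st by auto
      have Lk: "L powi k * (s / t) = (s * l powi k) / (t * m powi k)" by (simp add: L_def power_int_divide_distrib mult.commute)
      have tm: "0 < t * m powi k" using st lm by simp
      have "t * m powi k \<le> s * l powi k" "s * l powi k \<le> L * (t * m powi k)"
        using k tm unfolding Lk by (simp_all add: pos_le_divide_eq pos_divide_le_eq)
      then have "proj_of (T k (s *\<^sub>R a + t *\<^sub>R b)) \<in> B" unfolding Tab B_def using tm by blast
      moreover have "p = pgl_act (g [^]\<^bsub>PGL\<^esub> (- k)) (proj_of (T k (s *\<^sub>R a + t *\<^sub>R b)))"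
        using act[OF Cn_nz[OF T_Cn[OF H.axis_Cn[OF st(1,2)]]]] st(3) by (simp add: T_inv)
      ultimately show "p \<in> (\<Union>h\<in>generate PGL {g}. pgl_act h ` B)" using generate_iff by blast
    next
      fix p assume "p \<in> (\<Union>h\<in>generate PGL {g}. pgl_act h ` B)"
      then obtain k :: int and q where "q \<in> B" "p = pgl_act (g [^]\<^bsub>PGL\<^esub> k) q" using generate_iff by auto
      then show "p \<in> A" using A_inv[of k] BA by blast
    qed
  qed
  ultimately show ?thesis unfolding contracting_element_def using g_Aut x0\<Omega> x0A A\<Omega> generate_iff by metis
qed

theorem rank_one_imp_contracting:
  assumes "rank_one_isometry \<Omega> g" shows "contracting_element \<Omega> g"
proof -
  have tl: "0 < translation_length \<Omega> g" using assms by (simp add: rank_one_isometry_def)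
  obtain p q where ax: "is_axis \<Omega> g p q" "\<not> in_half_triangle \<Omega> p q"
    using assms unfolding rank_one_isometry_def by blast
  obtain a b where ab: "p = proj_of a" "q = proj_of b" "a \<in> K" "b \<in> K" "a \<notin> Cn" "b \<notin> Cn" "a \<noteq> 0" "b \<noteq> 0" "a + b \<in> Cn"
    "T 1 a \<in> span {a, b}" "T 1 b \<in> span {a, b}" using is_axisD[OF ax(1)] by metis
  have nofix: "0 < hd x (T 1 x)" if "x \<in> Cn" for x using translation_length_le[OF that] tl by simp
  obtain l m where lm: "0 < l" "0 < m" "l \<noteq> m" "T 1 a = l *\<^sub>R a" "T 1 b = m *\<^sub>R b"
    using axis_eigenvectors[OF ab(3-6) ab(9-11) nofix] by blast
  have ht: "a + z \<in> Cn \<or> z + b \<in> Cn" if "z \<in> K" "z \<noteq> 0" for z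
    using ax(2) not_in_half_triangle_iff[OF ab(3-8)] ab(1,2) that by simp
  have ba: "b + a \<in> Cn" using ab(9) by (simp add: add.commute)
  obtain fb where fb: "fb \<in> dual" "fb \<bullet> a = 0" "fb \<bullet> b = 1" "\<And>x. fb \<bullet> T 1 x = m * (fb \<bullet> x)"
    using invariant_functional[OF ab(3,5) lm(4,5,2) ab(9)] by blast
  obtain fa where fa: "fa \<in> dual" "fa \<bullet> b = 0" "fa \<bullet> a = 1" "\<And>x. fa \<bullet> T 1 x = l * (fa \<bullet> x)"
    using invariant_functional[OF ab(4,6) lm(5,4,1) ba] by blast
  show ?thesis
  \<comment> \<open>The end with the larger eigenvalue is attracting; the other case exchanges the
    two ends.\<close>
  proof (cases "m < l")
    case True
    have "hyperbolic_flow Cn u T a b fa fb l m"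
      by unfold_locales (use ab fa fb lm ht True in auto)
    then show ?thesis by (rule hyperbolic_imp_contracting)
  next
    case False
    have ht': "b + z \<in> Cn \<or> z + a \<in> Cn" if "z \<in> K" "z \<noteq> 0" for z
      using ht[OF that] by (metis add.commute)
    have "hyperbolic_flow Cn u T b a fb fa m l"
      by unfold_locales (use ab ba fa fb lm ht' False in auto)
    then show ?thesis by (rule hyperbolic_imp_contracting)
  qed
qed

text \<open>Coboundedness places every point of \<open>A\<close> within \<open>R\<close> of the
  orbit, so the projection can be recorded by an orbit index. The quasi-isometry translates
  distances of projections to gaps of indices.\<close>

lemma contracting_imp_flow:
  assumes "contracting_element \<Omega> g"
  obtains x0 J c \<kappa> where "contracting_flow Cn u T x0 J c \<kappa>"
proof -
  obtain p0 A C where p0: "p0 \<in> \<Omega>" "qi_embedded_orbit \<Omega> g p0" "p0 \<in> A" "A \<subseteq> \<Omega>"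
    and inv: "\<forall>h\<in>generate PGL {g}. pgl_act h ` A = A"
    and PS: "PS_contracting \<Omega> C A" and cob: "acts_coboundedly \<Omega> (generate PGL {g}) A"
    using assms unfolding contracting_element_def by (elim bexE conjE exE) (rule that; assumption)
  have A_inv: "pgl_act h ` A = A" if "h \<in> generate PGL {g}" for h using inv that by (rule bspec)
  obtain B R where B': "B \<subseteq> A" "\<forall>x\<in>B. \<forall>y\<in>B. hilbert_dist \<Omega> x y \<le> R" "A = (\<Union>h\<in>generate PGL {g}. pgl_act h ` B)"
    using cob unfolding acts_coboundedly_def by (elim conjE exE) (rule that; assumption)
  have B: "B \<subseteq> A" "\<And>x y. x \<in> B \<Longrightarrow> y \<in> B \<Longrightarrow> hilbert_dist \<Omega> x y \<le> R" "A = (\<Union>h\<in>generate PGL {g}. pgl_act h ` B)"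
    using B'(1,2) by (blast, blast, intro B'(3))
  obtain \<pi> where \<pi>: "\<pi> ` \<Omega> \<subseteq> A" "\<And>x. x \<in> A \<Longrightarrow> hilbert_dist \<Omega> x (\<pi> x) \<le> C"
    "\<And>x y. x \<in> \<Omega> \<Longrightarrow> y \<in> \<Omega> \<Longrightarrow> C \<le> hilbert_dist \<Omega> (\<pi> x) (\<pi> y) \<Longrightarrow>
        hilbert_setdist \<Omega> (proj_segment \<Omega> x y) (\<pi> x) \<le> C"
    using PS unfolding PS_contracting_def by blast
  obtain Q L where QL: "1 \<le> Q" "0 \<le> L"
    "\<And>i j :: int. 1 / Q * \<bar>real_of_int i - real_of_int j\<bar> - L \<le>
      hilbert_dist \<Omega> (pgl_act (g [^]\<^bsub>PGL\<^esub> i) p0) (pgl_act (g [^]\<^bsub>PGL\<^esub> j) p0)"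
    using p0(2) unfolding qi_embedded_orbit_def Let_def by blast
  obtain x0 where x0: "x0 \<in> Cn" "p0 = proj_of x0" using in_\<Omega>D[OF p0(1)] by blast
  have qi: "\<bar>real_of_int i - real_of_int j\<bar> \<le> Q * (hd (T i x0) (T j x0) + L)" for i j
    using QL(3)[of i j] QL(1) unfolding x0(2) orbit_dist[OF x0(1)] by (simp add: field_simps)
  have rep: "\<exists>k::int. \<exists>v\<in>Cn. proj_of v \<in> B \<and> q = proj_of (T k v)" if "q \<in> A" for q
  proof -
    obtain k :: int and r where r: "r \<in> B" "q = pgl_act (g [^]\<^bsub>PGL\<^esub> k) r" using \<open>q \<in> A\<close> B(3) generate_iff by auto
    obtain v where v: "v \<in> Cn" "r = proj_of v" using in_\<Omega>D r(1) B(1) p0(4) by blast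
    then show ?thesis using r act[OF Cn_nz[OF v(1)]] by auto
  qed
  obtain k0 v0 where k0: "v0 \<in> Cn" "proj_of v0 \<in> B" "p0 = proj_of (T k0 v0)" using rep[OF p0(3)] by blast
  obtain c0 where c0: "0 < c0" "x0 = c0 *\<^sub>R T k0 v0"
    using proj_of_eq_pos[of x0 "T k0 v0"] x0 k0 T_Cn Cn_subset_K Cn_nz by metis
  have near: "\<exists>j. \<exists>y\<in>Cn. q = proj_of y \<and> hd y (T j x0) \<le> R" if q: "q \<in> A" for q
  proof -
    obtain k v where v: "v \<in> Cn" "proj_of v \<in> B" "q = proj_of (T k v)" using rep[OF q] by blast
    \<comment> \<open>The base point lies in the k0-th translate of \<open>B\<close>, so its image
      at time \<open>k - k0\<close> lies in the same translate as \<open>q\<close>.\<close>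
    have "T (k - k0) x0 = c0 *\<^sub>R T k v0" using T_add[of "k - k0" k0 v0] by (simp add: c0(2) T_lin)
    then have "hd (T k v) (T (k - k0) x0) = hd (1 *\<^sub>R T k v) (c0 *\<^sub>R T k v0)" by simp
    also have "\<dots> = hd v v0" using v k0 c0 T_Cn by (subst hd_scale) (auto simp: hd_T)
    also have "\<dots> \<le> R" using B(2)[OF v(2) k0(2)] hilbert_dist_hd[OF v(1) k0(1)] by simp
    finally show ?thesis using v T_Cn by blast
  qed
  have "\<forall>x\<in>Cn. \<exists>j. \<exists>y\<in>Cn. \<pi> (proj_of x) = proj_of y \<and> hd y (T j x0) \<le> R"
    using near \<pi>(1) proj_in_\<Omega> by blast
  then obtain J P where JP: "\<And>x. x \<in> Cn \<Longrightarrow> P x \<in> Cn" "\<And>x. x \<in> Cn \<Longrightarrow> \<pi> (proj_of x) = proj_of (P x)"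
    "\<And>x. x \<in> Cn \<Longrightarrow> hd (P x) (T (J x) x0) \<le> R" by metis
  have w: "T k x0 \<in> Cn" for k using T_Cn x0 by blast
  have wA: "proj_of (T k x0) \<in> A" for k
  proof -
    have "pgl_act (g [^]\<^bsub>PGL\<^esub> k) p0 \<in> A" using A_inv[of "g [^]\<^bsub>PGL\<^esub> k"] generate_iff p0(3) by blast
    then show ?thesis using act[OF Cn_nz[OF x0(1)]] x0(2) by simp
  qed
  have R: "0 \<le> R" using JP(3)[OF x0(1)] hd_nonneg[OF JP(1)[OF x0(1)] w, of "J x0"] by linarith
  have wP: "hd (T k x0) (P (T k x0)) \<le> C" for k
    using \<pi>(2)[OF wA[of k]] JP(2)[OF w[of k]] hilbert_dist_hd[OF w[of k] JP(1)[OF w[of k]]] by simp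
  have C: "0 \<le> C" using wP[of 0] hd_nonneg[OF w JP(1)[OF w], of 0 0] by linarith
  \<comment> \<open>The term with \<open>Q\<close> converts distances to index gaps;
    \<open>C + 1 + R\<close> bounds the distance from a segment to the orbit, with the slack 1 of
    \<open>setdist_leD\<close>; \<open>L\<close> is the additive constant of the
    quasi-isometry.\<close>
  define c where "c = Q * (C + 2 * R + L) + C + 1 + R + L"
  have Qp: "0 \<le> Q * (C + 2 * R + L)" using QL C R by simp
  have c: "Q * (C + R + L) \<le> c" "Q * (C + 2 * R + L) \<le> c" "C + 1 + R \<le> c" "L \<le> c" "0 \<le> c"
  proof -
    have "Q * (C + R + L) \<le> Q * (C + 2 * R + L)" using QL R by (intro mult_left_mono) auto
    with QL C R Qp show "Q * (C + R + L) \<le> c" "Q * (C + 2 * R + L) \<le> c" "C + 1 + R \<le> c" "L \<le> c" "0 \<le> c"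
      unfolding c_def by linarith+
  qed
  have "contracting_flow Cn u T x0 J c (1 / Q)"
  proof (unfold_locales, goal_cases)
    case 1 show ?case by (rule x0(1))
  next
    case 2 show ?case by (rule c(5))
  next
    case 3 show ?case using QL by simp
  next
    case (4 k)
    show ?case using QL(3)[of 0 k] c(4) unfolding x0(2) orbit_dist[OF x0(1)] by (simp add: T_0)
  next
    case (5 k)
    have "hd (T (J (T k x0)) x0) (T k x0) \<le> hd (T (J (T k x0)) x0) (P (T k x0)) + hd (P (T k x0)) (T k x0)"
      using w JP(1) by (intro hd_triangle) auto
    also have "\<dots> \<le> R + C" using JP(3)[OF w[of k]] wP[of k] hd_sym[OF w JP(1)[OF w]] by (metis add_mono)
    finally have "Q * (hd (T (J (T k x0)) x0) (T k x0) + L) \<le> Q * (C + R + L)" using QL by (intro mult_left_mono) auto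
    then show ?case using qi[of "J (T k x0)" k] c(1) by simp
  next
    case (6 x y)
    have x: "x \<in> Cn" and y: "y \<in> Cn" and far: "c \<le> \<bar>real_of_int (J x) - real_of_int (J y)\<bar>" using 6 by auto
    \<comment> \<open>An index gap of \<open>c\<close> puts the orbit points at least
      \<open>C + 2 R\<close> apart, hence the projections, each within \<open>R\<close> of its orbit
      point, at least \<open>C\<close>.\<close>
    have "Q * (C + 2 * R + L) \<le> Q * (hd (T (J x) x0) (T (J y) x0) + L)" using far qi[of "J x" "J y"] c(2) by linarith
    then have 1: "C + 2 * R \<le> hd (T (J x) x0) (T (J y) x0)" using QL(1) by (simp add: mult_le_cancel_left_pos)
    have "hd (T (J x) x0) (T (J y) x0) \<le> hd (T (J x) x0) (P x) + hd (P x) (T (J y) x0)"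
      using w JP(1) x by (intro hd_triangle) auto
    also have "hd (P x) (T (J y) x0) \<le> hd (P x) (P y) + hd (P y) (T (J y) x0)"
      using w JP(1) x y by (intro hd_triangle) auto
    finally have "C \<le> hd (P x) (P y)"
      using 1 JP(3)[OF x] JP(3)[OF y] hd_sym[OF w JP(1)[OF x], of "J x"] by simp
    then have "hilbert_setdist \<Omega> (proj_segment \<Omega> (proj_of x) (proj_of y)) (proj_of (P x)) \<le> C"
      using \<pi>(3)[OF proj_in_\<Omega>[OF x] proj_in_\<Omega>[OF y]] JP(1,2) x y hilbert_dist_hd by metis
    then obtain s t where st: "0 \<le> s" "0 \<le> t" "0 < s + t" "hd (s *\<^sub>R x + t *\<^sub>R y) (P x) \<le> C + 1"
      using setdist_leD[OF x y JP(1)[OF x]] by blast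
    have "hd (s *\<^sub>R x + t *\<^sub>R y) (T (J x) x0) \<le> hd (s *\<^sub>R x + t *\<^sub>R y) (P x) + hd (P x) (T (J x) x0)"
      by (intro hd_triangle hd_segment(1) x y st(1-3) JP(1) w)
    then show ?case using st JP(3)[OF x] c(3) by (intro exI[of _ s] exI[of _ t]) auto
  qed
  then show thesis by (rule that)
qed

theorem contracting_imp_rank_one:
  assumes "contracting_element \<Omega> g" shows "rank_one_isometry \<Omega> g"
proof -
  obtain x0 J c \<kappa> where "contracting_flow Cn u T x0 J c \<kappa>" using contracting_imp_flow[OF assms] by blast
  then interpret C: contracting_flow Cn u T x0 J c \<kappa> .
  have "\<kappa> \<le> translation_length \<Omega> g" by (rule translation_length_ge) (rule C.translation_lower)
  then have tl: "0 < translation_length \<Omega> g" using C.\<kappa>_pos by simp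
  obtain a b l m where "a \<in> K" "b \<in> K" "a \<notin> Cn" "b \<notin> Cn" "a + b \<in> Cn" "T 1 a = l *\<^sub>R a" "T 1 b = m *\<^sub>R b"
    using C.exists_axis by metis
  then have ax: "is_axis \<Omega> g (proj_of a) (proj_of b)" by (rule is_axisI)
  \<comment> \<open>The condition concerns every axis, not only the one just found. Each has
    eigenvectors with distinct eigenvalues at its ends, since fixed points in the domain are
    excluded.\<close>
  have "\<not> in_half_triangle \<Omega> p q" if pq: "is_axis \<Omega> g p q" for p q
  proof -
    obtain a b where ab: "p = proj_of a" "q = proj_of b" "a \<in> K" "b \<in> K" "a \<notin> Cn" "b \<notin> Cn" "a \<noteq> 0" "b \<noteq> 0" "a + b \<in> Cn"
      "T 1 a \<in> span {a, b}" "T 1 b \<in> span {a, b}" using is_axisD[OF pq] by metis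
    have nofix: "0 < hd x (T 1 x)" if "x \<in> Cn" for x using C.translation_lower[OF that] C.\<kappa>_pos by simp
    obtain l m where lm: "0 < l" "0 < m" "l \<noteq> m" "T 1 a = l *\<^sub>R a" "T 1 b = m *\<^sub>R b"
      using axis_eigenvectors[OF ab(3-6) ab(9-11) nofix] by blast
    have ba: "b + a \<in> Cn" using ab(9) by (simp add: add.commute)
    have "a + z \<in> Cn \<or> z + b \<in> Cn" if z: "z \<in> K" "z \<noteq> 0" for z
    proof (cases "m < l")
      case True
      then show ?thesis by (rule C.no_half_triangle_at_axis[OF ab(3-6,9) lm(4,5,2) _ z])
    next
      case False
      then have "l < m" using lm by simp
      then have "b + z \<in> Cn \<or> z + a \<in> Cn"
        by (rule C.no_half_triangle_at_axis[OF ab(4,3,6,5) ba lm(5,4,1) _ z])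
      then show ?thesis by (metis add.commute)
    qed
    then show ?thesis unfolding ab(1,2) not_in_half_triangle_iff[OF ab(3-8)] by blast
  qed
  then show ?thesis unfolding rank_one_isometry_def using g_Aut tl ax by blast
qed

end

theorem theorem1p2:
  fixes \<Omega> :: "'n::finite proj set" and \<gamma> :: "(real ^ 'n ^ 'n) set"
  assumes "properly_convex_domain \<Omega>" and "\<gamma> \<in> Aut \<Omega>"
  shows "contracting_element \<Omega> \<gamma> \<longleftrightarrow> rank_one_isometry \<Omega> \<gamma>"
proof -
  \<comment> \<open>The same choice as in the definition of \<open>coord\<close>.\<close>
  define u where "u = (SOME u. adapted_chart \<Omega> u)"
  have "adapted_chart \<Omega> u" unfolding u_def using assms(1) by (auto simp: properly_convex_domain_def intro: someI_ex)
  then interpret charted_domain \<Omega> u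
    using assms(1) by unfold_locales (auto simp: properly_convex_domain_def coord_def u_def)
  obtain T where "lifted_automorphism \<Omega> u T \<gamma>" using lift_automorphism[OF assms(2)] by blast
  then interpret lifted_automorphism \<Omega> u T \<gamma> .
  show ?thesis using contracting_imp_rank_one rank_one_imp_contracting by blast
qed

end
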